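(* Let $d\ge 5$, let $0<\gamma<d-2$, and put $p_N=N^{-\gamma}$. Let $\Omega_N\subseteq Q_N$ be the binomial random subset obtained by retaining each point of $Q_N$ independently with probability $p_N$. For every $0<\delta<1$ there exist integers $s>r\ge 2$ and $J\ge 0$ depending only on $d$ and $\delta$, the finite set $$\mathcal Q=\{r^j s^{J-j}:0\le j\le J\},$$ and constants $c_0=c_0(d,\delta)>0$, $c_1=c_1(d,\delta)>0$, $c_2=c_2(d,\delta)>0$ and $\mathfrak c=\mathfrak c(d,\delta,\gamma)>0$ such that, for all sufficiently large $N$, with probability at least $1-\exp(-\mathfrak c N^{d-\gamma})$, every subset $B\subseteq\Omega_N$ satisfying $|B|\ge\delta|\Omega_N|$ has the following property: for every integer $\lambda$ satisfying $$c_1 p_N^{-2/(d-2)}\le\lambda\le c_2N^2,$$ we have $$\frac1{|Q_N|}\sum_{\mathbf x\in\mathbb Z^d}\mathbf 1_B(\mathbf x)\sum_{j=0}^{J}A^{(r^j)}_{s^{2(J-j)}\lambda}\mathbf 1_B(\mathbf x)\ \ge\ c_0\,p_N^2 .$$ Moreover, if $\rho_N$ denotes the probability that the preceding conclusion (that every $B\subseteq\Omega_N$ with $|B|\ge\delta|\Omega_N|$ satisfies the displayed inequality for every integer $\lambda$ in the stated range) fails, then $|\log\rho_N|\simeq_{d,\delta,\gamma}N^{d-\gamma}$ for all sufficiently large $N$.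
   Context: For $N,\lambda\in\mathbb N$: $Q_N=[-N,N]^d\cap\mathbb Z^d$ and $S_\lambda=\{\mathbf v\in\mathbb Z^d:|\mathbf v|^2=\lambda\}$ with $|\cdot|$ the Euclidean norm. For $q\in\mathbb N$ and $f:\mathbb Z^d\to\mathbb R$, the dilated spherical average is $A_\lambda^{(q)}f(\mathbf x)=\frac1{|S_\lambda|}\sum_{\mathbf v\in S_\lambda}f(\mathbf x+q\mathbf v)$. $\mathbf 1_B$ is the indicator function of $B$. The notation $a\simeq_\kappa b$ means $C^{-1}b\le a\le Cb$ for some constant $C>0$ depending only on $\kappa$. *)

theory Defs
  imports "HOL-Probability.Probability"
begin

definition cube :: "nat \<Rightarrow> (int ^ 'd) set" where
  "cube N = {x. \<forall>i. \<bar>x $ i\<bar> \<le> int N}"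

(* int ^ 'd carries no norm of its own, so points are embedded into real ^ 'd. *)
definition lattice_sphere :: "nat \<Rightarrow> (int ^ 'd) set" where
  "lattice_sphere l = {v. (norm (\<chi> i. real_of_int (v $ i)))\<^sup>2 = real l}"

definition spherical_avg ::
    "nat \<Rightarrow> nat \<Rightarrow> (int ^ 'd \<Rightarrow> real) \<Rightarrow> int ^ 'd \<Rightarrow> real" where
  "spherical_avg q l f x =
     (\<Sum>v\<in>lattice_sphere l. f (x + int q *s v)) / real (card (lattice_sphere l :: (int ^ 'd) set))"

(* Each point of the finite set Q is retained independently with probability p. *)
definition binomial_subset :: "'a set \<Rightarrow> real \<Rightarrow> 'a set pmf" where
  "binomial_subset Q p =
     map_pmf (\<lambda>\<omega>. {x \<in> Q. \<omega> x}) (Pi_pmf Q False (\<lambda>_. bernoulli_pmf p))"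

(* The j-th average only involves points at distance r ^ j * s ^ (J - j) * sqrt l from x.
   The outer sum over the whole lattice has finite support when \<Omega> is finite; it is written
   with infsum because sum over an infinite set is 0. *)
definition dense_subsets_rich ::
    "nat \<Rightarrow> nat \<Rightarrow> nat \<Rightarrow> real \<Rightarrow> real \<Rightarrow> real \<Rightarrow> real \<Rightarrow> nat \<Rightarrow> real \<Rightarrow> (int ^ 'd) set \<Rightarrow> bool" where
  "dense_subsets_rich r s J c0 c1 c2 \<delta> N p \<Omega> \<longleftrightarrow>
     (\<forall>B. B \<subseteq> \<Omega> \<and> real (card B) \<ge> \<delta> * real (card \<Omega>) \<longrightarrow>
       (\<forall>l::nat. c1 * p powr (-2 / (real CARD('d) - 2)) \<le> real l \<and> real l \<le> c2 * (real N)\<^sup>2 \<longrightarrow>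
         (\<Sum>\<^sub>\<infinity>x\<in>UNIV. indicat_real B x *
             (\<Sum>j=0..J. spherical_avg (r ^ j) (s ^ (2 * (J - j)) * l) (indicat_real B) x))
           / real (card (cube N :: (int ^ 'd) set))
         \<ge> c0 * p\<^sup>2))"

lemma finite_cube: "finite (cube N :: (int ^ 'd) set)"
proof -
  have "cube N \<subseteq> (\<lambda>f. \<chi> i. f i) ` (PiE (UNIV :: 'd set) (\<lambda>_. {- int N..int N}))"
  proof
    fix x :: "int ^ 'd" assume "x \<in> cube N"
    then have "($) x \<in> PiE UNIV (\<lambda>_. {- int N..int N})"
      by (auto simp: cube_def abs_le_iff minus_le_iff)
    then show "x \<in> (\<lambda>f. \<chi> i. f i) ` (PiE (UNIV :: 'd set) (\<lambda>_. {- int N..int N}))"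
      by (intro image_eqI[of _ _ "($) x"]) auto
  qed
  then show ?thesis
    by (rule finite_subset) (intro finite_imageI finite_PiE; simp)
qed

lemma finite_lattice_sphere: "finite (lattice_sphere l :: (int ^ 'd) set)"
proof (rule finite_subset[OF _ finite_cube])
  show "lattice_sphere l \<subseteq> (cube l :: (int ^ 'd) set)"
  proof
    fix v :: "int ^ 'd" assume v: "v \<in> lattice_sphere l"
    have "\<bar>v $ i\<bar> \<le> int l" for i
    proof -
      have "\<bar>real_of_int (v $ i)\<bar> \<le> norm (\<chi> i. real_of_int (v $ i))"
        using component_le_norm_cart[of "\<chi> i. real_of_int (v $ i)" i] by simp
      then have "(real_of_int (v $ i))\<^sup>2 \<le> real l"
        using v power_mono[of "\<bar>real_of_int (v $ i)\<bar>" _ 2] by (fastforce simp: lattice_sphere_def)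
      then have "(v $ i)\<^sup>2 \<le> int l"
        by (metis of_int_le_iff of_int_of_nat_eq of_int_power)
      moreover have "\<bar>v $ i\<bar> \<le> (v $ i)\<^sup>2"
        using self_le_power[of "\<bar>v $ i\<bar>" 2] by (cases "v $ i = 0") auto
      ultimately show ?thesis by linarith
    qed
    then show "v \<in> cube l" by (simp add: cube_def)
  qed
qed

end

theory Submission
  imports Defs "HOL-Number_Theory.Number_Theory" "HOL-Real_Asymp.Real_Asymp"
begin

text \<open>
  Write \<open>n\<close> for the number of points of the cube and fix a radius \<open>l\<close>. Let \<open>edge_weight r s J l x y\<close> be
  the sum over \<open>j\<close> of the proportion of vectors \<open>v\<close> on the sphere of squared radius \<open>s^(2(J-j)) l\<close>
  with \<open>x + r^j v = y\<close>. The sum in the theorem is the total weight of the pairs in \<open>B \<times> B\<close>, so the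
  theorem is a counting statement in a weighted graph, relative to a sparse random set. Three
  ingredients are enough.

  \<^emph>\<open>Dense sets carry weight\<close> (\<open>supersaturation\<close>). If \<open>A\<close> has at least \<open>\<alpha> n\<close> points of the cube, the
  pairs in \<open>A \<times> A\<close> have weight at least \<open>card A\<close>. On a large discrete torus this weight is the average
  of the squared Fourier transform of \<open>A\<close> against the sum over \<open>j\<close> of multipliers \<open>m j\<close>, the
  normalised exponential sums over the spheres. A multiplier that is not small forces its frequency
  to be close to a rational point of bounded denominator (\<open>esum_decay\<close>). As \<open>r\<close> is a multiple of all
  these denominators and \<open>s\<close> is much larger than \<open>r\<close>, the next dilations then carry the frequency so
  close to an integer point that all later multipliers have nonnegative real part. Hence
  at most one of the \<open>J + 1\<close> multipliers is substantially negative, at every frequency. At frequencies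
  near \<open>0\<close> all of them are close to \<open>1\<close>, and these frequencies carry at least a fixed multiple of \<open>\<alpha>\<close> of the
  mass. So a number \<open>J\<close> of dilations of order \<open>1 / \<alpha>\<close> makes the sum positive.

  \<^emph>\<open>No pair is heavy.\<close> A weight is at most \<open>J + 1\<close> over the size of a sphere, and a sphere of squared
  radius \<open>l\<close> has at least \<open>c l^((d-2)/2)\<close> points (\<open>card_sphere_ge\<close>). So all weights are at most a small
  multiple of \<open>p\<close> as soon as \<open>l\<close> is at least a constant times \<open>p^(-2/(d-2))\<close>.

  \<^emph>\<open>Containers\<close> (\<open>container\<close>). A set \<open>B\<close> with few weighted pairs has a fingerprint \<open>F\<close> of at most a small
  multiple of \<open>p n\<close> points that determines a set \<open>C F\<close> covering most of the remaining part of \<open>B\<close>, and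
  no point of \<open>C F\<close> has weight 1 or more into \<open>C F\<close>. By supersaturation \<open>C F\<close> has at most \<open>\<alpha> n\<close>
  points. If \<open>B\<close> has at least \<open>\<delta>\<close> times as many points as the random set, the random set must contain
  \<open>F\<close> and have far more points in \<open>C F\<close> than expected. The exponential moment
  bound for the latter survives the union over all \<open>F\<close>, because containing \<open>F\<close> costs a factor
  \<open>p^(card F)\<close>. The failure probability for one \<open>l\<close> is therefore at most \<open>exp (- c p n)\<close>, and only
  polynomially many \<open>l\<close> occur. In the other direction the random set is empty with probability
  \<open>(1 - p)^n\<close>, and the empty set fails.

  The arithmetic input, \<open>esum_decay\<close> and \<open>card_sphere_ge\<close>, comes from the circle method. A
  trapezoidal weight replaces the sharp cutoff of the quadratic exponential sums, so that geometric
  sums decay quadratically, Weyl's inequality holds without a logarithm, and five of the \<open>d\<close> factors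
  give a convergent sum over all arcs. The lower bound for spheres avoids singular series: spheres
  whose squared radii are close and congruent modulo \<open>2 q0!\<close> have sizes that differ by
  \<open>O (N^(d-2) / sqrt q0)\<close>, where \<open>N\<close> is the radius, whereas counting solutions modulo \<open>M = 2 q0!\<close> shows that
  their average size is at least a constant times \<open>N^(d-2) \<phi>(M) / M\<close>, and \<open>\<phi>(M) / M\<close> is at least of order
  \<open>q0^(-1/3)\<close>.
\<close>

section \<open>Exponential sums and summation by parts\<close>

definition ee :: "real \<Rightarrow> complex" where "ee x = cis (2 * pi * x)"

lemma ee_add: "ee (x + y) = ee x * ee y"
  by (simp add: ee_def cis_mult distrib_left)

lemma ee_0 [simp]: "ee 0 = 1" by (simp add: ee_def)

lemma norm_ee [simp]: "norm (ee x) = 1" by (simp add: ee_def)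

lemma ee_of_int [simp]: "ee (of_int n) = 1"
  by (simp add: ee_def cis_multiple_2pi)

lemma cnj_ee: "cnj (ee x) = ee (- x)"
  by (simp add: ee_def cis_cnj)

lemma ee_add_int [simp]: "ee (x + of_int n) = ee x" "ee (of_int n + x) = ee x"
  by (simp_all add: ee_add)

lemma ee_sum: "finite A \<Longrightarrow> ee (\<Sum>i\<in>A. f i) = (\<Prod>i\<in>A. ee (f i))"
  by (induction A rule: finite_induct) (auto simp: ee_add)

text \<open>
  Distance to the nearest integer.
\<close>

definition nint :: "real \<Rightarrow> real" where "nint x = \<bar>x - of_int (round x)\<bar>"

lemma nint_nonneg [simp]: "0 \<le> nint x" by (simp add: nint_def)

lemma nint_le_half: "nint x \<le> 1/2"
  using of_int_round_abs_le[of x] by (simp add: nint_def abs_minus_commute)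

lemma nint_le: "nint x \<le> \<bar>x - of_int n\<bar>"
  unfolding nint_def using round_diff_minimal[of x n] by simp

lemma nint_le_abs: "nint x \<le> \<bar>x\<bar>"
  using nint_le[of x 0] by simp

lemma nint_add_int [simp]: "nint (x + of_int n) = nint x"
proof (rule antisym)
  show "nint (x + of_int n) \<le> nint x"
    using nint_le[of "x + of_int n" "round x + n"] by (simp add: nint_def)
  show "nint x \<le> nint (x + of_int n)"
    using nint_le[of "x" "round (x + of_int n) - n"] by (simp add: nint_def algebra_simps)
qed

lemma nint_diff_le: "nint x - nint y \<le> \<bar>x - y\<bar>"
  using nint_le[of x "round y"] unfolding nint_def by linarith

lemma nint_eq_abs: assumes "\<bar>x\<bar> \<le> 1/2" shows "nint x = \<bar>x\<bar>"
proof -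
  have "\<bar>x\<bar> \<le> \<bar>x - of_int n\<bar>" for n :: int
  proof (cases "n = 0")
    case False
    then have "1 \<le> \<bar>real_of_int n\<bar>" by linarith
    then show ?thesis using assms by linarith
  qed simp
  then show ?thesis using nint_le_abs[of x] by (simp add: nint_def antisym)
qed

lemma nint_of_int_mult: "nint (of_int n * x) \<le> \<bar>of_int n\<bar> * nint x"
proof -
  have "nint (of_int n * x) \<le> \<bar>of_int n * x - of_int (n * round x)\<bar>" by (rule nint_le)
  also have "\<dots> = \<bar>of_int n\<bar> * nint x" by (simp add: nint_def abs_mult[symmetric] right_diff_distrib)
  finally show ?thesis .
qed

lemma norm_one_minus_cis: "norm (1 - cis \<theta>) = 2 * \<bar>sin (\<theta> / 2)\<bar>"
proof -
  have "(norm (1 - cis \<theta>))\<^sup>2 = (1 - cos \<theta>)\<^sup>2 + (sin \<theta>)\<^sup>2"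
    by (simp add: cmod_power2)
  also have "\<dots> = 2 - 2 * cos \<theta>"
    using sin_cos_squared_add[of \<theta>] by (simp add: power2_eq_square algebra_simps)
  also have "\<dots> = (2 * \<bar>sin (\<theta> / 2)\<bar>)\<^sup>2"
    using cos_double_sin[of "\<theta>/2"] by (simp add: power_mult_distrib)
  finally show ?thesis by (rule power2_eq_imp_eq) auto
qed

lemma norm_one_minus_ee_le: "norm (1 - ee x) \<le> 2 * pi * \<bar>x\<bar>"
  using abs_sin_x_le_abs_x[of "pi * x"] unfolding ee_def norm_one_minus_cis
  by (simp add: abs_mult)

lemma norm_ee_diff_le: "norm (ee x - ee y) \<le> 2 * pi * \<bar>x - y\<bar>"
proof -
  have "ee x - ee y = ee x * (1 - ee (y - x))"
    using ee_add[of x "y - x"] by (simp add: algebra_simps)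
  then show ?thesis
    using norm_one_minus_ee_le[of "y - x"] by (simp add: norm_mult abs_minus_commute)
qed

lemma norm_one_minus_ee_le_nint: "norm (1 - ee x) \<le> 2 * pi * nint x"
proof -
  have "ee x = ee (x - of_int (round x))"
    using ee_add_int(1)[of "x - of_int (round x)" "round x"] by simp
  then show ?thesis using norm_one_minus_ee_le[of "x - of_int (round x)"] by (simp add: nint_def)
qed

text \<open>
  The converse of \<open>norm_one_minus_ee_le_nint\<close> up to a constant: by periodicity this is the
  inequality \<open>z \<le> sin (\<pi> z)\<close> for \<open>0 \<le> z \<le> 1/2\<close>. It turns closeness of \<open>ee x\<close> to 1 into closeness of
  \<open>x\<close> to an integer.
\<close>

lemma norm_one_minus_ee_ge: "2 * nint x \<le> norm (1 - ee x)"
proof -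
  define y where "y = x - of_int (round x)"
  have y: "\<bar>y\<bar> \<le> 1/2" using nint_le_half[of x] by (simp add: y_def nint_def)
  have "ee x = ee y"
    using ee_add_int(1)[of y "round x"] by (simp add: y_def)
  have *: "z \<le> \<bar>sin (pi * z)\<bar>" if "0 \<le> z" "z \<le> 1/2" for z :: real
  proof (cases "z \<le> 1/6")
    case True
    show ?thesis
    proof (cases "z = 0")
      case False
      then have "0 < pi * z" using that by simp
      then obtain t where t: "0 < t" "t < pi * z" "sin (pi * z) - sin 0 = (pi * z - 0) * cos t"
        using MVT2[of 0 "pi * z" sin cos] by (auto intro: DERIV_sin)
      have "pi * z \<le> pi * (1/6)" using True by (intro mult_left_mono) auto
      then have "t \<le> pi / 3" using t(2) pi_gt_zero by linarith
      then have "cos (pi / 3) \<le> cos t"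
        using t(1) by (intro cos_monotone_0_pi_le) (use pi_gt_zero in auto)
      then have "1/2 \<le> cos t" by (simp add: cos_60)
      then have "pi * z * (1/2) \<le> pi * z * cos t" using that by (intro mult_left_mono) auto
      then have "pi * z * (1/2) \<le> sin (pi * z)" using t(3) by simp
      moreover have "z * 1 \<le> z * (pi * (1/2))" using pi_ge_two that by (intro mult_left_mono) auto
      ultimately show ?thesis by (simp add: mult_ac)
    qed auto
  next
    case False
    have "sin (pi / 6) \<le> sin (pi * z)"
      using False that mult_left_mono[of z "1/2" pi] mult_left_mono[of "1/6" z pi]
      by (intro sin_monotone_2pi_le) (use pi_gt_zero in auto)
    then show ?thesis using that by (simp add: sin_30)
  qed
  have "\<bar>y\<bar> \<le> \<bar>sin (pi * y)\<bar>" using *[of "\<bar>y\<bar>"] y by (cases "y \<ge> 0") auto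
  then show ?thesis
    unfolding \<open>ee x = ee y\<close> unfolding ee_def norm_one_minus_cis by (simp add: nint_def y_def)
qed

text \<open>
  Multiplying by \<open>ee (L \<alpha>)\<close> shifts the summation index by \<open>L\<close>. The support condition leaves room
  for the shift at the upper end, so there are no boundary terms.
\<close>

lemma sum_shift_ee:
  fixes g :: "int \<Rightarrow> complex"
  assumes supp: "\<And>n. n \<notin> {a..b-L} \<Longrightarrow> g n = 0" and "L \<ge> 0"
  shows "(1 - ee (of_int L * \<alpha>)) * (\<Sum>n\<in>{a..b}. g n * ee (of_int n * \<alpha>))
       = (\<Sum>n\<in>{a..b}. (g n - g (n - L)) * ee (of_int n * \<alpha>))"
proof -
  have "(\<Sum>n\<in>{a..b}. g (n - L) * ee (of_int n * \<alpha>)) = (\<Sum>m\<in>{a-L..b-L}. g m * ee (of_int (m + L) * \<alpha>))"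
    by (rule sum.reindex_bij_witness[of _ "\<lambda>m. m + L" "\<lambda>n. n - L"]) auto
  also have "\<dots> = (\<Sum>m\<in>{a-L..b}. g m * ee (of_int (m + L) * \<alpha>))"
    by (rule sum.mono_neutral_left) (use supp \<open>L \<ge> 0\<close> in auto)
  also have "\<dots> = (\<Sum>m\<in>{a..b}. g m * ee (of_int (m + L) * \<alpha>))"
    by (rule sum.mono_neutral_right) (use supp \<open>L \<ge> 0\<close> in auto)
  also have "\<dots> = ee (of_int L * \<alpha>) * (\<Sum>m\<in>{a..b}. g m * ee (of_int m * \<alpha>))"
    by (simp add: sum_distrib_left ee_add algebra_simps)
  finally show ?thesis
    by (simp add: algebra_simps sum_subtractf)
qed

lemma norm_sum_ee_le:
  fixes g :: "int \<Rightarrow> complex"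
  assumes supp: "\<And>n. n \<notin> {a..b-L} \<Longrightarrow> g n = 0" and "L \<ge> 0"
  shows "2 * nint (of_int L * \<alpha>) * norm (\<Sum>n\<in>{a..b}. g n * ee (of_int n * \<alpha>))
       \<le> (\<Sum>n\<in>{a..b}. norm (g n - g (n - L)))"
proof -
  have "2 * nint (of_int L * \<alpha>) * norm (\<Sum>n\<in>{a..b}. g n * ee (of_int n * \<alpha>))
     \<le> norm (1 - ee (of_int L * \<alpha>)) * norm (\<Sum>n\<in>{a..b}. g n * ee (of_int n * \<alpha>))"
    by (intro mult_right_mono norm_one_minus_ee_ge norm_ge_zero)
  also have "\<dots> = norm (\<Sum>n\<in>{a..b}. (g n - g (n - L)) * ee (of_int n * \<alpha>))"
    unfolding norm_mult[symmetric] by (subst sum_shift_ee[OF assms]) auto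
  also have "\<dots> \<le> (\<Sum>n\<in>{a..b}. norm (g n - g (n - L)))"
    by (rule order.trans[OF norm_sum]) (simp add: norm_mult)
  finally show ?thesis .
qed

text \<open>
  Two summations by parts. A weight whose second difference has total mass \<open>O(1/N)\<close> thus gives the
  bound \<open>1 / (N nint(\<alpha>)\<^sup>2)\<close>, which is summable over well-spaced \<open>\<alpha>\<close>; a single summation by parts would
  give \<open>1 / nint \<alpha>\<close> and lose a logarithm.
\<close>

lemma norm_sum_ee_le_second_difference:
  fixes g :: "int \<Rightarrow> complex"
  assumes supp: "\<And>n. n \<notin> {a..b-2} \<Longrightarrow> g n = 0"
  shows "4 * (nint \<alpha>)\<^sup>2 * norm (\<Sum>n\<in>{a..b}. g n * ee (of_int n * \<alpha>))
       \<le> (\<Sum>n\<in>{a..b}. norm (g n - 2 * g (n - 1) + g (n - 2)))"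
proof -
  have 1: "(1 - ee \<alpha>) * (\<Sum>n\<in>{a..b}. g n * ee (of_int n * \<alpha>))
       = (\<Sum>n\<in>{a..b}. (g n - g (n - 1)) * ee (of_int n * \<alpha>))"
  proof -
    have "g n = 0" if "n \<notin> {a..b-1}" for n using that by (intro supp) auto
    from sum_shift_ee[of a b 1 g \<alpha>, OF this] show ?thesis by simp
  qed
  have "4 * (nint \<alpha>)\<^sup>2 * norm (\<Sum>n\<in>{a..b}. g n * ee (of_int n * \<alpha>))
     = (2 * nint \<alpha>) * ((2 * nint \<alpha>) * norm (\<Sum>n\<in>{a..b}. g n * ee (of_int n * \<alpha>)))"
    by (simp add: power2_eq_square)
  also have "\<dots> \<le> (2 * nint \<alpha>) * (norm (1 - ee \<alpha>) * norm (\<Sum>n\<in>{a..b}. g n * ee (of_int n * \<alpha>)))"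
    by (intro mult_left_mono mult_right_mono norm_one_minus_ee_ge) auto
  also have "\<dots> = 2 * nint \<alpha> * norm (\<Sum>n\<in>{a..b}. (g n - g (n - 1)) * ee (of_int n * \<alpha>))"
    unfolding 1[symmetric] by (simp add: norm_mult)
  also have "\<dots> \<le> (\<Sum>n\<in>{a..b}. norm ((g n - g (n - 1)) - (g (n - 1) - g (n - 1 - 1))))"
  proof -
    have "g n - g (n - 1) = 0" if "n \<notin> {a..b-1}" for n
      using that supp[of n] supp[of "n-1"] by auto
    from norm_sum_ee_le[of a b 1 "\<lambda>n. g n - g (n - 1)" \<alpha>, OF this] show ?thesis by simp
  qed
  also have "\<dots> = (\<Sum>n\<in>{a..b}. norm (g n - 2 * g (n - 1) + g (n - 2)))"
    by (simp add: algebra_simps)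
  finally show ?thesis .
qed

text \<open>
  For \<open>N \<ge> 1\<close>, the trapezoid that is 1 on \<open>[-N, N]\<close> and 0 outside \<open>(-2N, 2N)\<close>.
\<close>

definition trap :: "nat \<Rightarrow> int \<Rightarrow> real" where
  "trap N n = max 0 (min 1 (2 - \<bar>of_int n\<bar> / N))"

lemma trap_nonneg [simp]: "0 \<le> trap N n" and trap_le_1 [simp]: "trap N n \<le> 1"
  by (auto simp: trap_def)

lemma trap_eq_1: assumes "\<bar>n\<bar> \<le> int N" shows "trap N n = 1"
proof -
  have "\<bar>real_of_int n\<bar> \<le> real N" using assms by linarith
  then have "\<bar>real_of_int n\<bar> / N \<le> 1" by (cases "N = 0") (auto simp: divide_le_eq)
  then show ?thesis by (auto simp: trap_def)
qed

lemma trap_eq_0: assumes "\<bar>n\<bar> \<ge> 2 * int N" "N \<ge> 1" shows "trap N n = 0"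
proof -
  have "\<bar>real_of_int n\<bar> \<ge> 2 * real N" using assms by linarith
  then have "\<bar>real_of_int n\<bar> / N \<ge> 2" using assms by (simp add: le_divide_eq)
  then show ?thesis by (auto simp: trap_def)
qed

lemma clamp_lipschitz: "\<bar>max 0 (min 1 x) - max 0 (min 1 y)\<bar> \<le> \<bar>x - y\<bar>" for x y :: real
  by (auto simp: max_def min_def abs_if)

lemma trap_lipschitz: "\<bar>trap N n - trap N m\<bar> \<le> \<bar>of_int n - of_int m\<bar> / N"
proof -
  have "\<bar>trap N n - trap N m\<bar> \<le> \<bar>\<bar>of_int n\<bar> / N - \<bar>of_int m\<bar> / N\<bar>"
    using clamp_lipschitz[of "2 - \<bar>of_int n\<bar> / N" "2 - \<bar>of_int m\<bar> / N"]
    by (simp add: trap_def abs_minus_commute)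
  also have "\<dots> = \<bar>\<bar>of_int n\<bar> - \<bar>of_int m\<bar>\<bar> / N"
    by (simp add: diff_divide_distrib[symmetric])
  also have "\<dots> \<le> \<bar>of_int n - of_int m\<bar> / N"
    by (intro divide_right_mono) auto
  finally show ?thesis .
qed

text \<open>
  The trapezoid is affine away from its four corners.
\<close>

lemma trap_second_difference:
  assumes "N \<ge> 1" "n - 1 \<notin> {int N, - int N, 2 * int N, - 2 * int N}"
  shows "trap N n - 2 * trap N (n - 1) + trap N (n - 2) = 0"
proof -
  define m where "m = n - 1"
  have n: "n = m + 1" "n - 1 = m" "n - 2 = m - 1" by (auto simp: m_def)
  have lin: "trap N k = 2 - \<bar>of_int k\<bar> / N" if "int N \<le> \<bar>k\<bar>" "\<bar>k\<bar> \<le> 2 * int N" for k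
  proof -
    have "real N \<le> \<bar>of_int k\<bar>" "\<bar>of_int k\<bar> \<le> 2 * real N" using that by linarith+
    then have "1 \<le> \<bar>of_int k\<bar> / N" "\<bar>of_int k\<bar> / N \<le> 2" using assms by (auto simp: divide_simps)
    then show ?thesis by (auto simp: trap_def)
  qed
  consider "\<bar>m\<bar> < int N" | "int N < m" "m < 2 * int N" | "int N < -m" "-m < 2 * int N" | "\<bar>m\<bar> > 2 * int N"
    using assms(2) unfolding n by fastforce
  then have "trap N (m + 1) - 2 * trap N m + trap N (m - 1) = 0"
  proof cases
    case 1 then show ?thesis by (simp add: trap_eq_1)
  next
    case 2 then show ?thesis using assms(1) by (simp add: lin field_simps)
  next
    case 3 then show ?thesis using assms(1) by (simp add: lin field_simps)
  next
    case 4 then show ?thesis using assms(1) by (simp add: trap_eq_0)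
  qed
  then show ?thesis by (simp add: n(1))
qed

lemma trap_second_difference_le:
  shows "\<bar>trap N n - 2 * trap N (n - 1) + trap N (n - 2)\<bar> \<le> 2 / N"
  using trap_lipschitz[of N n "n-1"] trap_lipschitz[of N "n-1" "n-2"] by (simp add: abs_le_iff)

lemma sum_trap_second_difference_le:
  assumes "N \<ge> 1" "finite I"
  shows "(\<Sum>n\<in>I. \<bar>trap N (n+h) - 2 * trap N (n + h - 1) + trap N (n + h - 2)\<bar>) \<le> 8 / N"
proof -
  let ?K = "{1 - h + int N, 1 - h - int N, 1 - h + 2 * int N, 1 - h - 2 * int N}"
  have "(\<Sum>n\<in>I. \<bar>trap N (n+h) - 2 * trap N (n + h - 1) + trap N (n + h - 2)\<bar>)
      = (\<Sum>n\<in>I \<inter> ?K. \<bar>trap N (n+h) - 2 * trap N (n + h - 1) + trap N (n + h - 2)\<bar>)"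
  proof (rule sum.mono_neutral_right)
    show "\<forall>i\<in>I - I \<inter> ?K. \<bar>trap N (i + h) - 2 * trap N (i + h - 1) + trap N (i + h - 2)\<bar> = 0"
      by (intro ballI, subst trap_second_difference) (use assms in auto)
  qed (use assms in auto)
  also have "\<dots> \<le> real (card (I \<inter> ?K)) * (2 / N)"
    by (intro sum_bounded_above trap_second_difference_le)
  also have "\<dots> \<le> 4 * (2 / N)"
  proof -
    have "card (I \<inter> ?K) \<le> card ?K" by (intro card_mono) auto
    also have "\<dots> \<le> 4" by (auto simp: card_insert_if)
    finally show ?thesis by (intro mult_right_mono) auto
  qed
  finally show ?thesis by simp
qed

text \<open>
  Leibniz rule for second differences: the corners of both factors contribute \<open>O(1/N)\<close> in total, and
  the product of first differences is \<open>O(1/N\<^sup>2)\<close> at each of \<open>O(N)\<close> points.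
\<close>

lemma sum_product_second_difference_le:
  assumes "N \<ge> 1"
  defines "g \<equiv> \<lambda>h m. trap N m * trap N (m + h)"
  shows "(\<Sum>m\<in>{-2*int N..2*int N+2}. \<bar>g h m - 2 * g h (m - 1) + g h (m - 2)\<bar>) \<le> 40 / N"
proof -
  let ?I = "{-2*int N..2*int N+2}"
  let ?w = "trap N" and ?u = "\<lambda>m. trap N (m + h)"
  have pt: "\<bar>g h m - 2 * g h (m - 1) + g h (m - 2)\<bar> \<le>
     \<bar>?u m - 2 * ?u (m - 1) + ?u (m - 2)\<bar> + 2 * (1/N)^2 + \<bar>?w m - 2 * ?w (m - 1) + ?w (m - 2)\<bar>" for m
  proof -
    have eq: "g h m - 2 * g h (m - 1) + g h (m - 2) = ?w m * (?u m - 2 * ?u (m - 1) + ?u (m - 2))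
      + 2 * ((?w m - ?w (m - 1)) * (?u (m - 1) - ?u (m - 2)))
      + (?w m - 2 * ?w (m - 1) + ?w (m - 2)) * ?u (m - 2)"
      by (simp add: g_def algebra_simps)
    have a: "\<bar>?w m * (?u m - 2 * ?u (m - 1) + ?u (m - 2))\<bar> \<le> \<bar>?u m - 2 * ?u (m - 1) + ?u (m - 2)\<bar>"
      by (simp add: abs_mult mult_left_le_one_le)
    have b: "\<bar>(?w m - 2 * ?w (m - 1) + ?w (m - 2)) * ?u (m - 2)\<bar> \<le> \<bar>?w m - 2 * ?w (m - 1) + ?w (m - 2)\<bar>"
      by (simp add: abs_mult mult_right_le_one_le)
    have "\<bar>?w m - ?w (m - 1)\<bar> \<le> 1 / N" "\<bar>?u (m - 1) - ?u (m - 2)\<bar> \<le> 1 / N"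
      using trap_lipschitz[of N m "m - 1"] trap_lipschitz[of N "m - 1 + h" "m - 2 + h"] by auto
    then have c: "\<bar>(?w m - ?w (m - 1)) * (?u (m - 1) - ?u (m - 2))\<bar> \<le> (1/N)^2"
      unfolding abs_mult power2_eq_square by (intro mult_mono) auto
    show ?thesis unfolding eq using a b c by linarith
  qed
  have "(\<Sum>m\<in>?I. \<bar>g h m - 2 * g h (m - 1) + g h (m - 2)\<bar>) \<le>
     (\<Sum>m\<in>?I. \<bar>?u m - 2 * ?u (m - 1) + ?u (m - 2)\<bar>) + (\<Sum>m\<in>?I. 2 * (1/N)^2)
     + (\<Sum>m\<in>?I. \<bar>?w m - 2 * ?w (m - 1) + ?w (m - 2)\<bar>)"
    unfolding sum.distrib[symmetric] by (intro sum_mono pt)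
  also have "\<dots> \<le> 8 / N + 16 / N + 8 / N"
  proof (intro add_mono)
    show "(\<Sum>m\<in>?I. \<bar>?u m - 2 * ?u (m - 1) + ?u (m - 2)\<bar>) \<le> 8 / N"
      using sum_trap_second_difference_le[OF assms(1), of ?I h] by (simp add: algebra_simps)
    show "(\<Sum>m\<in>?I. \<bar>?w m - 2 * ?w (m - 1) + ?w (m - 2)\<bar>) \<le> 8 / N"
      using sum_trap_second_difference_le[OF assms(1), of ?I 0] by (simp add: algebra_simps)
    have "(\<Sum>m\<in>?I. 2 * (1/real N)^2) = real (card ?I) * (2 * (1/real N)^2)" by simp
    also have "real (card ?I) = 4 * N + 3" by simp
    also have "(4 * N + 3) * (2 * (1/real N)^2) \<le> (8 * N) * (2 * (1/real N)^2)"
      by (intro mult_right_mono) (use assms(1) in auto)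
    also have "\<dots> = 16 / N" using assms(1) by (simp add: power2_eq_square)
    finally show "(\<Sum>m\<in>?I. 2 * (1/real N)^2) \<le> 16 / N" .
  qed
  also have "\<dots> \<le> 40 / N" by (simp add: add_divide_distrib[symmetric] divide_right_mono)
  finally show ?thesis .
qed

section \<open>A Weyl bound without logarithm\<close>

definition wsum :: "nat \<Rightarrow> real \<Rightarrow> real \<Rightarrow> complex" where
  "wsum N \<tau> \<xi> = (\<Sum>n\<in>{-2*int N..2*int N}. of_real (trap N n) * ee ((of_int n)\<^sup>2 * \<tau> + of_int n * \<xi>))"

lemma norm_wsum_le: assumes "N \<ge> 1" shows "norm (wsum N \<tau> \<xi>) \<le> 5 * N"
proof -
  have "norm (wsum N \<tau> \<xi>) \<le> (\<Sum>n\<in>{-2*int N..2*int N}. 1)"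
    unfolding wsum_def by (rule order.trans[OF norm_sum], rule sum_mono) (simp add: norm_mult)
  then show ?thesis using assms by simp
qed

text \<open>
  The sums that remain after differencing \<open>wsum\<close>: the phase has become linear.
\<close>

definition corr :: "nat \<Rightarrow> int \<Rightarrow> real \<Rightarrow> real" where
  "corr N h \<alpha> = norm (\<Sum>m\<in>{-2*int N..2*int N}. of_real (trap N m * trap N (m + h)) * ee (of_int m * \<alpha>))"

text \<open>
  Weyl differencing: in \<open>\<bar>wsum\<bar>\<^sup>2\<close> the pairs \<open>(m + h, m)\<close> have phase \<open>2 m h \<tau>\<close> plus a term that depends
  on \<open>h\<close> only. The linear frequency \<open>\<xi>\<close> disappears into that term, so the bound is uniform in \<open>\<xi>\<close>.
\<close>

lemma norm_wsum_squared_le: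
  assumes "N \<ge> 1"
  shows "(norm (wsum N \<tau> \<xi>))\<^sup>2 \<le> (\<Sum>h\<in>{-4*int N..4*int N}. corr N h (of_int h * (2 * \<tau>)))"
proof -
  define I where "I = {-2*int N..2*int N}"
  define H where "H = {-4*int N..4*int N}"
  define G where "G = (\<lambda>n. of_real (trap N n) * ee ((of_int n)\<^sup>2 * \<tau> + of_int n * \<xi>))"
  have w: "wsum N \<tau> \<xi> = (\<Sum>n\<in>I. G n)" by (simp add: wsum_def I_def G_def)
  have G0: "G n = 0" if "n \<notin> I" for n
    using that assms trap_eq_0[of N n] by (auto simp: G_def I_def)
  have shift: "(\<Sum>n\<in>I. G n) = (\<Sum>h\<in>H. G (m + h))" if "m \<in> I" for m
  proof -
    have "(\<Sum>h\<in>H. G (m + h)) = (\<Sum>n\<in>{m - 4*int N..m + 4*int N}. G n)"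
      by (rule sum.reindex_bij_witness[of _ "\<lambda>n. n - m" "\<lambda>h. m + h"]) (auto simp: H_def)
    also have "\<dots> = (\<Sum>n\<in>I. G n)"
      by (rule sum.mono_neutral_right) (use that G0 in \<open>auto simp: I_def\<close>)
    finally show ?thesis by simp
  qed
  have GG: "G (m + h) * cnj (G m) = ee ((of_int h)\<^sup>2 * \<tau> + of_int h * \<xi>) *
     (of_real (trap N m * trap N (m + h)) * ee (of_int m * (of_int h * (2 * \<tau>))))" for m h
  proof -
    have "ee ((of_int (m + h))\<^sup>2 * \<tau> + of_int (m + h) * \<xi>) * ee (- ((of_int m)\<^sup>2 * \<tau> + of_int m * \<xi>))
       = ee ((of_int h)\<^sup>2 * \<tau> + of_int h * \<xi>) * ee (of_int m * (of_int h * (2 * \<tau>)))"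
      unfolding ee_add[symmetric] by (rule arg_cong[of _ _ ee]) (simp add: power2_eq_square algebra_simps)
    then show ?thesis by (simp add: G_def cnj_ee mult_ac)
  qed
  have "complex_of_real ((norm (wsum N \<tau> \<xi>))\<^sup>2) = (\<Sum>n\<in>I. G n) * cnj (\<Sum>m\<in>I. G m)"
    unfolding w using complex_norm_square[of "sum G I"] by simp
  also have "\<dots> = (\<Sum>m\<in>I. (\<Sum>n\<in>I. G n) * cnj (G m))"
    by (simp add: sum_distrib_left)
  also have "\<dots> = (\<Sum>m\<in>I. (\<Sum>h\<in>H. G (m + h)) * cnj (G m))"
    by (intro sum.cong refl) (simp only: shift)
  also have "\<dots> = (\<Sum>h\<in>H. \<Sum>m\<in>I. G (m + h) * cnj (G m))"
    unfolding sum_distrib_right by (rule sum.swap)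
  finally have "(norm (wsum N \<tau> \<xi>))\<^sup>2 = norm (\<Sum>h\<in>H. \<Sum>m\<in>I. G (m + h) * cnj (G m))"
    by (metis norm_of_real abs_of_nonneg zero_le_power2)
  also have "\<dots> \<le> (\<Sum>h\<in>H. norm (\<Sum>m\<in>I. G (m + h) * cnj (G m)))"
    by (rule norm_sum)
  also have "\<dots> = (\<Sum>h\<in>H. corr N h (of_int h * (2 * \<tau>)))"
    unfolding GG sum_distrib_left[symmetric] norm_mult by (simp add: corr_def I_def)
  finally show ?thesis by (simp add: H_def)
qed

lemma corr_nonneg [simp]: "0 \<le> corr N h \<alpha>" by (simp add: corr_def)

lemma corr_le: assumes "N \<ge> 1" shows "corr N h \<alpha> \<le> 5 * N"
proof -
  have "corr N h \<alpha> \<le> (\<Sum>m\<in>{-2*int N..2*int N}. 1)"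
    unfolding corr_def by (rule order.trans[OF norm_sum], rule sum_mono) (simp add: norm_mult mult_le_one)
  then show ?thesis using assms by simp
qed

lemma corr_le_nint: assumes "N \<ge> 1" shows "N * (nint \<alpha>)\<^sup>2 * corr N h \<alpha> \<le> 10"
proof -
  define g where "g = (\<lambda>m. complex_of_real (trap N m * trap N (m + h)))"
  have g0: "g m = 0" if "m \<notin> {-2*int N..2*int N+2-2}" for m
    using that assms trap_eq_0[of N m] by (auto simp: g_def)
  have "(\<Sum>m\<in>{-2*int N..2*int N+2}. g m * ee (of_int m * \<alpha>)) = (\<Sum>m\<in>{-2*int N..2*int N}. g m * ee (of_int m * \<alpha>))"
    by (rule sum.mono_neutral_right) (use g0 in auto)
  then have "corr N h \<alpha> = norm (\<Sum>m\<in>{-2*int N..2*int N+2}. g m * ee (of_int m * \<alpha>))"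
    by (simp add: corr_def g_def)
  then have "4 * (nint \<alpha>)\<^sup>2 * corr N h \<alpha> \<le> (\<Sum>m\<in>{-2*int N..2*int N+2}. norm (g m - 2 * g (m - 1) + g (m - 2)))"
    using norm_sum_ee_le_second_difference[of "-2*int N" "2*int N+2" g \<alpha>, OF g0] by simp
  also have "\<dots> = (\<Sum>m\<in>{-2*int N..2*int N+2}. \<bar>trap N m * trap N (m + h)
      - 2 * (trap N (m - 1) * trap N (m - 1 + h)) + trap N (m - 2) * trap N (m - 2 + h)\<bar>)"
  proof (intro sum.cong refl)
    fix m
    have "g m - 2 * g (m - 1) + g (m - 2) = of_real (trap N m * trap N (m + h)
      - 2 * (trap N (m - 1) * trap N (m - 1 + h)) + trap N (m - 2) * trap N (m - 2 + h))"
      by (simp add: g_def)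
    then show "norm (g m - 2 * g (m - 1) + g (m - 2)) = \<bar>trap N m * trap N (m + h)
      - 2 * (trap N (m - 1) * trap N (m - 1 + h)) + trap N (m - 2) * trap N (m - 2 + h)\<bar>"
      by (simp only: norm_of_real)
  qed
  also have "\<dots> \<le> 40 / N" by (rule sum_product_second_difference_le[OF assms])
  finally have "4 * (nint \<alpha>)\<^sup>2 * corr N h \<alpha> \<le> 40 / N" .
  then have "N * (4 * (nint \<alpha>)\<^sup>2 * corr N h \<alpha>) \<le> N * (40 / N)" by (intro mult_left_mono) auto
  then show ?thesis using assms by (simp add: mult_ac)
qed

lemma sum_inverse_squares_le: "(\<Sum>r\<in>{1..m}. 1 / (real r)\<^sup>2) \<le> 2 - 1 / m"
proof (induction m)
  case (Suc m)
  have "1 / (real (Suc m))\<^sup>2 \<le> 1 / m - 1 / Suc m" if "m \<ge> 1"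
  proof -
    have "1 / (real (Suc m))\<^sup>2 \<le> 1 / (real m * real (Suc m))"
      using that by (intro divide_left_mono) (auto simp: power2_eq_square intro!: mult_pos_pos)
    also have "\<dots> = 1 / m - 1 / Suc m" using that by (simp add: field_simps)
    finally show ?thesis .
  qed
  then show ?case using Suc by (cases "m = 0") auto
qed auto

lemma sum_inverse_nint_squares_le:
  assumes "q \<ge> 1"
  shows "(\<Sum>r\<in>{1..<q}. 1 / (nint (real r / q))\<^sup>2) \<le> 4 * (real q)\<^sup>2"
proof -
  have pt: "1 / (nint (real r / q))\<^sup>2 \<le> (real q)\<^sup>2 * (1 / (real r)\<^sup>2) + (real q)\<^sup>2 * (1 / (real (q - r))\<^sup>2)" if r: "r \<in> {1..<q}" for r
  proof -
    define n where "n = round (real r / q)"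
    have rq: "real (q - r) = real q - real r" "real r > 0" "real r < real q" using r by auto
    have "nint (real r / q) = real r / q \<or> nint (real r / q) \<ge> real r / q \<or> nint (real r / q) \<ge> real (q - r) / q"
    proof (cases "n \<le> 0")
      case True
      then have "real_of_int n \<le> 0" by linarith
      then have "nint (real r / q) \<ge> real r / q" unfolding nint_def n_def[symmetric]
        by linarith
      then show ?thesis by simp
    next
      case False
      then have "real_of_int n \<ge> 1" by linarith
      moreover have "real (q - r) / q = 1 - real r / q" using rq by (simp add: field_simps)
      ultimately have "nint (real r / q) \<ge> real (q - r) / q" unfolding nint_def n_def[symmetric]
        by linarith
      then show ?thesis by simp
    qed
    then consider "nint (real r / q) \<ge> real r / q" | "nint (real r / q) \<ge> real (q - r) / q" by linarith
    then show ?thesis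
    proof cases
      case 1
      have p: "0 < real r / q" using r by auto
      then have p': "0 < nint (real r / q)" using 1 by linarith
      have "1 / (nint (real r / q))\<^sup>2 \<le> 1 / (real r / q)\<^sup>2"
        using p p' 1 by (intro divide_left_mono power_mono mult_pos_pos zero_less_power) auto
      also have "\<dots> = (real q)\<^sup>2 * (1 / (real r)\<^sup>2)" by (simp add: power_divide)
      finally show ?thesis by (simp add: add_increasing2)
    next
      case 2
      have p: "0 < real (q - r) / q" using r by auto
      then have p': "0 < nint (real r / q)" using 2 by linarith
      have "1 / (nint (real r / q))\<^sup>2 \<le> 1 / (real (q - r) / q)\<^sup>2"
        using p p' 2 unfolding rq(1) by (intro divide_left_mono power_mono mult_pos_pos zero_less_power) auto
      also have "\<dots> = (real q)\<^sup>2 * (1 / (real (q - r))\<^sup>2)" by (simp add: power_divide)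
      finally show ?thesis by (simp add: add_increasing)
    qed
  qed
  have S: "(\<Sum>r\<in>{1..<q}. 1 / (real r)\<^sup>2) \<le> 2"
  proof -
    have "{1..<q} = {1..q-1}" using assms by auto
    then show ?thesis using sum_inverse_squares_le[of "q-1"] by (smt (verit) divide_nonneg_nonneg of_nat_0_le_iff)
  qed
  have S': "(\<Sum>r\<in>{1..<q}. 1 / (real (q - r))\<^sup>2) = (\<Sum>r\<in>{1..<q}. 1 / (real r)\<^sup>2)"
    by (rule sum.reindex_bij_witness[of _ "\<lambda>r. q - r" "\<lambda>r. q - r"]) auto
  have "(\<Sum>r\<in>{1..<q}. 1 / (nint (real r / q))\<^sup>2) \<le>
     (\<Sum>r\<in>{1..<q}. (real q)\<^sup>2 * (1 / (real r)\<^sup>2) + (real q)\<^sup>2 * (1 / (real (q - r))\<^sup>2))"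
    by (intro sum_mono pt)
  also have "\<dots> = (real q)\<^sup>2 * (2 * (\<Sum>r\<in>{1..<q}. 1 / (real r)\<^sup>2))"
    by (simp only: sum.distrib sum_distrib_left[symmetric] S' mult_2 distrib_left)
  also have "\<dots> \<le> (real q)\<^sup>2 * (2 * 2)" using S by (intro mult_left_mono) auto
  finally show ?thesis by simp
qed


text \<open>
  Here \<open>D h\<close> stands for \<open>corr\<close> at \<open>h t\<close>. In a block of \<open>q\<close> consecutive integers \<open>h\<close> the residues of
  \<open>h a\<close> modulo \<open>q\<close> are distinct, and \<open>t\<close> is so close to \<open>a / q\<close> that \<open>nint (h t)\<close> is comparable to the
  distance of \<open>h a / q\<close> from the integers. So a block contributes \<open>O(q\<^sup>2 / N)\<close>, and there are \<open>O(N / q)\<close>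
  blocks.
\<close>

lemma sum_nonmultiples_le:
  fixes D :: "int \<Rightarrow> real" and N q :: nat
  assumes "N \<ge> 1" "q \<ge> 1" "q \<le> 16 * N" "coprime a (int q)" "\<bar>t - a / q\<bar> \<le> 1 / (16 * N * q)"
    and D: "\<And>h. 0 \<le> D h" "\<And>h. N * (nint (h * t))\<^sup>2 * D h \<le> 10"
  shows "(\<Sum>h\<in>{h\<in>{-4*int N..4*int N}. \<not> int q dvd h}. D h) \<le> 3000 * q"
proof -
  define H where "H = {h\<in>{-4*int N..4*int N}. \<not> int q dvd h}"
  have [simp]: "finite H" by (rule finite_subset[of _ "{-4*int N..4*int N}"]) (auto simp: H_def)
  define \<rho> where "\<rho> = (\<lambda>h. nat ((h * a) mod int q))"
  have q0: "real q > 0" using assms by simp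
  have int_\<rho>: "int (\<rho> h) = (h * a) mod int q" for h using assms(2) by (simp add: \<rho>_def)
  have \<rho>_range: "\<rho> h \<in> {1..<q}" if "h \<in> H" for h
  proof -
    have "\<not> int q dvd h * a" using that assms(4)
      by (auto simp: H_def coprime_dvd_mult_left_iff coprime_commute)
    then have "(h * a) mod int q \<noteq> 0" by (simp add: dvd_eq_mod_eq_0)
    moreover have "0 \<le> (h * a) mod int q" "(h * a) mod int q < int q" using assms(2) by auto
    ultimately have "int (\<rho> h) \<noteq> 0" "int (\<rho> h) < int q" unfolding int_\<rho> by auto
    then show ?thesis by simp
  qed
  have nint_\<rho>: "nint (h * a / q) = nint (\<rho> h / q)" for h
  proof -
    have "h * a = (h * a) div int q * int q + int (\<rho> h)" by (simp add: int_\<rho>)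
    then have "real_of_int (h * a) = real_of_int ((h * a) div int q) * q + \<rho> h"
      by (metis of_int_add of_int_mult of_int_of_nat_eq)
    then have "h * a / q = \<rho> h / q + of_int ((h * a) div int q)"
      using q0 by (simp add: field_simps)
    then show ?thesis by simp
  qed
  \<comment> \<open>The approximation error \<open>\<bar>h (t - a/q)\<bar>\<close> is at most \<open>1 / (4q)\<close>, a quarter of the least possible
    distance \<open>1/q\<close>; and \<open>10 (4/3)\<^sup>2 \<le> 18\<close>.\<close>
  have pt: "D h \<le> 18 / N * (1 / (nint (\<rho> h / q))\<^sup>2)" if h: "h \<in> H" for h
  proof -
    have "1 / q \<le> nint (\<rho> h / q)"
    proof -
      have "int (\<rho> h) - round (\<rho> h / q) * int q \<noteq> 0"
      proof
        assume "int (\<rho> h) - round (\<rho> h / q) * int q = 0"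
        then have "int q dvd int (\<rho> h)" by (metis diff_eq_diff_eq diff_zero dvd_triv_right eq_iff_diff_eq_0)
        then have "q dvd \<rho> h" by simp
        then show False using \<rho>_range[OF h] by (auto dest: dvd_imp_le)
      qed
      then have "1 \<le> \<bar>int (\<rho> h) - round (\<rho> h / q) * int q\<bar>" by linarith
      then have "1 \<le> \<bar>real_of_int (int (\<rho> h) - round (\<rho> h / q) * int q)\<bar>" by linarith
      also have "\<dots> = nint (\<rho> h / q) * q"
      proof -
        have "real_of_int (int (\<rho> h) - round (\<rho> h / q) * int q) = (\<rho> h / q - round (\<rho> h / q)) * q"
          using q0 by (simp add: field_simps)
        then show ?thesis unfolding nint_def by (simp add: abs_mult)
      qed
      finally show ?thesis using q0 by (simp add: field_simps)
    qed
    moreover have "nint (h * a / q) - nint (h * t) \<le> 1 / (4 * q)"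
    proof -
      have "nint (h * a / q) - nint (h * t) \<le> \<bar>h * a / q - h * t\<bar>" by (rule nint_diff_le)
      also have "h * a / q - h * t = - (h * (t - a / q))" by (simp add: algebra_simps)
      also have "\<bar>- (h * (t - a / q))\<bar> = \<bar>real_of_int h\<bar> * \<bar>t - a / q\<bar>" by (simp add: abs_mult)
      also have "\<dots> \<le> (4 * N) * (1 / (16 * N * q))"
        using h assms(5) by (intro mult_mono) (auto simp: H_def)
      also have "\<dots> = 1 / (4 * q)" using assms(1) by (simp add: field_simps)
      finally show ?thesis .
    qed
    moreover have "1 / (4 * real q) = (1/4) * (1 / q)" by simp
    ultimately have lb: "3/4 * nint (\<rho> h / q) \<le> nint (h * t)" "0 < nint (\<rho> h / q)"
      using nint_\<rho>[of h] q0 by (linarith, smt (verit) divide_pos_pos)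
    have "N * (3/4 * nint (\<rho> h / q))\<^sup>2 * D h \<le> N * (nint (h * t))\<^sup>2 * D h"
      using lb D(1) by (intro mult_right_mono mult_left_mono power_mono) auto
    also have "\<dots> \<le> 10" by (rule D(2))
    finally have "N * (nint (\<rho> h / q))\<^sup>2 * D h \<le> 18" by (simp add: power_mult_distrib power2_eq_square)
    then show ?thesis using lb(2) assms(1) by (simp add: field_simps)
  qed
  have block: "(\<Sum>h\<in>{h\<in>H. h div int q = j}. D h) \<le> 72 * q^2 / N" for j
  proof -
    let ?B = "{h\<in>H. h div int q = j}"
    have inj: "inj_on \<rho> ?B"
    proof (rule inj_onI)
      fix x y assume x: "x \<in> ?B" and y: "y \<in> ?B" and e: "\<rho> x = \<rho> y"
      from e have "(x * a) mod int q = (y * a) mod int q" by (metis int_\<rho>)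
      then have "[x * a = y * a] (mod int q)" by (simp add: cong_def)
      then have "[x = y] (mod int q)" using assms(4) by (simp add: cong_mult_rcancel)
      then show "x = y" using x y unfolding cong_def by (metis (mono_tags, lifting) mem_Collect_eq mult_div_mod_eq)
    qed
    have "(\<Sum>h\<in>?B. D h) \<le> (\<Sum>h\<in>?B. 18 / N * (1 / (nint (\<rho> h / q))\<^sup>2))"
      by (intro sum_mono pt) auto
    also have "\<dots> = 18 / N * (\<Sum>h\<in>?B. (1 / (nint (\<rho> h / q))\<^sup>2))"
      by (simp add: sum_distrib_left)
    also have "(\<Sum>h\<in>?B. (1 / (nint (\<rho> h / q))\<^sup>2)) = (\<Sum>r\<in>\<rho> ` ?B. (1 / (nint (r / q))\<^sup>2))"
      by (simp add: sum.reindex[OF inj])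
    also have "\<dots> \<le> (\<Sum>r\<in>{1..<q}. (1 / (nint (real r / q))\<^sup>2))"
      using \<rho>_range by (intro sum_mono2) auto
    also have "\<dots> \<le> 4 * (real q)\<^sup>2" by (rule sum_inverse_nint_squares_le[OF assms(2)])
    finally show ?thesis by (simp add: mult_left_mono divide_right_mono)
  qed
  have card: "real (card ((\<lambda>h. h div int q) ` H)) \<le> 40 * N / q"
  proof -
    define u v where "u = (-4*int N) div int q" and "v = (4*int N) div int q"
    have "card ((\<lambda>h. h div int q) ` H) \<le> card {u..v}"
    proof (intro card_mono subsetI)
      fix y assume "y \<in> (\<lambda>h. h div int q) ` H"
      then show "y \<in> {u..v}" using assms(2) by (auto simp: H_def u_def v_def intro!: zdiv_mono1)
    qed auto
    moreover have "u \<le> v" using assms(2) by (auto simp: u_def v_def intro!: zdiv_mono1)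
    ultimately have "real (card ((\<lambda>h. h div int q) ` H)) \<le> real_of_int v - real_of_int u + 1"
      by simp
    moreover have "real_of_int v \<le> 4 * N / q"
      using floor_divide_of_int_eq[of "4 * int N" "int q", where ?'a = real] of_int_floor_le[of "4 * real N / q"]
      by (simp add: v_def)
    moreover have "-(4 * N / q) - 1 \<le> real_of_int u"
      using floor_divide_of_int_eq[of "- 4 * int N" "int q", where ?'a = real] floor_correct[of "- (4 * real N / q)"]
      by (simp add: u_def)
    ultimately have "real (card ((\<lambda>h. h div int q) ` H)) \<le> 4 * N / q + 4 * N / q + 2" by linarith
    moreover have "1 \<le> 16 * N / q" using assms(2,3) by (simp add: le_divide_eq flip: of_nat_mult)
    ultimately show ?thesis by simp
  qed
  have "(\<Sum>h\<in>H. D h) = (\<Sum>j\<in>(\<lambda>h. h div int q) ` H. \<Sum>h\<in>{h\<in>H. h div int q = j}. D h)"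
    by (rule sum.image_gen) simp
  also have "\<dots> \<le> real (card ((\<lambda>h. h div int q) ` H)) * (72 * q^2 / N)"
    using block by (intro sum_bounded_above) auto
  also have "\<dots> \<le> (40 * N / q) * (72 * q^2 / N)"
    using card by (intro mult_right_mono) auto
  also have "\<dots> = 2880 * q" using assms(1,2) by (simp add: field_simps power2_eq_square)
  finally show ?thesis by (simp add: H_def)
qed

lemma sum_inverse_shifted_squares_le:
  assumes "(\<kappa>::real) > 0"
  shows "(\<Sum>j\<in>{0..n}. 1 / (real j + \<kappa>)\<^sup>2) \<le> 1 / \<kappa>\<^sup>2 + 1 / \<kappa> - 1 / (real n + \<kappa>)"
proof (induction n)
  case (Suc n)
  have "1 / (real (Suc n) + \<kappa>)\<^sup>2 \<le> 1 / ((real n + \<kappa>) * (real (Suc n) + \<kappa>))"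
    using assms by (intro divide_left_mono) (auto simp: power2_eq_square intro!: mult_pos_pos mult_right_mono add_nonneg_pos)
  also have "\<dots> = 1 / (real n + \<kappa>) - 1 / (real (Suc n) + \<kappa>)"
  proof -
    have "real n + \<kappa> > 0" "real (Suc n) + \<kappa> > 0" using assms by (auto intro: add_nonneg_pos)
    then show ?thesis by (simp add: field_simps)
  qed
  finally show ?case using Suc by simp
qed auto

lemma sum_symmetric_int_le:
  fixes F :: "int \<Rightarrow> real"
  assumes "\<And>j. 0 \<le> F j"
  shows "(\<Sum>j\<in>{-int n..int n}. F j) \<le> (\<Sum>j\<in>{0..n}. F (int j)) + (\<Sum>j\<in>{0..n}. F (- int j))"
proof -
  have sub: "{-int n..int n} \<subseteq> int ` {0..n} \<union> (\<lambda>j. - int j) ` {0..n}"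
  proof
    fix j assume "j \<in> {-int n..int n}"
    then have "(j = int (nat j) \<and> nat j \<in> {0..n}) \<or> (j = - int (nat (-j)) \<and> nat (-j) \<in> {0..n})" by auto
    then show "j \<in> int ` {0..n} \<union> (\<lambda>j. - int j) ` {0..n}" by blast
  qed
  have "(\<Sum>j\<in>{-int n..int n}. F j) \<le> sum F (int ` {0..n} \<union> (\<lambda>j. - int j) ` {0..n})"
    using assms sub by (intro sum_mono2) auto
  also have "\<dots> \<le> sum F (int ` {0..n}) + sum F ((\<lambda>j. - int j) ` {0..n})"
    using assms by (subst sum_Un) (auto intro!: sum_nonneg)
  also have "sum F (int ` {0..n}) = (\<Sum>j\<in>{0..n}. F (int j))"
    by (subst sum.reindex) auto
  also have "sum F ((\<lambda>j. - int j) ` {0..n}) = (\<Sum>j\<in>{0..n}. F (- int j))"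
    by (subst sum.reindex) (auto simp: inj_on_def)
  finally show ?thesis .
qed

text \<open>
  For \<open>h = j q\<close> the number \<open>h t\<close> differs from the integer \<open>j a\<close> by \<open>j q (t - a/q)\<close>, which is at most
  \<open>1/2\<close> in absolute value. The trivial bound for all \<open>j\<close> gives the first estimate. Decay in \<open>j\<close> from
  \<open>\<bar>j\<bar> = 1 / (N q \<bar>t - a/q\<bar>)\<close> on gives the second.
\<close>

lemma sum_multiples_le:
  fixes D :: "int \<Rightarrow> real" and N q :: nat and S :: real
  assumes "N \<ge> 1" "q \<ge> 1" "q \<le> 16 * N" "\<bar>t - a / q\<bar> \<le> 1 / (16 * N * q)"
    and D: "\<And>h. 0 \<le> D h" "\<And>h. N * (nint (h * t))\<^sup>2 * D h \<le> 10" "\<And>h. D h \<le> 5 * N"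
  defines "S \<equiv> (\<Sum>h\<in>{h\<in>{-4*int N..4*int N}. int q dvd h}. D h)"
  shows "q * S \<le> 120 * N^2" "q * S * \<bar>t - of_int a / q\<bar> \<le> 120"
proof -
  define \<beta> where "\<beta> = t - a / q"
  have q0: "real q > 0" and N0: "real N > 0" using assms by auto
  define J where "J = nat \<lfloor>4 * real N / q\<rfloor>"
  have J: "int J = \<lfloor>4 * real N / q\<rfloor>" by (simp add: J_def)
  have Jle: "real J \<le> 4 * N / q"
  proof -
    have "real J = of_int \<lfloor>4 * real N / q\<rfloor>" using J by (metis of_int_of_nat_eq)
    then show ?thesis using of_int_floor_le[of "4 * real N / q"] by simp
  qed
  have sub: "{h\<in>{-4*int N..4*int N}. int q dvd h} \<subseteq> (\<lambda>j. j * int q) ` {-int J..int J}"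
  proof
    fix h assume h: "h \<in> {h\<in>{-4*int N..4*int N}. int q dvd h}"
    then obtain j where j: "h = j * int q" by (metis (no_types, lifting) dvdE mem_Collect_eq mult.commute)
    have "real_of_int \<bar>h\<bar> \<le> real_of_int (4 * int N)" using h by (subst of_int_le_iff) auto
    then have "\<bar>real_of_int j\<bar> * q \<le> 4 * N" by (simp add: j abs_mult)
    then have "real_of_int \<bar>j\<bar> \<le> 4 * N / q" using q0 by (simp add: field_simps)
    then have "\<bar>j\<bar> \<le> int J" unfolding J le_floor_iff by simp
    then have "j \<in> {-int J..int J}" by auto
    then show "h \<in> (\<lambda>j. j * int q) ` {-int J..int J}" using j by blast
  qed
  have inj: "inj_on (\<lambda>j. j * int q) {-int J..int J}" using assms(2) by (auto simp: inj_on_def)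
  have S: "S \<le> (\<Sum>j\<in>{-int J..int J}. D (j * int q))"
  proof -
    have "S \<le> sum D ((\<lambda>j. j * int q) ` {-int J..int J})"
      unfolding S_def using sub D(1) by (intro sum_mono2) auto
    then show ?thesis by (simp add: sum.reindex[OF inj])
  qed
  have "S \<le> (\<Sum>j\<in>{-int J..int J}. 5 * real N)" by (rule order.trans[OF S sum_mono]) (use D(3) in simp)
  also have "\<dots> = (2 * real J + 1) * (5 * N)" by simp
  also have "\<dots> \<le> (24 * N / q) * (5 * N)"
  proof (intro mult_right_mono)
    have "1 \<le> 16 * N / q" using assms(2,3) by (simp add: le_divide_eq flip: of_nat_mult)
    then show "2 * real J + 1 \<le> 24 * N / q" using Jle by simp
  qed auto
  finally have "S \<le> (24 * N / q) * (5 * N)" .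
  then show "q * S \<le> 120 * N^2" using q0 by (simp add: field_simps power2_eq_square)
  show "q * S * \<bar>t - of_int a / q\<bar> \<le> 120"
  proof (cases "\<beta> = 0")
    case False
    \<comment> \<open>\<open>\<kappa>\<close> is the value of \<open>\<bar>j\<bar>\<close> at which the decay sets in.\<close>
    define \<kappa> where "\<kappa> = 1 / (N * q * \<bar>\<beta>\<bar>)"
    have \<kappa>0: "\<kappa> > 0" using False q0 N0 by (simp add: \<kappa>_def)
    have \<kappa>1: "\<kappa> \<ge> 1"
    proof -
      have "N * q * \<bar>\<beta>\<bar> \<le> N * q * (1 / (16 * N * q))"
        using assms(4) by (intro mult_left_mono) (auto simp: \<beta>_def)
      also have "\<dots> \<le> 1" using q0 N0 by (simp add: field_simps)
      finally show ?thesis using False q0 N0 by (simp add: \<kappa>_def)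
    qed
    have pt: "D (j * int q) \<le> 30 * N * \<kappa>\<^sup>2 * (1 / (\<bar>j\<bar> + \<kappa>)\<^sup>2)" if j: "j \<in> {-int J..int J}" for j
    proof -
      have "\<bar>real_of_int j\<bar> \<le> real J" using j by auto
      then have jJ: "\<bar>real_of_int j\<bar> \<le> 4 * N / q" using Jle by linarith
      have "nint (of_int (j * int q) * t) = nint (j * q * \<beta> + of_int (j * a))"
        using q0 by (intro arg_cong[of _ _ nint]) (simp add: \<beta>_def field_simps)
      also have "\<dots> = nint (j * q * \<beta>)" by (rule nint_add_int)
      also have "\<dots> = \<bar>j * q * \<beta>\<bar>"
      proof (rule nint_eq_abs)
        have "\<bar>j * q * \<beta>\<bar> = \<bar>real_of_int j\<bar> * q * \<bar>\<beta>\<bar>" by (simp add: abs_mult)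
        also have "\<dots> \<le> (4 * N / q) * q * (1 / (16 * N * q))"
          using jJ assms(4) by (intro mult_mono) (auto simp: \<beta>_def)
        also have "\<dots> = 1 / (4 * q)" using q0 N0 by (simp add: field_simps)
        also have "\<dots> \<le> 1 / 2" using assms(2) by (simp add: field_simps)
        finally show "\<bar>j * q * \<beta>\<bar> \<le> 1 / 2" .
      qed
      finally have "N * (j * q * \<beta>)\<^sup>2 * D (j * int q) \<le> 10" using D(2)[of "j * int q"] by simp
      then have "(N * \<kappa>\<^sup>2) * (N * (j * q * \<beta>)\<^sup>2 * D (j * int q)) \<le> (N * \<kappa>\<^sup>2) * 10"
        by (intro mult_left_mono) auto
      also have "(N * \<kappa>\<^sup>2) * (N * (j * q * \<beta>)\<^sup>2 * D (j * int q)) = (real_of_int j)\<^sup>2 * D (j * int q)"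
        using False q0 N0 by (simp add: \<kappa>_def field_simps power2_eq_square)
      finally have 1: "(real_of_int j)\<^sup>2 * D (j * int q) \<le> 10 * N * \<kappa>\<^sup>2" by simp
      have 2: "\<kappa>\<^sup>2 * D (j * int q) \<le> \<kappa>\<^sup>2 * (5 * N)" using D(3) by (intro mult_left_mono) auto
      have "(\<bar>j\<bar> + \<kappa>)\<^sup>2 \<le> 2 * (real_of_int j)\<^sup>2 + 2 * \<kappa>\<^sup>2"
        using sum_squares_bound[of "\<bar>real_of_int j\<bar>" \<kappa>] by (simp add: power2_sum)
      then have "(\<bar>j\<bar> + \<kappa>)\<^sup>2 * D (j * int q) \<le> (2 * (real_of_int j)\<^sup>2 + 2 * \<kappa>\<^sup>2) * D (j * int q)"
        using D(1) by (intro mult_right_mono) auto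
      also have "\<dots> \<le> 30 * N * \<kappa>\<^sup>2" using 1 2 by (simp add: algebra_simps)
      finally show ?thesis using \<kappa>0 by (simp add: field_simps add_nonneg_pos)
    qed
    have "S \<le> (\<Sum>j\<in>{-int J..int J}. 30 * N * \<kappa>\<^sup>2 * (1 / (\<bar>j\<bar> + \<kappa>)\<^sup>2))"
      by (rule order.trans[OF S sum_mono]) (use pt in simp)
    also have "\<dots> = 30 * N * \<kappa>\<^sup>2 * (\<Sum>j\<in>{-int J..int J}. 1 / (\<bar>j\<bar> + \<kappa>)\<^sup>2)"
      by (simp add: sum_distrib_left)
    also have "\<dots> \<le> 30 * N * \<kappa>\<^sup>2 * (2 * (1 / \<kappa>\<^sup>2 + 1 / \<kappa>))"
    proof (intro mult_left_mono)
      have "(\<Sum>j\<in>{-int J..int J}. 1 / (\<bar>j\<bar> + \<kappa>)\<^sup>2) \<le> (\<Sum>j\<in>{0..J}. 1 / (real j + \<kappa>)\<^sup>2) + (\<Sum>j\<in>{0..J}. 1 / (real j + \<kappa>)\<^sup>2)"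
        using sum_symmetric_int_le[of "\<lambda>j. 1 / (\<bar>j\<bar> + \<kappa>)\<^sup>2" J] by simp
      also have "\<dots> \<le> 2 * (1 / \<kappa>\<^sup>2 + 1 / \<kappa>)"
      proof -
        have "(\<Sum>j\<in>{0..J}. 1 / (real j + \<kappa>)\<^sup>2) \<le> 1 / \<kappa>\<^sup>2 + 1 / \<kappa>"
          by (rule order.trans[OF sum_inverse_shifted_squares_le[OF \<kappa>0]]) (use \<kappa>0 in simp)
        then show ?thesis unfolding mult_2 by (intro add_mono)
      qed
      finally show "(\<Sum>j\<in>{-int J..int J}. 1 / (\<bar>j\<bar> + \<kappa>)\<^sup>2) \<le> 2 * (1 / \<kappa>\<^sup>2 + 1 / \<kappa>)" .
    qed auto
    also have "\<dots> = 60 * N * (1 + \<kappa>)" using \<kappa>0 by (simp add: field_simps power2_eq_square)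
    also have "\<dots> \<le> 60 * N * (2 * \<kappa>)" using \<kappa>1 by (intro mult_left_mono) auto
    also have "\<dots> = 120 / (q * \<bar>\<beta>\<bar>)" using N0 by (simp add: \<kappa>_def)
    finally show ?thesis using q0 False unfolding \<beta>_def[symmetric] by (simp add: field_simps)
  qed (simp add: \<beta>_def)
qed

text \<open>
  Weyl's inequality, in the sharp form \<open>\<bar>wsum\<bar>\<^sup>2 = O (1 / (q (1/N\<^sup>2 + \<bar>2\<tau> - a/q\<bar>)))\<close>: multiples and
  nonmultiples of \<open>q\<close> are estimated separately after differencing.
\<close>

lemma weyl_bound:
  assumes "N \<ge> 1" "q \<ge> 1" "q \<le> 16 * N" "coprime a (int q)" "\<bar>2 * \<tau> - a / q\<bar> \<le> 1 / (16 * N * q)"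
  shows "(norm (wsum N \<tau> \<xi>))\<^sup>2 * (q * (1 / N^2 + \<bar>2 * \<tau> - a / q\<bar>)) \<le> 10 ^ 6"
proof -
  define D where "D = (\<lambda>h. corr N h (of_int h * (2 * \<tau>)))"
  define \<beta> where "\<beta> = \<bar>2 * \<tau> - a / q\<bar>"
  define S where "S = (\<Sum>h\<in>{h\<in>{-4*int N..4*int N}. int q dvd h}. D h)"
  define S' where "S' = (\<Sum>h\<in>{h\<in>{-4*int N..4*int N}. \<not> int q dvd h}. D h)"
  have N0: "real N > 0" and q0: "real q > 0" using assms by auto
  have D: "0 \<le> D h" "N * (nint (of_int h * (2 * \<tau>)))\<^sup>2 * D h \<le> 10" "D h \<le> 5 * N" for h
    using corr_le[OF assms(1)] corr_le_nint[OF assms(1)] by (auto simp: D_def)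
  have S': "S' \<le> 3000 * q" unfolding S'_def by (rule sum_nonmultiples_le[OF assms(1-5)]) (use D in auto)
  have S: "q * S \<le> 120 * N^2" "q * S * \<beta> \<le> 120"
    unfolding S_def \<beta>_def using sum_multiples_le[OF assms(1-3,5), of D] D by auto
  have "(norm (wsum N \<tau> \<xi>))\<^sup>2 \<le> (\<Sum>h\<in>{-4*int N..4*int N}. D h)"
    unfolding D_def by (rule norm_wsum_squared_le[OF assms(1)])
  also have "\<dots> = S + S'"
    unfolding S_def S'_def by (subst sum.union_disjoint[symmetric]) (auto intro!: sum.cong finite_subset[of _ "{-4*int N..4*int N}"])
  finally have "(norm (wsum N \<tau> \<xi>))\<^sup>2 * (q * (1 / N^2 + \<beta>)) \<le> (S + S') * (q * (1 / N^2 + \<beta>))"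
    by (intro mult_right_mono) (auto simp: \<beta>_def)
  also have "\<dots> = q * S / N^2 + q * S * \<beta> + S' * (q * (1 / N^2 + \<beta>))"
    by (simp add: algebra_simps add_divide_distrib)
  also have "\<dots> \<le> 120 + 120 + (3000 * q) * (q * (1 / N^2 + \<beta>))"
  proof (intro add_mono mult_right_mono S S')
    show "q * S / N^2 \<le> 120" using S(1) N0 by (simp add: divide_le_eq)
  qed (auto simp: \<beta>_def)
  also have "\<dots> = 240 + 3000 * ((q / N)\<^sup>2 + q * (q * \<beta>))" by (simp add: field_simps power2_eq_square)
  also have "\<dots> \<le> 240 + 3000 * (16\<^sup>2 + 1)"
  proof (intro add_left_mono mult_left_mono add_mono power_mono)
    show "q / N \<le> 16" using assms(1,3) by (simp add: divide_le_eq flip: of_nat_mult)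
    have "q * (q * \<beta>) \<le> (16 * N) * (q * (1 / (16 * N * q)))"
      using assms(3,5) by (intro mult_mono) (auto simp: \<beta>_def simp flip: of_nat_mult)
    then show "q * (q * \<beta>) \<le> 1" using N0 q0 by simp
  qed auto
  finally show ?thesis by (simp add: \<beta>_def)
qed

section \<open>The circle method on a discrete circle\<close>

lemma nint_eq_0_iff: "nint x = 0 \<longleftrightarrow> x \<in> \<int>"
proof
  show "nint x = 0 \<Longrightarrow> x \<in> \<int>" unfolding nint_def by (metis Ints_of_int abs_eq_0 eq_iff_diff_eq_0)
  assume "x \<in> \<int>"
  then obtain n where "x = of_int n" by (auto elim: Ints_cases)
  then show "nint x = 0" by (simp add: nint_def)
qed

lemma sum_ee_roots:
  assumes "P > 0"
  shows "(\<Sum>k<P. ee (real k * of_int n / P)) = (if int P dvd n then of_nat P else 0)"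
proof (cases "int P dvd n")
  case True
  then obtain m where m: "n = int P * m" by auto
  have "ee (real k * of_int n / P) = 1" for k
    using assms ee_of_int[of "int k * m"] by (simp add: m)
  then show ?thesis using True by simp
next
  case False
  define z where "z = ee (of_int n / P)"
  have zk: "ee (real k * of_int n / P) = z ^ k" for k
  proof -
    have "z ^ k = cis (real k * (2 * pi * (of_int n / P)))" unfolding z_def ee_def by (rule Complex.DeMoivre)
    also have "real k * (2 * pi * (of_int n / P)) = 2 * pi * (real k * of_int n / P)" by simp
    finally show ?thesis by (simp only: ee_def)
  qed
  have "z ^ P = 1" using zk[of P] assms by simp
  moreover have "z \<noteq> 1"
  proof
    assume "z = 1"
    then have "nint (of_int n / P) = 0"
      using norm_one_minus_ee_ge[of "of_int n / P"] nint_nonneg[of "of_int n / P"] by (simp add: z_def)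
    then obtain m where "of_int n / real P = of_int m" by (auto simp: nint_eq_0_iff elim: Ints_cases)
    then have "real_of_int n = of_int (m * int P)" using assms by (simp add: field_simps)
    then have "n = m * int P" by (simp only: of_int_eq_iff)
    then show False using False by simp
  qed
  ultimately have "(\<Sum>k<P. z ^ k) = 0" by (simp add: geometric_sum)
  then show ?thesis using False zk by simp
qed

lemma prod_sum_vec:
  fixes g :: "'d::finite \<Rightarrow> int \<Rightarrow> 'a :: comm_semiring_1"
  assumes "\<And>i. finite (B i)"
  shows "(\<Prod>i\<in>UNIV. \<Sum>n\<in>B i. g i n) = (\<Sum>v\<in>{v::int^'d. \<forall>i. v $ i \<in> B i}. \<Prod>i\<in>UNIV. g i (v $ i))"
proof -
  have "(\<Prod>i\<in>UNIV. \<Sum>n\<in>B i. g i n) = (\<Sum>f\<in>PiE UNIV B. \<Prod>i\<in>UNIV. g i (f i))"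
    by (rule prod_sum_PiE) (use assms in auto)
  also have "\<dots> = (\<Sum>v\<in>{v::int^'d. \<forall>i. v $ i \<in> B i}. \<Prod>i\<in>UNIV. g i (v $ i))"
    by (rule sum.reindex_bij_witness[of _ "\<lambda>v. vec_nth v" "\<lambda>f. vec_lambda f"]) auto
  finally show ?thesis .
qed

definition nsq :: "int ^ 'd::finite \<Rightarrow> int" where "nsq v = (\<Sum>i\<in>UNIV. (v $ i)\<^sup>2)"

lemma nsq_nonneg: "0 \<le> nsq v" by (simp add: nsq_def sum_nonneg)

lemma component_squared_le_nsq: "(v $ i)\<^sup>2 \<le> nsq v"
  unfolding nsq_def by (rule member_le_sum) auto

lemma lattice_sphere_iff: "v \<in> lattice_sphere l \<longleftrightarrow> nsq v = int l"
proof -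
  have "(norm (\<chi> i. real_of_int (v $ i)))\<^sup>2 = real_of_int (nsq v)"
    unfolding nsq_def norm_vec_def L2_set_def by (simp add: sum_nonneg)
  then show ?thesis unfolding lattice_sphere_def by (simp, metis of_int_eq_iff of_int_of_nat_eq)
qed

definition esum :: "nat \<Rightarrow> ('d::finite \<Rightarrow> real) \<Rightarrow> complex" where
  "esum l \<xi> = (\<Sum>v\<in>(lattice_sphere l :: (int ^ 'd) set). ee (\<Sum>i\<in>UNIV. of_int (v $ i) * \<xi> i))"

text \<open>
  The circle method with an average over \<open>P\<close> equally spaced points in place of an integral. As
  \<open>nsq v - l\<close> is smaller than \<open>P\<close> in absolute value on the support of the weight, orthogonality of the
  characters modulo \<open>P\<close> still detects \<open>nsq v = l\<close>. The weight is 1 at all points of the sphere.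
\<close>

lemma esum_circle:
  fixes \<xi> :: "'d::finite \<Rightarrow> real" and N l P :: nat
  assumes "N \<ge> 1" "l < (N + 1)\<^sup>2" "P > 4 * CARD('d) * N\<^sup>2 + l"
  shows "of_nat P * esum l \<xi> = (\<Sum>k<P. ee (- (real l * (real k / P))) * (\<Prod>i\<in>UNIV. wsum N (real k / P) (\<xi> i)))"
proof -
  define V where "V = {v::int^'d. \<forall>i. v $ i \<in> {-2*int N..2*int N}}"
  define W where "W = (\<lambda>v::int^'d. complex_of_real (\<Prod>i\<in>UNIV. trap N (v $ i)))"
  define E where "E = (\<lambda>v::int^'d. ee (\<Sum>i\<in>UNIV. of_int (v $ i) * \<xi> i))"
  have P0: "P > 0" using assms by simp
  have l_less: "int l < (int N + 1)\<^sup>2"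
  proof -
    have "int l < int ((N + 1)\<^sup>2)" using assms(2) by (simp only: of_nat_less_iff)
    then show ?thesis by (simp add: add.commute)
  qed
  have V_le: "\<bar>v $ i\<bar> \<le> 2 * int N" if "v \<in> V" for v i
  proof -
    have "v $ i \<in> {-2*int N..2*int N}" using that by (simp add: V_def)
    then show ?thesis by (simp add: abs_le_iff)
  qed
  have finV: "finite V"
    by (rule finite_subset[OF _ finite_cube[of "2 * N"]]) (use V_le in \<open>auto simp: cube_def\<close>)
  have prod: "(\<Prod>i\<in>UNIV. wsum N \<tau> (\<xi> i)) = (\<Sum>v\<in>V. W v * (ee (of_int (nsq v) * \<tau>) * E v))" for \<tau>
  proof -
    have "(\<Prod>i\<in>UNIV. wsum N \<tau> (\<xi> i)) = (\<Sum>v\<in>V. \<Prod>i\<in>UNIV. of_real (trap N (v $ i)) * ee ((of_int (v $ i))\<^sup>2 * \<tau> + of_int (v $ i) * \<xi> i))"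
      unfolding wsum_def V_def by (rule prod_sum_vec) auto
    also have "\<dots> = (\<Sum>v\<in>V. W v * (ee (of_int (nsq v) * \<tau>) * E v))"
      by (intro sum.cong refl) (simp add: W_def E_def prod.distrib ee_add nsq_def sum_distrib_right ee_sum)
    finally show ?thesis .
  qed
  have V_nsq: "nsq v \<le> 4 * int CARD('d) * (int N)\<^sup>2" if "v \<in> V" for v
  proof -
    have "(v $ i)\<^sup>2 \<le> (2 * int N)\<^sup>2" for i
      using V_le[OF that, of i] abs_le_square_iff[of "v $ i" "2 * int N"] by simp
    then have "nsq v \<le> (\<Sum>i\<in>(UNIV::'d set). (2 * int N)\<^sup>2)" unfolding nsq_def by (intro sum_mono) auto
    then show ?thesis by (simp add: power_mult_distrib)
  qed
  have dvd: "int P dvd nsq v - int l \<longleftrightarrow> nsq v = int l" if "v \<in> V" for v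
  proof
    assume d: "int P dvd nsq v - int l"
    show "nsq v = int l"
    proof (rule ccontr)
      assume "nsq v \<noteq> int l"
      then have "int P \<le> \<bar>nsq v - int l\<bar>" using dvd_imp_le_int[OF _ d] by simp
      moreover have "int P > 4 * int CARD('d) * (int N)\<^sup>2 + int l"
      proof -
        have "int (4 * CARD('d) * N\<^sup>2 + l) < int P" using assms(3) by (simp only: of_nat_less_iff)
        then show ?thesis by simp
      qed
      ultimately show False using V_nsq[OF that] nsq_nonneg[of v] by linarith
    qed
  qed auto
  have "(\<Sum>k<P. ee (- (real l * (real k / P))) * (\<Prod>i\<in>UNIV. wsum N (real k / P) (\<xi> i)))
     = (\<Sum>k<P. \<Sum>v\<in>V. W v * E v * ee (real k * of_int (nsq v - int l) / P))"
    unfolding prod sum_distrib_left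
  proof (intro sum.cong refl)
    fix k :: nat and v :: "int ^ 'd"
    have ek: "ee (- (real l * (real k / P))) * ee (of_int (nsq v) * (real k / P)) = ee (real k * of_int (nsq v - int l) / P)"
      unfolding ee_add[symmetric] by (rule arg_cong[of _ _ ee]) (simp add: algebra_simps diff_divide_distrib)
    then show "ee (- (real l * (real k / P))) * (W v * (ee (of_int (nsq v) * (real k / P)) * E v)) = W v * E v * ee (real k * of_int (nsq v - int l) / P)"
      unfolding ek[symmetric] by (simp only: mult_ac)
  qed
  also have "\<dots> = (\<Sum>v\<in>V. W v * E v * (\<Sum>k<P. ee (real k * of_int (nsq v - int l) / P)))"
    unfolding sum_distrib_left by (rule sum.swap)
  also have "\<dots> = (\<Sum>v\<in>V. if nsq v = int l then W v * E v * of_nat P else 0)"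
    unfolding sum_ee_roots[OF P0] by (intro sum.cong refl) (simp add: dvd)
  also have "\<dots> = (\<Sum>v\<in>{v\<in>V. nsq v = int l}. W v * E v * of_nat P)"
    by (rule sum.inter_filter[OF finV, symmetric])
  also have "{v\<in>V. nsq v = int l} = lattice_sphere l"
  proof -
    have "\<bar>v $ i\<bar> \<le> int N" if "nsq v = int l" for v :: "int ^ 'd" and i
    proof (rule ccontr)
      assume "\<not> \<bar>v $ i\<bar> \<le> int N"
      then have "(int N + 1)\<^sup>2 \<le> (v $ i)\<^sup>2" by (intro abs_le_square_iff[THEN iffD1]) auto
      also have "\<dots> \<le> int l" using component_squared_le_nsq[of v i] that by simp
      also note l_less
      finally show False by simp
    qed
    note bnd = this
    have "v \<in> V" if "nsq v = int l" for v
      unfolding V_def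
    proof (intro CollectI allI)
      fix i show "v $ i \<in> {-2*int N..2*int N}" using bnd[OF that, of i] by (simp add: abs_le_iff)
    qed
    then show ?thesis by (auto simp: lattice_sphere_iff)
  qed
  also have "(\<Sum>v\<in>lattice_sphere l. W v * E v * of_nat P) = (\<Sum>v\<in>lattice_sphere l. of_nat P * E v)"
  proof (intro sum.cong refl)
    fix v :: "int ^ 'd" assume "v \<in> lattice_sphere l"
    then have l: "nsq v = int l" by (simp add: lattice_sphere_iff)
    have "\<bar>v $ i\<bar> \<le> int N" for i
    proof (rule ccontr)
      assume "\<not> \<bar>v $ i\<bar> \<le> int N"
      then have "(int N + 1)\<^sup>2 \<le> (v $ i)\<^sup>2" by (intro abs_le_square_iff[THEN iffD1]) auto
      also have "\<dots> \<le> int l" using component_squared_le_nsq[of v i] l by simp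
      also note l_less
      finally show False by simp
    qed
    then have "W v = 1" by (simp add: W_def trap_eq_1)
    then show "W v * E v * of_nat P = of_nat P * E v" by simp
  qed
  finally show ?thesis by (simp add: esum_def E_def sum_distrib_left)
qed

text \<open>
  The weight \<open>n^(-3/2)\<close>. Five factors of Weyl's bound give \<open>q^(-5/2)\<close>, of which \<open>q^(-3/2)\<close> is left
  after summation over the \<open>O(q)\<close> fractions with denominator \<open>q\<close>.
\<close>

definition bw :: "nat \<Rightarrow> real" where "bw n = 1 / (real n * sqrt n)"

lemma bw_nonneg: "0 \<le> bw n" by (simp add: bw_def)

lemma bw_le_telescope: assumes "n \<ge> 1" shows "bw (Suc n) \<le> 2 / sqrt n - 2 / sqrt (Suc n)"
proof -
  define x y where "x = sqrt n" and "y = sqrt (Suc n)"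
  have x: "x > 0" "x \<le> y" "x\<^sup>2 = n" "y\<^sup>2 = n + 1" using assms by (auto simp: x_def y_def)
  have y: "y > 0" using x by linarith
  have yx: "(y - x) * (y + x) = 1" using x by (simp add: algebra_simps power2_eq_square)
  have "1 = (y - x) * (y + x)" by (simp add: yx)
  also have "\<dots> \<le> (y - x) * (2 * y)" using x by (intro mult_left_mono) auto
  finally have *: "1 \<le> 2 * y * (y - x)" by (simp add: algebra_simps)
  have "bw (Suc n) = 1 / (y\<^sup>2 * y)" using x by (simp add: bw_def y_def)
  also have "\<dots> = x / (x * y * y\<^sup>2)" using x(1) y by (simp add: field_simps)
  also have "\<dots> \<le> (2 * y * (y - x) * y) / (x * y * y\<^sup>2)"
  proof (intro divide_right_mono)
    have "x * 1 \<le> y * (2 * y * (y - x))" using x y * by (intro mult_mono) auto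
    then show "x \<le> 2 * y * (y - x) * y" by (simp add: mult_ac)
  qed (use x y in auto)
  also have "\<dots> = 2 / x - 2 / y" using x(1) y by (simp add: field_simps power2_eq_square)
  finally show ?thesis by (simp add: x_def y_def)
qed

lemma sum_bw_tail: assumes "a \<ge> 1" shows "(\<Sum>n\<in>{a<..b}. bw n) \<le> 2 / sqrt a"
proof -
  have "(\<Sum>n\<in>{a<..b}. bw n) \<le> 2 / sqrt a - 2 / sqrt b" if "a \<le> b" using that
  proof (induction b rule: dec_induct)
    case (step b)
    have "{a<..Suc b} = insert (Suc b) {a<..b}" using step by auto
    then show ?case using step bw_le_telescope[of b] assms by simp
  qed auto
  moreover have "0 \<le> 2 / sqrt b" by simp
  moreover have "(\<Sum>n\<in>{a<..b}. bw n) = 0" if "\<not> a \<le> b" using that by simp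
  ultimately show ?thesis by (smt (verit) divide_nonneg_nonneg real_sqrt_ge_zero of_nat_0_le_iff)
qed

lemma sum_bw_le: assumes "finite A" "0 \<notin> A" shows "(\<Sum>n\<in>A. bw n) \<le> 3"
proof -
  obtain b where b: "A \<subseteq> {..b}" using assms(1) finite_nat_iff_bounded_le by auto
  have "(\<Sum>n\<in>A. bw n) \<le> (\<Sum>n\<in>insert 1 {1<..b}. bw n)"
  proof (rule sum_mono2)
    show "A \<subseteq> insert 1 {1<..b}"
    proof
      fix x assume "x \<in> A"
      then have "x \<le> b" using b by blast
      moreover have "x \<noteq> 0" using \<open>x \<in> A\<close> assms by metis
      ultimately show "x \<in> insert 1 {1<..b}" by auto
    qed
  qed (auto simp: bw_nonneg)
  also have "\<dots> \<le> 1 + 2" using sum_bw_tail[of 1 b] by (simp add: bw_def)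
  finally show ?thesis by simp
qed

lemma card_nat_interval_le:
  fixes x y :: real assumes "x \<le> y"
  shows "finite {k::nat. x \<le> k \<and> real k < y}" "real (card {k::nat. x \<le> real k \<and> real k < y}) \<le> y - x + 1"
proof -
  have sub: "int ` {k::nat. x \<le> k \<and> real k < y} \<subseteq> {\<lceil>x\<rceil>..<\<lceil>y\<rceil>}"
    by (auto simp: ceiling_le_iff less_ceiling_iff)
  then have fin: "finite (int ` {k::nat. x \<le> k \<and> real k < y})" by (rule finite_subset) auto
  then show "finite {k::nat. x \<le> k \<and> real k < y}" by (rule finite_imageD) auto
  have "card {k::nat. x \<le> k \<and> real k < y} = card (int ` {k::nat. x \<le> k \<and> real k < y})"
    by (rule card_image[symmetric]) auto
  also have "\<dots> \<le> card {\<lceil>x\<rceil>..<\<lceil>y\<rceil>}" using sub by (intro card_mono) auto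
  also have "\<dots> = nat (\<lceil>y\<rceil> - \<lceil>x\<rceil>)" by simp
  finally have "real (card {k::nat. x \<le> k \<and> real k < y}) \<le> real (nat (\<lceil>y\<rceil> - \<lceil>x\<rceil>))" by simp
  also have "\<dots> = of_int (\<lceil>y\<rceil> - \<lceil>x\<rceil>)" using assms by (simp add: ceiling_mono)
  also have "\<dots> \<le> y - x + 1" by linarith
  finally show "real (card {k::nat. x \<le> real k \<and> real k < y}) \<le> y - x + 1" .
qed

text \<open>
  The indices \<open>k\<close> in question form two intervals of length \<open>P / (2 N\<^sup>2)\<close>, and \<open>P \<ge> N\<^sup>2\<close> absorbs the
  rounding.
\<close>

lemma card_arc_le:
  fixes N P m :: nat and c :: real
  assumes "N \<ge> 1" "P \<ge> N\<^sup>2"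
  shows "finite {k::nat. nat \<lfloor>(real N)\<^sup>2 * \<bar>2 * (k / P) - c\<bar>\<rfloor> = m}"
    "real (card {k::nat. nat \<lfloor>(real N)\<^sup>2 * \<bar>2 * (k / P) - c\<bar>\<rfloor> = m}) \<le> 4 * P / N\<^sup>2"
proof -
  have N0: "(real N)\<^sup>2 > 0" using assms by simp
  have "0 < N\<^sup>2" using assms(1) by simp
  then have P0: "real P > 0" using assms(2) by linarith
  define L where "L = P / (2 * N\<^sup>2)"
  have L0: "L > 0" using N0 P0 by (simp add: L_def)
  define c' where "c' = c * P / 2"
  let ?A = "{k::nat. nat \<lfloor>(real N)\<^sup>2 * \<bar>2 * (k / P) - c\<bar>\<rfloor> = m}"
  let ?B1 = "{k::nat. c' + m * L \<le> k \<and> real k < c' + (m + 1) * L}"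
  have sub: "?A \<subseteq> ?B1 \<union> {k::nat. c' - (m + 1) * L \<le> k \<and> real k < c' - m * L \<or> real k = c' - m * L}"
  proof
    fix k assume "k \<in> ?A"
    then have "\<lfloor>(real N)\<^sup>2 * \<bar>2 * (k / P) - c\<bar>\<rfloor> = int m" by auto
    then have b: "m \<le> (real N)\<^sup>2 * \<bar>2 * (k / P) - c\<bar>" "(real N)\<^sup>2 * \<bar>2 * (k / P) - c\<bar> < m + 1"
      by linarith+
    have e: "(real N)\<^sup>2 * \<bar>2 * (k / P) - c\<bar> * L = \<bar>k - c'\<bar>"
    proof -
      have "(real N)\<^sup>2 * \<bar>2 * (k / P) - c\<bar> * L = (P / 2) * \<bar>2 * (k / P) - c\<bar>" using N0 by (simp add: L_def)
      also have "\<dots> = \<bar>(P / 2) * (2 * (k / P) - c)\<bar>" by (simp add: abs_mult)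
      also have "(P / 2) * (2 * (k / P) - c) = k - c'" using P0 by (simp add: c'_def field_simps)
      finally show ?thesis .
    qed
    have b1: "m * L \<le> \<bar>k - c'\<bar>" and b2: "\<bar>k - c'\<bar> < (m + 1) * L"
      unfolding e[symmetric] using b L0 by (auto intro: mult_right_mono mult_strict_right_mono)
    show "k \<in> ?B1 \<union> {k::nat. c' - (m + 1) * L \<le> k \<and> real k < c' - m * L \<or> real k = c' - m * L}"
    proof (cases "k \<ge> c'")
      case True
      then have "c' + m * L \<le> k" "real k < c' + (m + 1) * L" using b1 b2 by linarith+
      then show ?thesis by blast
    next
      case False
      then have "c' - (m + 1) * L \<le> k" "real k \<le> c' - m * L" using b1 b2 by linarith+
      then have "c' - (m + 1) * L \<le> k \<and> real k < c' - m * L \<or> real k = c' - m * L" by linarith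
      then show ?thesis by blast
    qed
  qed
  let ?C = "{k::nat. c' - (m + 1) * L \<le> k \<and> real k < c' - m * L}"
  let ?E = "{k::nat. real k = c' - m * L}"
  have E: "finite ?E" "card ?E \<le> 1"
  proof -
    have "\<exists>k0. ?E \<subseteq> {k0}"
    proof (cases "?E = {}")
      case False
      then obtain k0 where "real k0 = c' - m * L" by auto
      then have "?E \<subseteq> {k0}" by (auto simp flip: of_nat_eq_iff[where ?'a = real])
      then show ?thesis by blast
    qed auto
    then obtain k0 where "?E \<subseteq> {k0}" by blast
    then show "finite ?E" "card ?E \<le> 1" using card_mono[of "{k0}" ?E] by (auto intro: finite_subset)
  qed
  have sub': "?A \<subseteq> ?B1 \<union> ?C \<union> ?E" using sub by auto
  have B1: "finite ?B1" "card ?B1 \<le> L + 1"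
    using card_nat_interval_le[of "c' + m * L" "c' + (m + 1) * L"] L0 by (auto simp: algebra_simps)
  have C: "finite ?C" "card ?C \<le> L + 1"
    using card_nat_interval_le[of "c' - (m + 1) * L" "c' - m * L"] L0 by (auto simp: algebra_simps)
  show "finite {k::nat. nat \<lfloor>(real N)\<^sup>2 * \<bar>2 * (k / P) - c\<bar>\<rfloor> = m}"
    by (rule finite_subset[OF sub']) (intro finite_UnI B1 C E)
  have "card ?A \<le> card (?B1 \<union> ?C \<union> ?E)" using B1 C E sub' by (intro card_mono) auto
  also have "\<dots> \<le> card ?B1 + card ?C + card ?E"
    by (meson add_le_mono1 card_Un_le order_trans)
  finally have "real (card ?A) \<le> real (card ?B1) + real (card ?C) + real (card ?E)" by linarith
  also have "\<dots> \<le> (L + 1) + (L + 1) + 1" using B1 C E by linarith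
  finally have "real (card ?A) \<le> 2 * L + 3" by simp
  moreover have "2 * L = P / N\<^sup>2" using N0 by (simp add: L_def field_simps)
  moreover have "1 \<le> P / (real N)\<^sup>2" using assms(2) N0 by (simp add: le_divide_eq flip: of_nat_power)
  ultimately show "real (card ?A) \<le> 4 * P / N\<^sup>2" by simp
qed

section \<open>Summation over arcs\<close>

text \<open>
  Dirichlet approximation of \<open>2 k / P\<close>. The factor 2 is the one that differencing puts in front
  of the quadratic coefficient.
\<close>

lemma exists_arc:
  fixes N P k :: nat
  assumes "N \<ge> 1" "k < P"
  shows "\<exists>a q::nat. coprime (int a) (int q) \<and> 1 \<le> q \<and> q \<le> 16 * N \<and> a \<le> 2 * q
    \<and> \<bar>2 * (real k / real P) - a / q\<bar> \<le> 1 / (16 * N * q)"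
proof -
  define \<theta> where "\<theta> = 2 * (real k / real P)"
  have \<theta>: "0 \<le> \<theta>" "\<theta> < 2" using assms(2) by (auto simp: \<theta>_def divide_less_eq)
  obtain h j where hj: "coprime h j" "0 < j" "j \<le> int (16 * N)" "\<bar>of_int j * \<theta> - of_int h\<bar> < 1 / real (16 * N)"
    using Dirichlet_approx_coprime[of "16 * N" \<theta>] assms(1) by auto
  have "1 / real (16 * N) \<le> 1" using assms(1) by simp
  then have d: "\<bar>of_int j * \<theta> - of_int h\<bar> < 1" using hj(4) by linarith
  have "0 \<le> of_int j * \<theta>" using hj(2) \<theta> by simp
  then have "real_of_int h > -1" using d by linarith
  then have h0: "h \<ge> 0" by linarith
  have "of_int j * \<theta> < of_int j * 2" using hj(2) \<theta> by (intro mult_strict_left_mono) auto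
  then have "real_of_int h < 2 * of_int j + 1" using d by linarith
  then have h2: "h \<le> 2 * j" by linarith
  define a q where "a = nat h" and "q = nat j"
  have aq: "int a = h" "int q = j" using h0 hj(2) by (auto simp: a_def q_def)
  have aq': "real a = of_int h" "real q = of_int j" using aq by (metis of_int_of_nat_eq)+
  have q0: "0 < real q" using hj(2) aq' by simp
  have "\<theta> - a / q = (of_int j * \<theta> - of_int h) / q" using q0 by (simp add: aq' field_simps)
  then have "\<bar>\<theta> - a / q\<bar> = \<bar>of_int j * \<theta> - of_int h\<bar> / q" using q0 by (simp add: abs_divide)
  also have "\<dots> \<le> (1 / real (16 * N)) / q" using hj(4) q0 by (intro divide_right_mono) auto
  finally have "\<bar>\<theta> - a / q\<bar> \<le> 1 / (16 * N * q)" by (simp add: field_simps)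
  moreover have "coprime (int a) (int q)" using hj(1) aq by simp
  moreover have "1 \<le> q" "q \<le> 16 * N" "a \<le> 2 * q" using aq hj h2 by linarith+
  ultimately show ?thesis unfolding \<theta>_def by blast
qed

text \<open>
  Five coordinates are estimated by \<open>weyl_bound\<close> and the others trivially. With \<open>m\<close> the rounded
  distance from the rational in units of \<open>1/N\<^sup>2\<close>, each of the five factors is \<open>O (N / sqrt (q (m + 1)))\<close>.
\<close>

lemma prod_wsum_le:
  fixes \<xi> :: "'d::finite \<Rightarrow> real" and N q m :: nat and \<tau> :: real and a :: int
  assumes "N \<ge> 1" "q \<ge> 1" "q \<le> 16 * N" "coprime a (int q)" "\<bar>2 * \<tau> - a / q\<bar> \<le> 1 / (16 * N * q)"
    and m: "m = nat \<lfloor>(real N)\<^sup>2 * \<bar>2 * \<tau> - a / q\<bar>\<rfloor>" and d: "CARD('d) \<ge> 5"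
  shows "(\<Prod>i\<in>UNIV. norm (wsum N \<tau> (\<xi> i))) \<le> 10^15 * 5^(CARD('d) - 5) * real N ^ CARD('d) * (bw q / q * bw (Suc m))"
proof -
  define y where "y = q * (1 / N\<^sup>2 + \<bar>2 * \<tau> - a / q\<bar>)"
  have N0: "real N > 0" and q0: "real q > 0" using assms by auto
  have "real m \<le> (real N)\<^sup>2 * \<bar>2 * \<tau> - a / q\<bar>" unfolding m by (simp add: of_nat_floor)
  then have "real (Suc m) \<le> (1 + (real N)\<^sup>2 * \<bar>2 * \<tau> - a / q\<bar>)" by simp
  then have "q * real (Suc m) \<le> q * (1 + (real N)\<^sup>2 * \<bar>2 * \<tau> - a / q\<bar>)" by (rule mult_left_mono) simp
  also have "\<dots> = (real N)\<^sup>2 * y" using N0 by (simp add: y_def field_simps)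
  finally have y1: "q * real (Suc m) / (real N)\<^sup>2 \<le> y" using N0 by (simp add: divide_le_eq mult.commute)
  have "0 < q * real (Suc m) / (real N)\<^sup>2" using q0 N0 by simp
  then have y0: "y > 0" using y1 by linarith
  define z where "z = sqrt q * sqrt (Suc m) / N"
  have z0: "z > 0" using q0 N0 by (simp add: z_def)
  have "z\<^sup>2 \<le> y" using y1 by (simp add: z_def power_divide power_mult_distrib)
  then have zy: "z \<le> sqrt y" by (rule real_le_rsqrt)
  define M where "M = min (5 * real N) (1000 / z)"
  have M0: "M > 0" using N0 z0 by (simp add: M_def)
  have le: "norm (wsum N \<tau> (\<xi> i)) \<le> M" for i
  proof -
    have "(norm (wsum N \<tau> (\<xi> i)) * z)\<^sup>2 \<le> (norm (wsum N \<tau> (\<xi> i)))\<^sup>2 * y"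
      unfolding power_mult_distrib using \<open>z\<^sup>2 \<le> y\<close> by (intro mult_left_mono) auto
    also have "\<dots> \<le> 1000\<^sup>2" using weyl_bound[OF assms(1-5), of "\<xi> i"] by (simp add: y_def)
    finally have "norm (wsum N \<tau> (\<xi> i)) * z \<le> 1000" by (rule power2_le_imp_le) simp
    then show ?thesis using norm_wsum_le[OF assms(1), of \<tau> "\<xi> i"] z0 by (simp add: M_def field_simps)
  qed
  have "(\<Prod>i\<in>UNIV. norm (wsum N \<tau> (\<xi> i))) \<le> (\<Prod>i\<in>(UNIV::'d set). M)"
    by (intro prod_mono) (use le in auto)
  also have "\<dots> = M ^ CARD('d)" by simp
  also have "\<dots> = M ^ (CARD('d) - 5) * M ^ 5" using d by (simp flip: power_add)
  also have "\<dots> \<le> (5 * real N) ^ (CARD('d) - 5) * (1000 / z) ^ 5"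
    using M0 by (intro mult_mono power_mono) (auto simp: M_def)
  also have "(1000 / z) ^ 5 = 10^15 * (1 / z^5)" by (simp add: power_divide)
  also have "1 / z ^ 5 = real N ^ 5 * (1 / (sqrt q ^ 5 * sqrt (Suc m) ^ 5))"
    by (simp add: z_def power_divide power_mult_distrib)
  also have "1 / (sqrt q ^ 5 * sqrt (Suc m) ^ 5) \<le> bw q / q * bw (Suc m)"
  proof -
    have p5: "sqrt x ^ 5 = x\<^sup>2 * sqrt x" if "x \<ge> 0" for x :: real
    proof -
      have "sqrt x ^ 5 = ((sqrt x)\<^sup>2)\<^sup>2 * sqrt x" by (simp only: power_mult[symmetric] power_Suc2[symmetric]) simp
      then show ?thesis using that by simp
    qed
    have "1 / (sqrt q ^ 5 * sqrt (Suc m) ^ 5) = bw q / q * (1 / ((Suc m)\<^sup>2 * sqrt (Suc m)))"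
      by (simp add: p5 bw_def power2_eq_square algebra_simps)
    also have "\<dots> \<le> bw q / q * (1 / (Suc m * sqrt (Suc m)))"
    proof (intro mult_left_mono divide_left_mono mult_right_mono mult_pos_pos)
      have "Suc m * 1 \<le> Suc m * Suc m" by (intro mult_left_mono) auto
      then show "real (Suc m) \<le> real ((Suc m)\<^sup>2)" by (simp only: of_nat_le_iff power2_eq_square mult_1_right)
    qed (auto simp: bw_def)
    finally show ?thesis by (simp add: bw_def)
  qed
  finally have "(\<Prod>i\<in>UNIV. norm (wsum N \<tau> (\<xi> i)))
     \<le> (5 * real N) ^ (CARD('d) - 5) * (10^15 * (real N ^ 5 * (bw q / q * bw (Suc m))))"
    by (simp add: mult_left_mono)
  also have "\<dots> = 10^15 * 5^(CARD('d) - 5) * (real N ^ (CARD('d) - 5) * real N ^ 5) * (bw q / q * bw (Suc m))"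
    by (simp add: power_mult_distrib)
  also have "real N ^ (CARD('d) - 5) * real N ^ 5 = real N ^ CARD('d)"
    using d by (simp flip: power_add)
  finally show ?thesis .
qed

text \<open>
  Each pair \<open>(q, m)\<close> is attained by \<open>O(q P / N\<^sup>2)\<close> indices: there are \<open>O(q)\<close> numerators, and
  \<open>O(P / N\<^sup>2)\<close> points in each arc.
\<close>

lemma sum_over_arcs_le:
  fixes N P :: nat and aa qq mm :: "nat \<Rightarrow> nat" and F :: "nat \<Rightarrow> nat \<Rightarrow> real"
  assumes "N \<ge> 1" "P \<ge> N\<^sup>2" "finite U" "finite K"
    and K: "\<And>k. k \<in> K \<Longrightarrow> aa k \<le> 2 * qq k \<and> 1 \<le> qq k \<and> (qq k, mm k) \<in> U
      \<and> mm k = nat \<lfloor>(real N)\<^sup>2 * \<bar>2 * (real k / real P) - aa k / qq k\<bar>\<rfloor> \<and> f k \<le> F (qq k) (mm k)"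
    and F: "\<And>q m. 0 \<le> F q m"
  shows "(\<Sum>k\<in>K. f k) \<le> (12 * P / N\<^sup>2) * (\<Sum>(q,m)\<in>U. q * F q m)"
proof -
  let ?g = "\<lambda>k. (qq k, mm k)"
  have cnt: "real (card {k\<in>K. ?g k = (q, m)}) \<le> 12 * P / N\<^sup>2 * q" for q m
  proof (cases "q \<ge> 1")
    case True
    let ?X = "\<lambda>a. {k::nat. nat \<lfloor>(real N)\<^sup>2 * \<bar>2 * (real k / real P) - real a / q\<bar>\<rfloor> = m}"
    have "{k\<in>K. ?g k = (q, m)} \<subseteq> (\<Union>a\<in>{..2*q}. ?X a)"
    proof
      fix k assume "k \<in> {k\<in>K. ?g k = (q, m)}"
      then have "aa k \<in> {..2*q}" "k \<in> ?X (aa k)" using K[of k] by auto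
      then show "k \<in> (\<Union>a\<in>{..2*q}. ?X a)" by blast
    qed
    then have "card {k\<in>K. ?g k = (q, m)} \<le> card (\<Union>a\<in>{..2*q}. ?X a)"
      using card_arc_le(1)[OF assms(1,2)] by (intro card_mono) auto
    also have "\<dots> \<le> (\<Sum>a\<in>{..2*q}. card (?X a))" by (rule card_UN_le) auto
    finally have "real (card {k\<in>K. ?g k = (q, m)}) \<le> (\<Sum>a\<in>{..2*q}. real (card (?X a)))"
      by (simp flip: of_nat_sum)
    also have "\<dots> \<le> (\<Sum>a\<in>{..2*q}. 4 * P / N\<^sup>2)" by (intro sum_mono card_arc_le(2)[OF assms(1,2)])
    also have "\<dots> = (2 * q + 1) * (4 * P / N\<^sup>2)" by simp
    also have "\<dots> \<le> (3 * q) * (4 * P / N\<^sup>2)" using True by (intro mult_right_mono) auto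
    finally show ?thesis by (simp add: mult_ac)
  next
    case False
    then have "{k\<in>K. ?g k = (q, m)} = {}" using K by fastforce
    then show ?thesis by (simp only: card.empty) simp
  qed
  have "(\<Sum>k\<in>K. f k) \<le> (\<Sum>k\<in>K. F (qq k) (mm k))" by (rule sum_mono) (use K in blast)
  also have "\<dots> = (\<Sum>u\<in>U. \<Sum>k\<in>{k\<in>K. ?g k = u}. F (qq k) (mm k))"
  proof (rule sum.group[symmetric])
    show "?g ` K \<subseteq> U" using K by blast
  qed (use assms(3,4) in auto)
  also have "\<dots> \<le> (\<Sum>u\<in>U. (12 * P / N\<^sup>2) * (fst u * F (fst u) (snd u)))"
  proof (rule sum_mono)
    fix u assume "u \<in> U"
    obtain q m where u: "u = (q, m)" by (cases u)
    have "(\<Sum>k\<in>{k\<in>K. ?g k = u}. F (qq k) (mm k)) = (\<Sum>k\<in>{k\<in>K. ?g k = u}. F q m)"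
      by (intro sum.cong) (auto simp: u)
    also have "\<dots> = real (card {k\<in>K. ?g k = u}) * F q m" by simp
    also have "\<dots> \<le> (12 * P / N\<^sup>2 * q) * F q m" using cnt[of q m] F u by (intro mult_right_mono) auto
    finally show "(\<Sum>k\<in>{k\<in>K. ?g k = u}. F (qq k) (mm k)) \<le> (12 * P / N\<^sup>2) * (fst u * F (fst u) (snd u))"
      by (simp add: u)
  qed
  also have "\<dots> = (12 * P / N\<^sup>2) * (\<Sum>u\<in>U. fst u * F (fst u) (snd u))"
    by (rule sum_distrib_left[symmetric])
  finally show ?thesis by (simp add: case_prod_unfold)
qed

text \<open>
  The arcs with \<open>q > q0\<close> or \<open>m \<ge> K0\<close> are a tail of the convergent double sum of \<open>q^(-3/2) (m+1)^(-3/2)\<close>.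
  This convergence is where dimension at least 5 enters. The remaining arcs have total length
  \<open>O(q0\<^sup>2 K0 / N\<^sup>2)\<close>; on them any saving \<open>\<kappa>\<close> over the trivial bound suffices, which the application
  supplies in the assumption \<open>major\<close>.
\<close>

theorem circle_bound:
  fixes \<xi> :: "'d::finite \<Rightarrow> real" and N P q0 K0 :: nat and c :: "nat \<Rightarrow> complex" and \<kappa> :: real
  assumes "N \<ge> 1" "P \<ge> N\<^sup>2" "CARD('d) \<ge> 5" "q0 \<ge> 1" "K0 \<ge> 1" "\<kappa> \<ge> 0"
    and c: "\<And>k. norm (c k) \<le> 2"
    and major: "\<And>(k::nat) (a::nat) (q::nat). k < P \<Longrightarrow> 1 \<le> q \<Longrightarrow> q \<le> q0 \<Longrightarrow> \<bar>2 * (real k / real P) - a / q\<bar> \<le> K0 / N\<^sup>2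
       \<Longrightarrow> norm (c k * (\<Prod>i\<in>UNIV. wsum N (real k / real P) (\<xi> i))) \<le> \<kappa> * real N ^ CARD('d)"
  shows "norm (\<Sum>k<P. c k * (\<Prod>i\<in>UNIV. wsum N (real k / real P) (\<xi> i)))
     \<le> P * real N ^ (CARD('d) - 2) * (144 * (10^15 * 5^(CARD('d) - 5)) * (1 / sqrt q0 + 1 / sqrt K0) + 12 * \<kappa> * q0\<^sup>2 * K0)"
proof -
  define d where "d = CARD('d)"
  define C :: real where "C = 10^15 * 5^(d - 5)"
  define f where "f = (\<lambda>k. norm (c k * (\<Prod>i\<in>UNIV. wsum N (real k / real P) (\<xi> i))))"
  have N0: "real N > 0" using assms by simp
  have d2: "real N ^ d = real N ^ (d - 2) * (real N)\<^sup>2"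
  proof -
    have "d - 2 + 2 = d" using assms(3) by (simp add: d_def)
    then show ?thesis by (metis power_add)
  qed
  have "\<forall>k\<in>{..<P}. \<exists>aq. case aq of (a, q) \<Rightarrow> coprime (int a) (int q) \<and> 1 \<le> q \<and> q \<le> 16 * N \<and> a \<le> 2 * q
    \<and> \<bar>2 * (real k / real P) - real a / real q\<bar> \<le> 1 / (16 * N * q)"
    using exists_arc[OF assms(1)] by fastforce
  then obtain aq where aq: "\<forall>k\<in>{..<P}. case aq k of (a, q) \<Rightarrow> coprime (int a) (int q) \<and> 1 \<le> q \<and> q \<le> 16 * N \<and> a \<le> 2 * q
    \<and> \<bar>2 * (real k / real P) - real a / real q\<bar> \<le> 1 / (16 * N * q)"
    by (rule bchoice[THEN exE])
  define aa qq where "aa = (\<lambda>k. fst (aq k))" and "qq = (\<lambda>k. snd (aq k))"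
  define mm where "mm = (\<lambda>k. nat \<lfloor>(real N)\<^sup>2 * \<bar>2 * (real k / real P) - aa k / qq k\<bar>\<rfloor>)"
  have arc: "coprime (int (aa k)) (int (qq k))" "1 \<le> qq k" "qq k \<le> 16 * N" "aa k \<le> 2 * qq k"
    "\<bar>2 * (real k / real P) - aa k / qq k\<bar> \<le> 1 / (16 * N * qq k)" if "k < P" for k
    using aq that by (auto simp: aa_def qq_def case_prod_unfold)
  have mmN: "mm k \<le> N" if "k < P" for k
  proof -
    have "(real N)\<^sup>2 * \<bar>2 * (real k / real P) - aa k / qq k\<bar> \<le> (real N)\<^sup>2 * (1 / (16 * N * qq k))"
      using arc(5)[OF that] by (intro mult_left_mono) auto
    also have "\<dots> = N * (1 / (16 * qq k))" using N0 by (simp add: power2_eq_square)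
    also have "\<dots> \<le> real N * 1" using arc(2)[OF that] by (intro mult_left_mono) auto
    finally show ?thesis unfolding mm_def by linarith
  qed
  \<comment> \<open>\<open>T\<close> collects the minor arcs, \<open>G\<close> the major arcs; \<open>U\<close> and \<open>U'\<close> contain the corresponding pairs
    \<open>(q, m)\<close>.\<close>
  define T where "T = {k. k < P \<and> (qq k > q0 \<or> mm k \<ge> K0)}"
  define G where "G = {k. k < P \<and> qq k \<le> q0 \<and> mm k < K0}"
  define U where "U = {q0<..16*N} \<times> {0..N} \<union> {1..16*N} \<times> {K0..N}"
  define U' where "U' = {1..q0} \<times> {..<K0}"
  have "(\<Sum>k\<in>T. f k) \<le> (12 * P / N\<^sup>2) * (\<Sum>(q,m)\<in>U. q * (2 * (C * real N ^ d * (bw q / q * bw (Suc m)))))"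
  proof (rule sum_over_arcs_le[OF assms(1,2), where aa = aa and qq = qq and mm = mm])
    fix k assume "k \<in> T"
    then have k: "k < P" and kT: "qq k > q0 \<or> mm k \<ge> K0" by (auto simp: T_def)
    have "f k \<le> 2 * (C * real N ^ d * (bw (qq k) / qq k * bw (Suc (mm k))))"
      unfolding f_def norm_mult
    proof (intro mult_mono c)
      show "norm (\<Prod>i\<in>UNIV. wsum N (real k / real P) (\<xi> i)) \<le> C * real N ^ d * (bw (qq k) / qq k * bw (Suc (mm k)))"
        using prod_wsum_le[OF assms(1) arc(2,3,1)[OF k], of "real k / real P" "mm k" \<xi>] arc(5)[OF k] assms(3)
        by (simp add: prod_norm mm_def C_def d_def)
    qed auto
    then show "aa k \<le> 2 * qq k \<and> 1 \<le> qq k \<and> (qq k, mm k) \<in> U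
      \<and> mm k = nat \<lfloor>(real N)\<^sup>2 * \<bar>2 * (real k / real P) - aa k / qq k\<bar>\<rfloor>
      \<and> f k \<le> 2 * (C * real N ^ d * (bw (qq k) / qq k * bw (Suc (mm k))))"
      using arc[OF k] mmN[OF k] kT by (auto simp: U_def mm_def)
  qed (auto simp: U_def T_def C_def bw_nonneg)
  also have "\<dots> = (12 * P / N\<^sup>2) * (2 * C * real N ^ d * (\<Sum>(q,m)\<in>U. bw q * bw (Suc m)))"
  proof -
    have "(\<Sum>(q,m)\<in>U. q * (2 * (C * real N ^ d * (bw q / q * bw (Suc m))))) = (\<Sum>(q,m)\<in>U. 2 * C * real N ^ d * (bw q * bw (Suc m)))"
      by (intro sum.cong) (auto simp: U_def)
    then show ?thesis by (simp add: sum_distrib_left case_prod_unfold)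
  qed
  also have "\<dots> \<le> (12 * P / N\<^sup>2) * (2 * C * real N ^ d * (6 * (1 / sqrt q0 + 1 / sqrt K0)))"
  proof (intro mult_left_mono)
    have prod: "(\<Sum>(q,m)\<in>A \<times> B. bw q * bw (Suc m)) = (\<Sum>q\<in>A. bw q) * (\<Sum>m\<in>B. bw (Suc m))" for A B
      by (simp add: sum_product sum.cartesian_product)
    have Suc: "(\<Sum>m\<in>{x..N}. bw (Suc m)) = (\<Sum>n\<in>{x<..Suc N}. bw n)" for x
      by (rule sum.reindex_bij_witness[of _ "\<lambda>n. n - 1" Suc]) auto
    have "(\<Sum>(q,m)\<in>U. bw q * bw (Suc m)) \<le> (\<Sum>(q,m)\<in>{q0<..16*N} \<times> {0..N}. bw q * bw (Suc m)) + (\<Sum>(q,m)\<in>{1..16*N} \<times> {K0..N}. bw q * bw (Suc m))"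
      unfolding U_def by (subst sum_Un) (auto intro!: sum_nonneg simp: bw_nonneg)
    also have "\<dots> \<le> (2 / sqrt q0) * 3 + 3 * (2 / sqrt K0)"
      unfolding prod Suc
    proof (intro add_mono mult_mono sum_bw_tail sum_bw_le sum_nonneg)
    qed (use assms bw_nonneg in auto)
    finally show "(\<Sum>(q,m)\<in>U. bw q * bw (Suc m)) \<le> 6 * (1 / sqrt q0 + 1 / sqrt K0)" by simp
  qed (auto simp: C_def)
  finally have T: "(\<Sum>k\<in>T. f k) \<le> P * real N ^ (d - 2) * (144 * C * (1 / sqrt q0 + 1 / sqrt K0))"
    using N0 by (simp add: d2 algebra_simps)
  have "(\<Sum>k\<in>G. f k) \<le> (12 * P / N\<^sup>2) * (\<Sum>(q,m)\<in>U'. q * (\<kappa> * real N ^ d))"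
  proof (rule sum_over_arcs_le[OF assms(1,2), where aa = aa and qq = qq and mm = mm])
    fix k assume "k \<in> G"
    then have k: "k < P" "qq k \<le> q0" "mm k < K0" by (auto simp: G_def)
    have "(real N)\<^sup>2 * \<bar>2 * (real k / real P) - aa k / qq k\<bar> \<le> K0"
      using k(3) unfolding mm_def by linarith
    then have "\<bar>2 * (real k / real P) - aa k / qq k\<bar> \<le> K0 / N\<^sup>2" using N0 by (simp add: field_simps)
    then have "f k \<le> \<kappa> * real N ^ d"
      unfolding f_def d_def using arc(2)[OF k(1)] k by (intro major) auto
    then show "aa k \<le> 2 * qq k \<and> 1 \<le> qq k \<and> (qq k, mm k) \<in> U'
      \<and> mm k = nat \<lfloor>(real N)\<^sup>2 * \<bar>2 * (real k / real P) - aa k / qq k\<bar>\<rfloor> \<and> f k \<le> \<kappa> * real N ^ d"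
      using arc[OF k(1)] k by (auto simp: U'_def mm_def)
  qed (use assms(6) in \<open>auto simp: U'_def G_def\<close>)
  also have "\<dots> \<le> (12 * P / N\<^sup>2) * (q0\<^sup>2 * K0 * (\<kappa> * real N ^ d))"
  proof (intro mult_left_mono)
    have "(\<Sum>(q,m)\<in>U'. real q * (\<kappa> * real N ^ d)) \<le> (\<Sum>(q,m)\<in>U'. real q0 * (\<kappa> * real N ^ d))"
      using assms(6) by (intro sum_mono) (auto simp: U'_def intro!: mult_right_mono)
    also have "\<dots> = q0\<^sup>2 * K0 * (\<kappa> * real N ^ d)" by (simp add: U'_def power2_eq_square)
    finally show "(\<Sum>(q,m)\<in>U'. real q * (\<kappa> * real N ^ d)) \<le> q0\<^sup>2 * K0 * (\<kappa> * real N ^ d)" .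
  qed auto
  also have "\<dots> = P * real N ^ (d - 2) * (12 * \<kappa> * q0\<^sup>2 * K0)"
    using N0 by (simp add: d2)
  finally have G: "(\<Sum>k\<in>G. f k) \<le> P * real N ^ (d - 2) * (12 * \<kappa> * q0\<^sup>2 * K0)" .
  have "norm (\<Sum>k<P. c k * (\<Prod>i\<in>UNIV. wsum N (real k / real P) (\<xi> i))) \<le> (\<Sum>k<P. f k)"
    unfolding f_def by (rule norm_sum)
  also have PTG: "{..<P} = T \<union> G" by (auto simp: T_def G_def)
  also have "(\<Sum>k\<in>T \<union> G. f k) = (\<Sum>k\<in>T. f k) + (\<Sum>k\<in>G. f k)"
    by (rule sum.union_disjoint) (auto simp: T_def G_def)
  also have "\<dots> \<le> P * real N ^ (d - 2) * (144 * C * (1 / sqrt q0 + 1 / sqrt K0)) + P * real N ^ (d - 2) * (12 * \<kappa> * q0\<^sup>2 * K0)"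
    by (intro add_mono T G)
  finally show ?thesis by (simp only: PTG distrib_left C_def d_def)
qed

section \<open>Decay of spherical exponential sums and comparison of spheres\<close>

text \<open>
  Near \<open>a / (2q)\<close> the quadratic phase is almost periodic with period \<open>2 q\<close>, because
  \<open>n\<^sup>2 - (n - 2q)\<^sup>2 = 4 q (n - q)\<close>. Summation by parts with step \<open>2 q\<close> then shows that the sum can only
  be large if \<open>2 q \<xi>\<close> is close to an integer.
\<close>

lemma wsum_near_rational:
  fixes N q :: nat and a :: int and \<tau> \<xi> B :: real
  assumes "N \<ge> 1" "q \<ge> 1" "q \<le> N" "\<bar>2 * \<tau> - a / q\<bar> \<le> B / N\<^sup>2"
  shows "nint (2 * q * \<xi>) * norm (wsum N \<tau> \<xi>) \<le> 7 * q * (1 + 40 * B)"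
proof -
  define \<beta> where "\<beta> = 2 * \<tau> - a / q"
  have N0: "real N > 0" and q0: "real q > 0" using assms by auto
  have B0: "B \<ge> 0"
  proof -
    have "0 \<le> B / (real N)\<^sup>2" using order.trans[OF abs_ge_zero assms(4)] by simp
    then show ?thesis using N0 by (simp add: zero_le_divide_iff)
  qed
  define L where "L = 2 * int q"
  define G where "G = (\<lambda>n. of_real (trap N n) * ee ((of_int n)\<^sup>2 * \<tau>))"
  define I where "I = {-2*int N..2*int N+L}"
  have G0: "G n = 0" if "n \<notin> {-2*int N..2*int N+L-L}" for n
    using that assms trap_eq_0[of N n] by (auto simp: G_def)
  have w: "wsum N \<tau> \<xi> = (\<Sum>n\<in>I. G n * ee (of_int n * \<xi>))"
  proof -
    have "wsum N \<tau> \<xi> = (\<Sum>n\<in>{-2*int N..2*int N}. G n * ee (of_int n * \<xi>))"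
      by (simp add: wsum_def G_def ee_add mult_ac)
    also have "\<dots> = (\<Sum>n\<in>I. G n * ee (of_int n * \<xi>))"
      by (rule sum.mono_neutral_left) (use G0 in \<open>auto simp: I_def L_def\<close>)
    finally show ?thesis .
  qed
  have step: "norm (G n - G (n - L)) \<le> q * (2 + 80 * B) / N" if n: "n \<in> I" for n
  proof -
    \<comment> \<open>Since \<open>2 \<tau> = a/q + \<beta>\<close>, the phase increment \<open>4 q (n - q) \<tau>\<close> is an integer plus
      \<open>2 q (n - q) \<beta>\<close>.\<close>
    have e: "ee ((of_int n)\<^sup>2 * \<tau>) = ee ((of_int (n - L))\<^sup>2 * \<tau> + 2 * q * (n - int q) * \<beta>)"
    proof -
      have "(of_int n)\<^sup>2 * \<tau> = ((of_int (n - L))\<^sup>2 * \<tau> + 2 * q * (n - int q) * \<beta>) + of_int (2 * (n - int q) * a)"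
        using q0 by (simp add: L_def \<beta>_def power2_eq_square field_simps)
      then show ?thesis by (simp only: ee_add_int)
    qed
    have "\<bar>n - int q\<bar> \<le> 5 * int N" using n assms by (auto simp: I_def L_def)
    then have n5: "\<bar>real_of_int n - q\<bar> \<le> 5 * N" by linarith
    have "norm (ee ((of_int n)\<^sup>2 * \<tau>) - ee ((of_int (n - L))\<^sup>2 * \<tau>)) \<le> 2 * pi * \<bar>2 * q * (n - int q) * \<beta>\<bar>"
      unfolding e by (rule order.trans[OF norm_ee_diff_le]) simp
    also have "\<bar>2 * q * (n - int q) * \<beta>\<bar> = 2 * q * \<bar>real_of_int n - q\<bar> * \<bar>\<beta>\<bar>" by (simp add: abs_mult)
    also have "2 * pi * \<dots> \<le> 2 * 4 * (2 * real q * (5 * real N) * (B / (real N)\<^sup>2))"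
      using n5 assms(4) pi_less_4 by (intro mult_mono) (auto simp: \<beta>_def)
    also have "\<dots> = q * (80 * B) / N" using N0 by (simp add: power2_eq_square field_simps)
    finally have 1: "norm (ee ((of_int n)\<^sup>2 * \<tau>) - ee ((of_int (n - L))\<^sup>2 * \<tau>)) \<le> q * (80 * B) / N" .
    have 2: "\<bar>trap N n - trap N (n - L)\<bar> \<le> q * 2 / N"
      using trap_lipschitz[of N n "n - L"] by (simp add: L_def mult.commute)
    have "G n - G (n - L) = of_real (trap N n - trap N (n - L)) * ee ((of_int (n - L))\<^sup>2 * \<tau>)
       + of_real (trap N n) * (ee ((of_int n)\<^sup>2 * \<tau>) - ee ((of_int (n - L))\<^sup>2 * \<tau>))"
      by (simp add: G_def algebra_simps)
    also have "norm \<dots> \<le> \<bar>trap N n - trap N (n - L)\<bar> * 1 + 1 * norm (ee ((of_int n)\<^sup>2 * \<tau>) - ee ((of_int (n - L))\<^sup>2 * \<tau>))"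
      by (rule order.trans[OF norm_triangle_ineq], unfold norm_mult norm_of_real norm_ee, intro add_mono mult_right_mono) auto
    also have "\<dots> \<le> q * 2 / N + q * (80 * B) / N" using 1 2 by simp
    finally show ?thesis by (simp add: algebra_simps add_divide_distrib)
  qed
  have "2 * nint (of_int L * \<xi>) * norm (wsum N \<tau> \<xi>) \<le> (\<Sum>n\<in>I. norm (G n - G (n - L)))"
    unfolding w I_def by (rule norm_sum_ee_le) (use G0 in \<open>auto simp: L_def\<close>)
  also have "\<dots> \<le> (\<Sum>n\<in>I. q * (2 + 80 * B) / N)" by (intro sum_mono step)
  also have "\<dots> = (4 * N + 2 * q + 1) * (q * (2 + 80 * B) / N)" by (simp add: I_def L_def)
  also have "\<dots> \<le> (7 * N) * (q * (2 + 80 * B) / N)"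
    using assms B0 by (intro mult_right_mono) auto
  also have "\<dots> = 2 * (7 * q * (1 + 40 * B))" using N0 by (simp add: field_simps)
  finally have "2 * (nint (of_int L * \<xi>) * norm (wsum N \<tau> \<xi>)) \<le> 2 * (7 * q * (1 + 40 * B))"
    by (simp only: mult.assoc)
  then have "nint (of_int L * \<xi>) * norm (wsum N \<tau> \<xi>) \<le> 7 * q * (1 + 40 * B)"
    by (rule mult_left_le_imp_le) simp
  then show ?thesis by (simp add: L_def)
qed

lemma exists_large_sqrt:
  fixes x :: real assumes "\<epsilon> > 0"
  shows "\<exists>n::nat. (1::nat) \<le> n \<and> x / sqrt (real n) \<le> \<epsilon>"
proof -
  have "((\<lambda>n. x / sqrt (real n)) \<longlongrightarrow> 0) sequentially"
    by (intro tendsto_divide_0[OF tendsto_const] filterlim_at_top_imp_at_infinity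
      filterlim_compose[OF sqrt_at_top filterlim_real_sequentially])
  then have "eventually (\<lambda>n. x / sqrt (real n) < \<epsilon>) sequentially"
    using assms by (rule order_tendstoD(2))
  then have "eventually (\<lambda>n. (1::nat) \<le> n \<and> x / sqrt (real n) \<le> \<epsilon>) sequentially"
    using eventually_ge_at_top[of 1] by eventually_elim auto
  then show ?thesis by (rule eventually_happens'[OF sequentially_bot])
qed

text \<open>
  If every multiple \<open>q \<xi>\<close> with \<open>q \<le> 2 q0\<close> has a coordinate away from the integers, then on every major
  arc one factor of the product is small by \<open>wsum_near_rational\<close>. This is the saving that
  \<open>circle_bound\<close> asks for.
\<close>

theorem esum_decay:
  fixes \<epsilon> :: real
  assumes "CARD('d::finite) \<ge> 5" "\<epsilon> > 0"
  shows "\<exists>(Q::nat) (K::real). Q \<ge> 1 \<and> K > 0 \<and> (\<forall>(N::nat) (l::nat) (\<xi>::'d \<Rightarrow> real).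
     N \<ge> Q \<longrightarrow> N\<^sup>2 \<le> l \<longrightarrow> l < (N + 1)\<^sup>2 \<longrightarrow> norm (esum l \<xi>) > \<epsilon> * real N ^ (CARD('d) - 2) \<longrightarrow>
     (\<exists>q. 1 \<le> q \<and> q \<le> Q \<and> (\<forall>i. nint (real q * \<xi> i) \<le> K / N)))"
proof -
  define C :: real where "C = 144 * (10^15 * 5^(CARD('d) - 5))"
  obtain q0 :: nat where q0: "q0 \<ge> 1" "2 * C / sqrt q0 \<le> \<epsilon> / 2"
    using exists_large_sqrt[of "\<epsilon> / 2" "2 * C"] assms(2) by auto
  \<comment> \<open>With both cutoffs equal to \<open>q0\<close> the major arcs contribute \<open>12 \<kappa> q0^3 = \<epsilon>/2\<close>.\<close>
  define \<kappa> where "\<kappa> = \<epsilon> / (24 * real q0 ^ 3)"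
  have \<kappa>0: "\<kappa> > 0" using q0 assms(2) by (simp add: \<kappa>_def)
  define V where "V = 7 * real q0 * (1 + 40 * real q0)"
  have V0: "V > 0" using q0 unfolding V_def by (intro mult_pos_pos) auto
  define K where "K = V * 5 ^ (CARD('d) - 1) / \<kappa>"
  have K0: "K > 0" using V0 \<kappa>0 by (simp add: K_def)
  have "\<exists>q. 1 \<le> q \<and> q \<le> 2 * q0 \<and> (\<forall>i. nint (real q * \<xi> i) \<le> K / N)"
    if N: "N \<ge> 2 * q0" and l: "N\<^sup>2 \<le> l" "l < (N + 1)\<^sup>2" and big: "norm (esum l \<xi>) > \<epsilon> * real N ^ (CARD('d) - 2)"
    for N l :: nat and \<xi> :: "'d \<Rightarrow> real"
  proof (rule ccontr)
    assume neg: "\<not> (\<exists>q. 1 \<le> q \<and> q \<le> 2 * q0 \<and> (\<forall>i. nint (real q * \<xi> i) \<le> K / N))"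
    have N1: "N \<ge> 1" using N q0 by simp
    then have N0: "real N > 0" by simp
    define P where "P = 4 * CARD('d) * N\<^sup>2 + l + N\<^sup>2"
    have "0 < N\<^sup>2" using N1 by simp
    then have P: "P \<ge> N\<^sup>2" "P > 4 * CARD('d) * N\<^sup>2 + l" "0 < P" unfolding P_def by linarith+
    have "of_nat P * esum l \<xi> = (\<Sum>k<P. ee (- (real l * (real k / real P))) * (\<Prod>i\<in>UNIV. wsum N (real k / real P) (\<xi> i)))"
      by (rule esum_circle[OF N1 l(2) P(2)])
    then have "P * norm (esum l \<xi>) = norm (\<Sum>k<P. ee (- (real l * (real k / real P))) * (\<Prod>i\<in>UNIV. wsum N (real k / real P) (\<xi> i)))"
      by (metis norm_mult norm_of_nat)
    also have "\<dots> \<le> P * real N ^ (CARD('d) - 2) * (144 * (10^15 * 5^(CARD('d) - 5)) * (1 / sqrt q0 + 1 / sqrt q0) + 12 * \<kappa> * q0\<^sup>2 * q0)"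
    proof (rule circle_bound[OF N1 P(1) assms(1) q0(1) q0(1) less_imp_le[OF \<kappa>0],
          where c = "\<lambda>k. ee (- (real l * (real k / real P)))" and \<xi> = \<xi>])
      fix k a q :: nat
      assume kq: "k < P" "1 \<le> q" "q \<le> q0" "\<bar>2 * (real k / real P) - a / q\<bar> \<le> q0 / N\<^sup>2"
      define \<tau> where "\<tau> = real k / real P"
      have "1 \<le> 2 * q \<and> 2 * q \<le> 2 * q0" using kq by simp
      then obtain i where i: "K / N < nint (2 * q * \<xi> i)"
        using neg by (metis linorder_not_le of_nat_mult of_nat_numeral)
      have "nint (2 * q * \<xi> i) * norm (wsum N \<tau> (\<xi> i)) \<le> 7 * q * (1 + 40 * real q0)"
        using wsum_near_rational[OF N1 kq(2), of \<tau> "int a" "real q0" "\<xi> i"] kq(3,4) N by (simp add: \<tau>_def)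
      also have "\<dots> \<le> V" unfolding V_def using kq(3) by (intro mult_right_mono mult_left_mono) auto
      finally have "K / N * norm (wsum N \<tau> (\<xi> i)) \<le> V"
        using i by (meson less_imp_le mult_right_mono norm_ge_zero order_trans)
      then have wi: "norm (wsum N \<tau> (\<xi> i)) \<le> V * N / K" using N0 K0 by (simp add: field_simps)
      have "norm (\<Prod>i\<in>UNIV. wsum N \<tau> (\<xi> i)) = norm (wsum N \<tau> (\<xi> i)) * (\<Prod>j\<in>UNIV - {i}. norm (wsum N \<tau> (\<xi> j)))"
        unfolding prod_norm[symmetric] by (rule prod.remove) auto
      also have "\<dots> \<le> (V * N / K) * (\<Prod>j\<in>UNIV - {i}. 5 * real N)"
        by (intro mult_mono wi prod_mono) (use norm_wsum_le[OF N1] V0 K0 in \<open>auto intro!: prod_nonneg\<close>)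
      also have "(\<Prod>j\<in>UNIV - {i}. 5 * real N) = (5 * real N) ^ (CARD('d) - 1)" by simp
      also have "(V * N / K) * (5 * real N) ^ (CARD('d) - 1) = (V * 5 ^ (CARD('d) - 1) / K) * (N * real N ^ (CARD('d) - 1))"
        by (simp add: power_mult_distrib)
      also have "V * 5 ^ (CARD('d) - 1) / K = \<kappa>" using V0 \<kappa>0 by (simp add: K_def)
      also have "N * real N ^ (CARD('d) - 1) = real N ^ CARD('d)"
        using assms(1) by (metis mult.commute power_minus_mult zero_less_card_finite)
      finally show "norm (ee (- (real l * (real k / real P))) * (\<Prod>i\<in>UNIV. wsum N (real k / real P) (\<xi> i))) \<le> \<kappa> * real N ^ CARD('d)"
        by (simp add: norm_mult \<tau>_def)
    qed (use \<kappa>0 in auto)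
    also have "\<dots> \<le> P * real N ^ (CARD('d) - 2) * \<epsilon>"
    proof (intro mult_left_mono)
      have "12 * \<kappa> * q0\<^sup>2 * q0 = \<epsilon> / 2" using q0(1) by (simp add: \<kappa>_def power2_eq_square power3_eq_cube)
      then show "144 * (10^15 * 5^(CARD('d) - 5)) * (1 / sqrt q0 + 1 / sqrt q0) + 12 * \<kappa> * q0\<^sup>2 * q0 \<le> \<epsilon>"
        using q0(2) by (simp add: C_def)
    qed auto
    finally have "P * norm (esum l \<xi>) \<le> P * (\<epsilon> * real N ^ (CARD('d) - 2))" by (simp add: mult_ac)
    then have "norm (esum l \<xi>) \<le> \<epsilon> * real N ^ (CARD('d) - 2)" using P(3) by simp
    then show False using big by simp
  qed
  moreover have "2 * q0 \<ge> 1" using q0 by simp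
  ultimately show ?thesis using K0 by blast
qed

lemma esum_0: "esum l (\<lambda>_::'d::finite. 0) = of_nat (card (lattice_sphere l :: (int ^ 'd) set))"
  by (simp add: esum_def)

text \<open>
  The circle formula is applied to the difference of two radii. Its coefficients
  \<open>ee (- l \<tau>) - ee (- l' \<tau>)\<close> nearly vanish on the major arcs: at \<open>2 \<tau> = a/q\<close> with \<open>q \<le> q0\<close> they are
  exactly 0 because \<open>2 q\<close> divides \<open>l - l'\<close>, and for \<open>l'\<close> close to \<open>l\<close> they vary slowly.
\<close>

theorem card_sphere_compare:
  fixes N l l' q0 :: nat
  assumes "CARD('d::finite) \<ge> 5" "N \<ge> 1" "l < (N + 1)\<^sup>2" "l' \<le> l" "q0 \<ge> 1" "2 * fact q0 dvd l - l'"
    "real (l - l') \<le> l / (5 ^ CARD('d) * real q0 ^ 5)"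
  shows "\<bar>real (card (lattice_sphere l :: (int ^ 'd) set)) - real (card (lattice_sphere l' :: (int ^ 'd) set))\<bar>
     \<le> (288 * (10^15 * 5^(CARD('d) - 5)) + 192) / sqrt q0 * real N ^ (CARD('d) - 2)"
proof -
  define \<xi> where "\<xi> = (\<lambda>_::'d. 0 :: real)"
  define r where "r = (\<lambda>l. card (lattice_sphere l :: (int ^ 'd) set))"
  have N0: "real N > 0" using assms by simp
  define P where "P = 4 * CARD('d) * N\<^sup>2 + l + N\<^sup>2"
  have "0 < N\<^sup>2" using assms(2) by simp
  then have P: "P \<ge> N\<^sup>2" "P > 4 * CARD('d) * N\<^sup>2 + l" "P > 4 * CARD('d) * N\<^sup>2 + l'" "0 < P" "l' < (N + 1)\<^sup>2"
    using assms(3,4) unfolding P_def by linarith+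
  define c where "c = (\<lambda>k. ee (- (real l * (real k / real P))) - ee (- (real l' * (real k / real P))))"
  have lN: "real l \<le> 4 * (real N)\<^sup>2"
  proof -
    have "(N + 1)\<^sup>2 \<le> (2 * N)\<^sup>2" using assms(2) by (intro power_mono) auto
    then have "l \<le> (2 * N)\<^sup>2" using assms(3) by linarith
    then have "real l \<le> real ((2 * N)\<^sup>2)" by (simp only: of_nat_le_iff)
    then show ?thesis by (simp add: power_mult_distrib)
  qed
  define \<kappa> where "\<kappa> = 16 / real q0 ^ 4"
  have \<kappa>0: "\<kappa> \<ge> 0" by (simp add: \<kappa>_def)
  have "of_nat P * (esum l \<xi> - esum l' \<xi>) = (\<Sum>k<P. c k * (\<Prod>i\<in>UNIV. wsum N (real k / real P) (\<xi> i)))"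
    unfolding right_diff_distrib esum_circle[OF assms(2,3) P(2)] esum_circle[OF assms(2) P(5,3)]
    by (simp add: c_def left_diff_distrib sum_subtractf)
  then have "P * norm (esum l \<xi> - esum l' \<xi>) = norm (\<Sum>k<P. c k * (\<Prod>i\<in>UNIV. wsum N (real k / real P) (\<xi> i)))"
    by (metis norm_mult norm_of_nat)
  also have "\<dots> \<le> P * real N ^ (CARD('d) - 2) * (144 * (10^15 * 5^(CARD('d) - 5)) * (1 / sqrt q0 + 1 / sqrt q0) + 12 * \<kappa> * q0\<^sup>2 * q0)"
  proof (rule circle_bound[OF assms(2) P(1) assms(1) assms(5,5) \<kappa>0])
    show "norm (c k) \<le> 2" for k unfolding c_def by (rule order.trans[OF norm_triangle_ineq4]) simp
    fix k a q :: nat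
    assume kq: "k < P" "1 \<le> q" "q \<le> q0" "\<bar>2 * (real k / real P) - a / q\<bar> \<le> q0 / N\<^sup>2"
    define \<tau> where "\<tau> = real k / real P"
    define \<beta> where "\<beta> = 2 * \<tau> - a / q"
    have "q dvd fact q0" using kq by (intro dvd_fact) auto
    then have "2 * q dvd l - l'" using assms(6) by (meson dvd_trans mult_dvd_mono dvd_refl)
    then obtain m where m: "l - l' = 2 * q * m" by (elim dvdE)
    then have m': "real l - real l' = 2 * real q * real m" using assms(4)
      by (metis of_nat_diff of_nat_mult of_nat_numeral)
    have "- (real l' * \<tau>) = - (real l * \<tau>) + (real q * real m * \<beta>) + of_int (int (m * a))"
    proof -
      have "2 * real q * real m * \<tau> = real q * real m * \<beta> + real (m * a)"
        using kq(2) by (simp add: \<beta>_def field_simps)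
      then show ?thesis unfolding m'[symmetric] by (simp add: algebra_simps)
    qed
    then have "ee (- (real l' * \<tau>)) = ee (- (real l * \<tau>) + (real q * real m * \<beta>))"
      by (simp only: ee_add_int)
    then have "norm (c k) \<le> 2 * pi * \<bar>real q * real m * \<beta>\<bar>"
      unfolding c_def \<tau>_def[symmetric] using norm_ee_diff_le[of "- (real l * \<tau>)" "- (real l * \<tau>) + (real q * real m * \<beta>)"] by simp
    also have "\<dots> = pi * (real (l - l') * \<bar>\<beta>\<bar>)" by (simp add: m abs_mult)
    also have "\<dots> \<le> 4 * ((l / (5 ^ CARD('d) * real q0 ^ 5)) * (q0 / N\<^sup>2))"
      using pi_less_4 assms(7) kq(4) by (intro mult_mono) (auto simp: \<beta>_def \<tau>_def)
    also have "\<dots> \<le> 4 * ((4 * (real N)\<^sup>2 / (5 ^ CARD('d) * real q0 ^ 5)) * (q0 / N\<^sup>2))"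
      using lN by (intro mult_left_mono mult_right_mono divide_right_mono) auto
    also have "\<dots> = \<kappa> / 5 ^ CARD('d)" using N0 assms(5) by (simp add: \<kappa>_def field_simps eval_nat_numeral)
    finally have ck: "norm (c k) \<le> \<kappa> / 5 ^ CARD('d)" .
    have "norm (\<Prod>i\<in>UNIV. wsum N \<tau> (\<xi> i)) \<le> (\<Prod>i\<in>(UNIV::'d set). 5 * real N)"
      unfolding prod_norm[symmetric] by (intro prod_mono) (use norm_wsum_le[OF assms(2)] in auto)
    then have "norm (\<Prod>i\<in>UNIV. wsum N \<tau> (\<xi> i)) \<le> 5 ^ CARD('d) * real N ^ CARD('d)" by (simp add: power_mult_distrib)
    then have "norm (c k) * norm (\<Prod>i\<in>UNIV. wsum N \<tau> (\<xi> i)) \<le> (\<kappa> / 5 ^ CARD('d)) * (5 ^ CARD('d) * real N ^ CARD('d))"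
      using ck \<kappa>0 by (intro mult_mono) auto
    then show "norm (c k * (\<Prod>i\<in>UNIV. wsum N (real k / real P) (\<xi> i))) \<le> \<kappa> * real N ^ CARD('d)"
      by (simp add: norm_mult \<tau>_def)
  qed
  also have "\<dots> \<le> P * real N ^ (CARD('d) - 2) * ((288 * (10^15 * 5^(CARD('d) - 5)) + 192) / sqrt q0)"
  proof (intro mult_left_mono)
    have "12 * \<kappa> * q0\<^sup>2 * q0 = 192 / q0" using assms(5) by (simp add: \<kappa>_def eval_nat_numeral)
    also have "\<dots> \<le> 192 / sqrt q0"
    proof (intro divide_left_mono mult_pos_pos)
      have "sqrt q0 \<le> sqrt (real q0 * real q0)" using assms(5) by (intro real_sqrt_le_mono) (simp add: mult_le_cancel_left1)
      then show "sqrt q0 \<le> q0" by simp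
    qed (use assms(5) in auto)
    finally have "12 * \<kappa> * q0\<^sup>2 * q0 \<le> 192 / sqrt q0" .
    then show "144 * (10^15 * 5^(CARD('d) - 5)) * (1 / sqrt q0 + 1 / sqrt q0) + 12 * \<kappa> * q0\<^sup>2 * q0
       \<le> (288 * (10^15 * 5^(CARD('d) - 5)) + 192) / sqrt q0"
      by (simp add: add_divide_distrib)
  qed auto
  finally have "P * norm (esum l \<xi> - esum l' \<xi>) \<le> P * ((288 * (10^15 * 5^(CARD('d) - 5)) + 192) / sqrt q0 * real N ^ (CARD('d) - 2))"
    by (simp add: mult_ac)
  then have "norm (esum l \<xi> - esum l' \<xi>) \<le> (288 * (10^15 * 5^(CARD('d) - 5)) + 192) / sqrt q0 * real N ^ (CARD('d) - 2)"
    using P(4) by (simp add: mult_left_le_imp_le)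
  moreover have "norm (esum l \<xi> - esum l' \<xi>) = \<bar>real (r l) - real (r l')\<bar>"
    unfolding \<xi>_def esum_0 r_def by (metis norm_of_real of_real_diff of_real_of_nat_eq)
  ultimately show ?thesis by (simp add: r_def)
qed

section \<open>Sums of squares to a modulus\<close>

text \<open>
  Pigeonhole: the squares \<open>x\<^sup>2\<close> and the values \<open>-1 - y\<^sup>2\<close> each occupy \<open>(p + 1)/2\<close> residue classes.
\<close>

lemma exists_two_squares_mod_prime:
  assumes "prime p" "odd (p::nat)"
  shows "\<exists>x y::int. int p dvd 1 + x\<^sup>2 + y\<^sup>2"
proof -
  define h where "h = (int p - 1) div 2"
  have p3: "p \<ge> 3" using assms by (metis prime_ge_2_nat even_numeral le_neq_implies_less numeral_2_eq_2 numeral_3_eq_3 Suc_leI)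
  have h: "int p = 2 * h + 1" "h \<ge> 1" using assms(2) p3 by (auto simp: h_def elim!: oddE)
  have pp: "prime (int p)" using assms(1) by simp
  have inj: "inj_on (\<lambda>x. x\<^sup>2 mod int p) {0..h}"
  proof (rule inj_onI)
    fix x y assume xy: "x \<in> {0..h}" "y \<in> {0..h}" "x\<^sup>2 mod int p = y\<^sup>2 mod int p"
    then have "int p dvd x\<^sup>2 - y\<^sup>2" by (simp add: mod_eq_dvd_iff)
    also have "x\<^sup>2 - y\<^sup>2 = (x - y) * (x + y)" by (simp add: power2_eq_square algebra_simps)
    finally have "int p dvd x - y \<or> int p dvd x + y" using pp by (simp add: prime_dvd_mult_iff)
    then show "x = y"
    proof
      assume "int p dvd x - y"
      show ?thesis
      proof (rule ccontr)
        assume "x \<noteq> y"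
        then have "int p \<le> \<bar>x - y\<bar>" using \<open>int p dvd x - y\<close> dvd_imp_le_int[of "x - y" "int p"] by simp
        then show False using xy h by auto
      qed
    next
      assume "int p dvd x + y"
      then have "\<not> (0 < x + y)" using xy h zdvd_not_zless[of "x + y" "int p"] by auto
      then show ?thesis using xy by auto
    qed
  qed
  have inj2: "inj_on (\<lambda>y. (- 1 - y\<^sup>2) mod int p) {0..h}"
  proof (rule inj_onI)
    fix x y assume xy: "x \<in> {0..h}" "y \<in> {0..h}" "(- 1 - x\<^sup>2) mod int p = (- 1 - y\<^sup>2) mod int p"
    then have "int p dvd (- 1 - x\<^sup>2) - (- 1 - y\<^sup>2)" by (simp add: mod_eq_dvd_iff)
    then have "int p dvd y\<^sup>2 - x\<^sup>2" by simp
    then have "y\<^sup>2 mod int p = x\<^sup>2 mod int p" by (simp add: mod_eq_dvd_iff)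
    then show "x = y" using inj xy by (metis inj_onD)
  qed
  let ?A = "(\<lambda>x. x\<^sup>2 mod int p) ` {0..h}" and ?B = "(\<lambda>y. (- 1 - y\<^sup>2) mod int p) ` {0..h}"
  have "?A \<inter> ?B \<noteq> {}"
  proof
    assume "?A \<inter> ?B = {}"
    then have "card (?A \<union> ?B) = card ?A + card ?B" by (intro card_Un_disjoint) auto
    also have "\<dots> = 2 * card {0..h}" by (simp add: card_image[OF inj] card_image[OF inj2])
    also have "\<dots> = p + 1" using h by simp
    finally have "card (?A \<union> ?B) = p + 1" .
    moreover have "card (?A \<union> ?B) \<le> card {0..<int p}"
      using p3 by (intro card_mono) auto
    ultimately show False by simp
  qed
  then obtain x y where "x\<^sup>2 mod int p = (- 1 - y\<^sup>2) mod int p" by auto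
  then have "int p dvd x\<^sup>2 - (- 1 - y\<^sup>2)" by (simp add: mod_eq_dvd_iff)
  then show ?thesis by (intro exI[of _ x] exI[of _ y]) (simp add: algebra_simps)
qed

text \<open>
  Hensel lifting, one power of \<open>p\<close> at a time.
\<close>

lemma lift_square_mod_prime_power:
  fixes p x c :: int
  assumes "prime p" "odd p" "\<not> p dvd x" "p dvd x\<^sup>2 + c"
  shows "\<exists>y. \<not> p dvd y \<and> p ^ Suc k dvd y\<^sup>2 + c"
proof (induction k)
  case 0 then show ?case using assms by auto
next
  case (Suc k)
  then obtain y where y: "\<not> p dvd y" "p ^ Suc k dvd y\<^sup>2 + c" by blast
  then obtain m where m: "y\<^sup>2 + c = p ^ Suc k * m" by (elim dvdE)
  have "\<not> p dvd 2"
  proof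
    assume "p dvd 2"
    then have "p \<le> 2" by (rule zdvd_imp_le) simp
    then show False using assms(1,2) prime_ge_2_int[of p] by auto
  qed
  then have "coprime p (2 * y)" using assms(1,2) y(1) by (auto simp: prime_dvd_mult_iff intro: prime_imp_coprime)
  then have "coprime (2 * y) p" by (simp add: coprime_commute)
  then obtain z where z: "[2 * y * z = 1] (mod p)" using cong_solve_coprime_int by blast
  define t where "t = - m * z"
  have "[m + 2 * y * t = m - m * (2 * y * z)] (mod p)" by (simp add: t_def algebra_simps)
  also have "[m - m * (2 * y * z) = m - m * 1] (mod p)" by (intro cong_diff cong_mult z) auto
  finally have "p dvd m + 2 * y * t" by (simp add: cong_0_iff)
  then have a: "p ^ Suc (Suc k) dvd p ^ Suc k * (m + 2 * y * t)" by simp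
  have b: "p ^ Suc (Suc k) dvd t\<^sup>2 * (p ^ Suc k)\<^sup>2"
    by (intro dvd_mult) (simp add: power2_eq_square power_add[symmetric] le_imp_power_dvd)
  have "(y + t * p ^ Suc k)\<^sup>2 + c = p ^ Suc k * (m + 2 * y * t) + t\<^sup>2 * (p ^ Suc k)\<^sup>2"
    using m by (simp add: power2_eq_square algebra_simps)
  then have "p ^ Suc (Suc k) dvd (y + t * p ^ Suc k)\<^sup>2 + c" using a b by (metis dvd_add)
  moreover have "\<not> p dvd y + t * p ^ Suc k" using y(1) by (simp add: dvd_add_left_iff)
  ultimately show ?case by blast
qed

lemma combine_two_squares:
  fixes m n :: int
  assumes "coprime m n" "m dvd c + x\<^sup>2 + y\<^sup>2" "n dvd c + z\<^sup>2 + w\<^sup>2"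
  shows "\<exists>a b. m * n dvd c + a\<^sup>2 + b\<^sup>2"
proof -
  obtain a where a: "[a = x] (mod m)" "[a = z] (mod n)" using binary_chinese_remainder_int[OF assms(1)] by blast
  obtain b where b: "[b = y] (mod m)" "[b = w] (mod n)" using binary_chinese_remainder_int[OF assms(1)] by blast
  have "[c + a\<^sup>2 + b\<^sup>2 = c + x\<^sup>2 + y\<^sup>2] (mod m)" "[c + a\<^sup>2 + b\<^sup>2 = c + z\<^sup>2 + w\<^sup>2] (mod n)"
    by (intro cong_add cong_pow cong_refl a b)+
  then have "m dvd c + a\<^sup>2 + b\<^sup>2" "n dvd c + a\<^sup>2 + b\<^sup>2" using assms by (auto simp: cong_dvd_iff)
  then show ?thesis using assms(1) by (auto intro: divides_mult)
qed

lemma exists_two_squares_mod_odd: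
  assumes "odd (m::nat)"
  shows "\<exists>x y::int. int m dvd 1 + x\<^sup>2 + y\<^sup>2"
  using assms
proof (induction m rule: less_induct)
  case (less m)
  show ?case
  proof (cases "m = 1")
    case False
    then obtain p where p: "prime p" "p dvd m" using prime_factor_nat by blast
    have m0: "m \<noteq> 0" using less.prems by (cases m) auto
    have oddp: "odd p" using p less.prems by (meson dvd_trans)
    define k where "k = multiplicity p m"
    obtain y where y: "m = p ^ k * y" "\<not> p dvd y" unfolding k_def using m0 p(1)
      by (metis multiplicity_decompose' not_prime_unit)
    have k0: "k \<noteq> 0"
    proof
      assume "k = 0" then show False using y p by simp
    qed
    have "y < m"
    proof -
      have "1 < p ^ k" using k0 prime_gt_1_nat[OF p(1)] by (intro one_less_power) auto
      moreover have "y > 0" using y m0 by (cases y) auto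
      ultimately show ?thesis using y by simp
    qed
    moreover have "odd y" using less.prems y by simp
    ultimately obtain z w :: int where zw: "int y dvd 1 + z\<^sup>2 + w\<^sup>2" using less.IH by blast
    obtain a b :: int where ab: "int p dvd 1 + a\<^sup>2 + b\<^sup>2" using exists_two_squares_mod_prime[OF p(1) oddp] by blast
    have pi: "prime (int p)" "odd (int p)" using p(1) oddp by auto
    obtain k' where k': "k = Suc k'" using k0 by (cases k) auto
    have "\<exists>a b::int. int (p ^ k) dvd 1 + a\<^sup>2 + b\<^sup>2"
    proof (cases "int p dvd a")
      case False
      have "int p dvd a\<^sup>2 + (1 + b\<^sup>2)" using ab by (simp add: algebra_simps)
      then obtain a' where "int p ^ Suc k' dvd a'\<^sup>2 + (1 + b\<^sup>2)"
        using lift_square_mod_prime_power[OF pi False] by blast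
      then show ?thesis by (intro exI[of _ a'] exI[of _ b]) (simp add: k' algebra_simps)
    next
      case True
      have "\<not> int p dvd b"
      proof
        assume "int p dvd b"
        then have "int p dvd a\<^sup>2 + b\<^sup>2" using True by (simp add: power2_eq_square)
        then have "int p dvd 1" using ab by (metis add.assoc dvd_add_left_iff)
        then show False using pi(1) not_prime_unit by blast
      qed
      have "int p dvd b\<^sup>2 + (1 + a\<^sup>2)" using ab by (simp add: algebra_simps)
      then obtain b' where "int p ^ Suc k' dvd b'\<^sup>2 + (1 + a\<^sup>2)"
        using lift_square_mod_prime_power[OF pi \<open>\<not> int p dvd b\<close>] by blast
      then show ?thesis by (intro exI[of _ a] exI[of _ b']) (simp add: k' algebra_simps)
    qed
    then obtain a b :: int where ab: "int (p ^ k) dvd 1 + a\<^sup>2 + b\<^sup>2" by blast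
    have "coprime p y" using p(1) y(2) by (rule prime_imp_coprime)
    then have "coprime (int (p ^ k)) (int y)" by simp
    from combine_two_squares[OF this ab zw] show ?thesis by (simp add: y(1))
  qed auto
qed

text \<open>
  \<open>-7\<close> is a 2-adic square because it is congruent to 1 modulo 8.
\<close>

lemma exists_sqrt_minus_7_mod_power_2: "\<exists>x::int. odd x \<and> 2 ^ (k + 3) dvd x\<^sup>2 + 7"
proof (induction k)
  case 0 show ?case by (intro exI[of _ 1]) simp
next
  case (Suc k)
  then obtain x :: int where x: "odd x" "2 ^ (k + 3) dvd x\<^sup>2 + 7" by blast
  then obtain m where m: "x\<^sup>2 + 7 = 2 ^ (k + 3) * m" by (elim dvdE)
  show ?case
  proof (cases "even m")
    case True
    then show ?thesis using x m by (intro exI[of _ x]) (auto elim!: evenE simp: power_add)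
  next
    case False
    have "(x + 2 ^ (k + 2))\<^sup>2 + 7 = 2 ^ (k + 3) * (m + x) + 2 ^ (k + 4) * 2 ^ k"
      using m by (simp add: power2_eq_square algebra_simps power_add)
    moreover have "even (m + x)" using False x by simp
    then obtain j where j: "m + x = 2 * j" by (elim evenE)
    have "2 ^ (k + 4) dvd 2 ^ (k + 3) * (m + x)" unfolding j by (simp add: power_add)
    ultimately have "2 ^ (Suc k + 3) dvd (x + 2 ^ (k + 2))\<^sup>2 + 7" by (simp add: add.commute)
    then show ?thesis using x(1) by (intro exI[of _ "x + 2 ^ (k + 2)"]) simp
  qed
qed

text \<open>
  A vector that is isotropic modulo \<open>M\<close> and has a coordinate equal to 1. Modulo powers of 2 the identity
  \<open>1 + 1 + 1 + 4 - 7 = 0\<close> is used, modulo the odd part two squares suffice. The even coordinate \<open>c\<close> serves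
  to adjust parities in \<open>card_local_solutions\<close>.
\<close>

lemma exists_isotropic_mod:
  assumes "M > (0::nat)"
  shows "\<exists>a b c e::int. even c \<and> int M dvd 1 + a\<^sup>2 + b\<^sup>2 + c\<^sup>2 + e\<^sup>2"
proof -
  define k where "k = multiplicity 2 M"
  obtain y where y: "M = 2 ^ k * y" "odd y" unfolding k_def using assms
    by (metis multiplicity_decompose' not_prime_unit two_is_prime_nat gr_implies_not0)
  obtain a b :: int where ab: "int y dvd 1 + a\<^sup>2 + b\<^sup>2" using exists_two_squares_mod_odd[OF y(2)] by blast
  obtain x :: int where x: "2 ^ (k + 3) dvd x\<^sup>2 + 7" using exists_sqrt_minus_7_mod_power_2 by blast
  have "coprime (2 ^ (k + 3)) (int y)" using y(2) by simp
  note crt = binary_chinese_remainder_int[OF this]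
  obtain a' where a': "[a' = 1] (mod 2 ^ (k + 3))" "[a' = a] (mod int y)" using crt by blast
  obtain b' where b': "[b' = 1] (mod 2 ^ (k + 3))" "[b' = b] (mod int y)" using crt by blast
  obtain c' where c': "[c' = 2] (mod 2 ^ (k + 3))" "[c' = 0] (mod int y)" using crt by blast
  obtain e' where e': "[e' = x] (mod 2 ^ (k + 3))" "[e' = 0] (mod int y)" using crt by blast
  have "[1 + a'\<^sup>2 + b'\<^sup>2 + c'\<^sup>2 + e'\<^sup>2 = 1 + 1\<^sup>2 + 1\<^sup>2 + 2\<^sup>2 + x\<^sup>2] (mod 2 ^ (k + 3))"
    by (intro cong_add cong_pow cong_refl a' b' c' e')
  moreover have "1 + 1\<^sup>2 + 1\<^sup>2 + 2\<^sup>2 + x\<^sup>2 = x\<^sup>2 + 7" by simp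
  ultimately have 1: "2 ^ (k + 3) dvd 1 + a'\<^sup>2 + b'\<^sup>2 + c'\<^sup>2 + e'\<^sup>2" using x by (simp only: cong_dvd_iff)
  have "[1 + a'\<^sup>2 + b'\<^sup>2 + c'\<^sup>2 + e'\<^sup>2 = 1 + a\<^sup>2 + b\<^sup>2 + 0\<^sup>2 + 0\<^sup>2] (mod int y)"
    by (intro cong_add cong_pow cong_refl a' b' c' e')
  then have 2: "int y dvd 1 + a'\<^sup>2 + b'\<^sup>2 + c'\<^sup>2 + e'\<^sup>2" using ab by (simp add: cong_dvd_iff)
  have "2 ^ (k + 3) * int y dvd 1 + a'\<^sup>2 + b'\<^sup>2 + c'\<^sup>2 + e'\<^sup>2"
    using 1 2 \<open>coprime (2 ^ (k + 3)) (int y)\<close> by (rule divides_mult)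
  moreover have "int M dvd 2 ^ (k + 3) * int y" by (simp add: y(1) power_add)
  ultimately have "int M dvd 1 + a'\<^sup>2 + b'\<^sup>2 + c'\<^sup>2 + e'\<^sup>2" by (rule dvd_trans[rotated])
  moreover have "even c'"
  proof -
    have "(2::int) dvd 2 ^ (k + 3)" by simp
    then have "[c' = 2] (mod 2)" using c'(1) by (rule cong_dvd_modulus[rotated])
    then show ?thesis by (simp add: cong_def even_iff_mod_2_eq_zero)
  qed
  ultimately show ?thesis by blast
qed

text \<open>
  The product is about \<open>1 - 1/(3k)\<close>, so its cube can be compared with the telescoping factor
  \<open>1 - 1/k\<close>.
\<close>

lemma cube_mod6_step:
  assumes "k \<ge> (2::nat)"
  shows "(real k - 1) / k \<le> ((1 - 1 / (6 * real k - 1)) * (1 - 1 / (6 * real k + 1))) ^ 3"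
proof -
  define x where "x = real k"
  have x: "x \<ge> 2" using assms by (simp add: x_def)
  have "1 - 1 / (3 * x) \<le> (1 - 1 / (6 * x - 1)) * (1 - 1 / (6 * x + 1))"
  proof -
    have "(1 - 1 / (6 * x - 1)) * (1 - 1 / (6 * x + 1)) = (36 * x\<^sup>2 - 12 * x) / (36 * x\<^sup>2 - 1)"
      using x by (simp add: field_simps power2_eq_square)
    moreover have "1 - 1 / (3 * x) = (36 * x\<^sup>2 - 12 * x) / (36 * x\<^sup>2)" using x by (simp add: field_simps power2_eq_square)
    moreover have "4 \<le> x\<^sup>2" using power_mono[OF x, of 2] by simp
    moreover have "36 * x\<^sup>2 - 12 * x \<ge> 0" using x by (simp add: power2_eq_square)
    ultimately show ?thesis by (simp only:) (intro divide_left_mono mult_pos_pos, linarith+)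
  qed
  moreover have "0 \<le> 1 - 1 / (3 * x)" using x by (simp add: field_simps)
  ultimately have "(1 - 1 / (3 * x)) ^ 3 \<le> ((1 - 1 / (6 * x - 1)) * (1 - 1 / (6 * x + 1))) ^ 3"
    by (rule power_mono)
  moreover have "(x - 1) / x \<le> (1 - 1 / (3 * x)) ^ 3"
  proof -
    have "1 + real 3 * (- 1 / (3 * x)) \<le> (1 + (- 1 / (3 * x))) ^ 3" by (rule Bernoulli_inequality) (use x in \<open>simp add: field_simps\<close>)
    then show ?thesis using x by (simp add: field_simps)
  qed
  ultimately show ?thesis by (simp add: x_def)
qed

lemma prod_mod6_cubed_ge:
  assumes "n \<ge> 1"
  shows "(\<Prod>k\<in>{1..n}. (1 - 1 / (6 * real k - 1)) * (1 - 1 / (6 * real k + 1))) ^ 3 \<ge> 1 / (4 * real n)"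
  using assms
proof (induction n rule: nat_induct_at_least)
  case base show ?case by (simp add: field_simps eval_nat_numeral)
next
  case (Suc n)
  have "1 / (4 * real (Suc n)) = (1 / (4 * real n)) * ((real (Suc n) - 1) / Suc n)" using Suc.hyps by simp
  also have "\<dots> \<le> (\<Prod>k\<in>{1..n}. (1 - 1 / (6 * real k - 1)) * (1 - 1 / (6 * real k + 1))) ^ 3 *
     ((1 - 1 / (6 * real (Suc n) - 1)) * (1 - 1 / (6 * real (Suc n) + 1))) ^ 3"
  proof (intro mult_mono Suc.IH cube_mod6_step)
    show "0 \<le> (\<Prod>k\<in>{1..n}. (1 - 1 / (6 * real k - 1)) * (1 - 1 / (6 * real k + 1))) ^ 3"
      by (intro zero_le_power prod_nonneg mult_nonneg_nonneg ballI) (auto simp: field_simps)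
  qed (use Suc in auto)
  also have "\<dots> = (\<Prod>k\<in>{1..Suc n}. (1 - 1 / (6 * real k - 1)) * (1 - 1 / (6 * real k + 1))) ^ 3"
    by (simp add: power_mult_distrib[symmetric])
  finally show ?case .
qed

lemma prime_mod6:
  assumes "prime (p::nat)" "p \<ge> 5"
  shows "\<exists>k\<ge>1. k \<le> p \<and> (p = 6 * k - 1 \<or> p = 6 * k + 1)"
proof -
  have 2: "\<not> 2 dvd p" using primes_dvd_imp_eq[OF two_is_prime_nat assms(1)] assms(2) by auto
  have "prime (3::nat)" by simp
  then have 3: "\<not> 3 dvd p" using primes_dvd_imp_eq[of 3 p] assms by auto
  have "p mod 6 = 1 \<or> p mod 6 = 5" using 2 3 by presburger
  then show ?thesis
  proof
    assume "p mod 6 = 1"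
    then have "p = 6 * (p div 6) + 1" by presburger
    then show ?thesis using assms(2) by (intro exI[of _ "p div 6"]) auto
  next
    assume "p mod 6 = 5"
    then have "p = 6 * (p div 6 + 1) - 1" by presburger
    then show ?thesis using assms(2) by (intro exI[of _ "p div 6 + 1"]) auto
  qed
qed

section \<open>Counting solutions to a modulus\<close>

lemma card_vec_box:
  assumes "\<And>i. finite (B i)"
  shows "card {v::int^'d::finite. \<forall>i. v $ i \<in> B i} = (\<Prod>i\<in>UNIV. card (B i))"
  using prod_sum_vec[of B "\<lambda>_ _. 1::nat"] assms by simp

lemma finite_vec_box:
  assumes "\<And>i. finite (B i)"
  shows "finite {v::int^'d::finite. \<forall>i. v $ i \<in> B i}"
proof -
  have "{v::int^'d. \<forall>i. v $ i \<in> B i} \<subseteq> vec_lambda ` (PiE UNIV B)"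
  proof
    fix v :: "int ^ 'd" assume "v \<in> {v. \<forall>i. v $ i \<in> B i}"
    then have "vec_nth v \<in> PiE UNIV B" by auto
    then show "v \<in> vec_lambda ` (PiE UNIV B)" by (intro image_eqI[of _ _ "vec_nth v"]) auto
  qed
  then show ?thesis by (rule finite_subset) (use assms in \<open>auto intro!: finite_PiE\<close>)
qed

lemma nsq_add_smult:
  fixes w u :: "int ^ 'd::finite"
  shows "nsq (\<chi> i. w $ i + t * u $ i) = nsq w + 2 * t * (\<Sum>i\<in>UNIV. u $ i * w $ i) + t\<^sup>2 * nsq u"
  by (simp add: nsq_def power2_sum sum.distrib sum_distrib_left algebra_simps power2_eq_square)

lemma nsq_dvd_diff:
  fixes v w :: "int ^ 'd::finite"
  assumes "\<And>i. m dvd v $ i - w $ i"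
  shows "m dvd nsq v - nsq w"
proof -
  have "m dvd (v $ i)\<^sup>2 - (w $ i)\<^sup>2" for i
    using assms[of i] by (metis dvd_mult2 mult.commute power2_eq_square square_diff_square_factored)
  then show ?thesis unfolding nsq_def sum_subtractf[symmetric] by (intro dvd_sum) auto
qed

text \<open>
  The bound is within a factor 2 of \<open>\<phi>(M) / M\<close> times the expected number \<open>M^(d-1)\<close>. Let \<open>u\<close> be isotropic
  modulo \<open>M\<close>. Along a line \<open>w + t u\<close> the form is
  linear in \<open>t\<close>: \<open>nsq (w + t u) = nsq w + 2 t (u \<bullet> w)\<close> modulo \<open>M\<close>. If \<open>u \<bullet> w\<close> is a unit and \<open>nsq w\<close> has the
  parity of \<open>l\<close>, some \<open>t\<close> gives the value \<open>l\<close>. Each solution arises from at most \<open>M\<close> vectors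
  \<open>w\<close>, so it remains to count the admissible \<open>w\<close>. Prescribing the unit \<open>u \<bullet> w\<close>, half of the coordinate
  \<open>i4\<close> and all coordinates other than \<open>i1\<close> and \<open>i4\<close> leaves one bit of freedom, which corrects the parity
  because \<open>u\<close> is even at \<open>i4\<close>.
\<close>

lemma card_local_solutions:
  fixes M :: nat and l :: int
  assumes "even M" "M \<ge> 2" "CARD('d::finite) \<ge> 5"
  defines "R \<equiv> {v::int^'d. (\<forall>i. v $ i \<in> {0..<int M}) \<and> int M dvd nsq v - l}"
  shows "totient M * M ^ (CARD('d) - 2) \<le> 2 * card R"
proof -
  obtain h where h: "bij_betw h {0..<CARD('d)} (UNIV :: 'd set)" using ex_bij_betw_nat_finite[of "UNIV :: 'd set"] by auto
  define i1 i2 i3 i4 i5 where "i1 = h 0" and "i2 = h 1" and "i3 = h 2" and "i4 = h 3" and "i5 = h 4"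
  have hinj: "h x = h y \<longleftrightarrow> x = y" if "x < 5" "y < 5" for x y
    using h that assms(3) by (auto simp: bij_betw_def inj_on_def)
  have dist: "distinct [i1, i2, i3, i4, i5]" by (simp add: i1_def i2_def i3_def i4_def i5_def hinj)
  obtain a b c e :: int where iso: "even c" "int M dvd 1 + a\<^sup>2 + b\<^sup>2 + c\<^sup>2 + e\<^sup>2"
    using exists_isotropic_mod[of M] assms(2) by auto
  define u :: "int ^ 'd" where "u = (\<chi> i. if i = i1 then 1 else if i = i2 then a else if i = i3 then b
     else if i = i4 then c else if i = i5 then e else 0)"
  have u: "u $ i1 = 1" "u $ i2 = a" "u $ i3 = b" "u $ i4 = c" "u $ i5 = e" using dist by (auto simp: u_def)
  have "nsq u = (\<Sum>i\<in>{i1,i2,i3,i4,i5}. (u $ i)\<^sup>2)"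
    unfolding nsq_def by (rule sum.mono_neutral_right) (auto simp: u_def)
  also have "\<dots> = 1 + a\<^sup>2 + b\<^sup>2 + c\<^sup>2 + e\<^sup>2" using dist u by simp
  finally have nsq_u: "int M dvd nsq u" using iso(2) by simp
  define L where "L = (\<lambda>w::int^'d. \<Sum>i\<in>UNIV. u $ i * w $ i)"
  define m where "m = M div 2"
  have M: "M = 2 * m" "m \<ge> 1" using assms(1,2) by (auto simp: m_def)
  define I where "I = UNIV - {i1, i4}"
  have i14: "i1 \<noteq> i4" using dist by auto
  have split: "(\<Sum>i\<in>UNIV. f i) = f i1 + f i4 + (\<Sum>i\<in>I. f i)" for f :: "'d \<Rightarrow> int"
  proof -
    have e: "insert i1 (insert i4 I) = UNIV" by (auto simp: I_def)
    have "sum f (insert i1 (insert i4 I)) = f i1 + f i4 + (\<Sum>i\<in>I. f i)" using i14 by (simp add: I_def)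
    then show ?thesis unfolding e .
  qed
  define W where "W = {w::int^'d. (\<forall>i. w $ i \<in> {0..<int M}) \<and> coprime (L w) (int M) \<and> even (nsq w - l)}"
  define B where "B = (\<lambda>i. if i = i1 then int ` totatives M else if i = i4 then {0..<int m} else {0..<int M})"
  define X where "X = {x::int^'d. \<forall>i. x $ i \<in> B i}"
  define \<rho> where "\<rho> = (\<lambda>w::int^'d. \<chi> i. if i = i1 then L w mod int M else if i = i4 then w $ i div 2 else w $ i)"
  have finbox: "finite {w::int^'d. \<forall>i. w $ i \<in> {0..<int M}}" by (rule finite_vec_box) auto
  have finW: "finite W" by (rule finite_subset[OF _ finbox]) (auto simp: W_def)
  have finR: "finite R" by (rule finite_subset[OF _ finbox]) (auto simp: R_def)
  have "X \<subseteq> \<rho> ` W"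
  proof
    fix x assume x: "x \<in> X"
    have xB: "x $ i \<in> B i" for i using x by (simp add: X_def)
    have x1: "0 \<le> x $ i1" "x $ i1 < int M" "coprime (x $ i1) (int M)"
      using xB[of i1] totatives_less[of _ M] assms(2) by (auto simp: B_def totatives_def)
    have x4: "0 \<le> x $ i4" "x $ i4 < int m" using xB[of i4] i14 by (auto simp: B_def)
    have xo: "0 \<le> x $ i" "x $ i < int M" if "i \<in> I" for i using xB[of i] that by (auto simp: B_def I_def)
    define s where "s = (\<Sum>i\<in>I. u $ i * x $ i)"
    define s2 where "s2 = (\<Sum>i\<in>I. (x $ i)\<^sup>2)"
    \<comment> \<open>The bit \<open>\<epsilon>\<close> is added to coordinate \<open>i4\<close>, and \<open>z \<epsilon>\<close> is the value at \<open>i1\<close> that keeps \<open>u \<bullet> w\<close>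
      unchanged. Since \<open>c\<close> and \<open>M\<close> are even, the parity of \<open>z \<epsilon>\<close> does not depend on \<open>\<epsilon>\<close>, so that exactly the
      parity of coordinate \<open>i4\<close> changes.\<close>
    define z where "z = (\<lambda>\<epsilon>::int. (x $ i1 - c * (2 * x $ i4 + \<epsilon>) - s) mod int M)"
    define w where "w = (\<lambda>\<epsilon>::int. (\<chi> i. if i = i1 then z \<epsilon> else if i = i4 then 2 * x $ i4 + \<epsilon> else x $ i) :: int ^ 'd)"
    have w: "w \<epsilon> $ i1 = z \<epsilon>" "w \<epsilon> $ i4 = 2 * x $ i4 + \<epsilon>" "\<And>i. i \<in> I \<Longrightarrow> w \<epsilon> $ i = x $ i" for \<epsilon>
      using i14 by (auto simp: w_def I_def)
    have Lw: "L (w \<epsilon>) mod int M = x $ i1" for \<epsilon>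
    proof -
      have "(\<Sum>i\<in>I. u $ i * w \<epsilon> $ i) = s" unfolding s_def by (intro sum.cong refl) (simp add: w)
      then have "L (w \<epsilon>) = z \<epsilon> + (c * (2 * x $ i4 + \<epsilon>) + s)"
        unfolding L_def split by (simp add: u w)
      then have "L (w \<epsilon>) mod int M = ((x $ i1 - c * (2 * x $ i4 + \<epsilon>) - s) + (c * (2 * x $ i4 + \<epsilon>) + s)) mod int M"
        by (simp only: z_def mod_add_left_eq)
      then show ?thesis using x1 by simp
    qed
    have nsq_w: "nsq (w \<epsilon>) = (z \<epsilon>)\<^sup>2 + (2 * x $ i4 + \<epsilon>)\<^sup>2 + s2" for \<epsilon>
    proof -
      have "(\<Sum>i\<in>I. (w \<epsilon> $ i)\<^sup>2) = s2" unfolding s2_def by (intro sum.cong refl) (simp add: w)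
      then show ?thesis unfolding nsq_def split by (simp add: w)
    qed
    have evz: "even (z \<epsilon>) \<longleftrightarrow> even (x $ i1 - s)" for \<epsilon>
    proof -
      have "even (z \<epsilon>) \<longleftrightarrow> even (x $ i1 - c * (2 * x $ i4 + \<epsilon>) - s)"
        unfolding z_def by (rule dvd_mod_iff) (use assms(1) in simp)
      then show ?thesis using iso(1) by simp
    qed
    have "even (nsq (w 0) - l) \<or> even (nsq (w 1) - l)"
      unfolding nsq_w using evz[of 0] evz[of 1] by auto
    then obtain \<epsilon> where \<epsilon>: "\<epsilon> \<in> {0, 1}" "even (nsq (w \<epsilon>) - l)" by blast
    have "w \<epsilon> $ i \<in> {0..<int M}" for i
    proof -
      have z: "0 \<le> z \<epsilon>" "z \<epsilon> < int M" using assms(2) by (auto simp: z_def)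
      have "0 \<le> 2 * x $ i4 + \<epsilon>" "2 * x $ i4 + \<epsilon> < int M" using x4 \<epsilon>(1) M by auto
      note x4' = this
      consider "i = i1" | "i = i4" | "i \<in> I" by (auto simp: I_def)
      then show ?thesis
      proof cases
        case 1 then show ?thesis using z by (simp add: w)
      next
        case 2 then show ?thesis using x4' by (simp add: w)
      next
        case 3 then show ?thesis using xo[of i] by (simp add: w)
      qed
    qed
    moreover have "coprime (L (w \<epsilon>)) (int M)"
    proof -
      have "coprime (L (w \<epsilon>) mod int M) (int M)" using x1(3) by (simp add: Lw)
      then show ?thesis using assms(2) by simp
    qed
    ultimately have "w \<epsilon> \<in> W" using \<epsilon>(2) by (simp add: W_def)
    moreover have "\<rho> (w \<epsilon>) = x"
    proof -
      have "\<rho> (w \<epsilon>) $ i = x $ i" for i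
      proof -
        consider "i = i1" | "i = i4" | "i \<in> I" by (auto simp: I_def)
        then show ?thesis
        proof cases
          case 1 then show ?thesis by (simp add: \<rho>_def Lw)
        next
          case 2 then show ?thesis using i14 \<epsilon>(1) by (auto simp: \<rho>_def w)
        next
          case 3
          then have "i \<noteq> i1" "i \<noteq> i4" by (auto simp: I_def)
          then show ?thesis using w(3)[OF 3] by (simp add: \<rho>_def)
        qed
      qed
      then show ?thesis by (simp add: vec_eq_iff)
    qed
    ultimately show "x \<in> \<rho> ` W" by blast
  qed
  then have "card X \<le> card W" using finW by (meson card_image_le card_mono finite_imageI order_trans)
  moreover have "card X = totient M * (m * M ^ (CARD('d) - 2))"
  proof -
    have finB: "finite (B i)" for i by (simp add: B_def)
    have "card X = (\<Prod>i\<in>UNIV. card (B i))" unfolding X_def by (rule card_vec_box) (rule finB)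
    also have "UNIV = insert i1 (insert i4 I)" by (auto simp: I_def)
    also have "(\<Prod>i\<in>insert i1 (insert i4 I). card (B i)) = card (B i1) * (card (B i4) * (\<Prod>i\<in>I. card (B i)))"
      using i14 by (simp add: I_def)
    also have "(\<Prod>i\<in>I. card (B i)) = (\<Prod>i\<in>I. M)" by (intro prod.cong) (auto simp: B_def I_def)
    also have "\<dots> = M ^ (CARD('d) - 2)"
    proof -
      have "card I = CARD('d) - 2" unfolding I_def using i14 by (subst card_Diff_subset) auto
      then show ?thesis by simp
    qed
    also have "card (B i1) = totient M" by (simp add: B_def card_image totient_def)
    also have "card (B i4) = m" using i14 by (simp add: B_def)
    finally show ?thesis .
  qed
  moreover have "card W \<le> card R * M"
  proof -
    define \<sigma> where "\<sigma> = (\<lambda>(v::int^'d, t). (\<chi> i. (v $ i - t * u $ i) mod int M) :: int ^ 'd)"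
    have "W \<subseteq> \<sigma> ` (R \<times> {0..<int M})"
    proof
      fix w assume w: "w \<in> W"
      then have "coprime (L w) (int M)" by (simp add: W_def)
      then obtain z where z: "[L w * z = 1] (mod int M)" using cong_solve_coprime_int by blast
      have "even (nsq w - l)" using w unfolding W_def by blast
      then obtain s where s: "nsq w - l = 2 * s" by (elim evenE)
      define t where "t = (- s * z) mod int M"
      have t: "t \<in> {0..<int M}" using assms(2) by (simp add: t_def)
      have "[t * L w = (- s * z) * L w] (mod int M)" unfolding t_def by (intro cong_mult) (auto simp: cong_def)
      also have "(- s * z) * L w = - s * (L w * z)" by simp
      also have "[- s * (L w * z) = - s * 1] (mod int M)" by (intro cong_mult z) simp
      finally have tL: "int M dvd t * L w + s" by (simp add: cong_iff_dvd_diff)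
      define v :: "int ^ 'd" where "v = (\<chi> i. (w $ i + t * u $ i) mod int M)"
      have "int M dvd nsq (\<chi> i. w $ i + t * u $ i) - l"
      proof -
        have "nsq (\<chi> i. w $ i + t * u $ i) - l = 2 * (t * L w + s) + t\<^sup>2 * nsq u"
          using s unfolding nsq_add_smult L_def by (simp add: algebra_simps)
        then show ?thesis using dvd_add[OF dvd_mult[OF tL, of 2] dvd_mult[OF nsq_u, of "t\<^sup>2"]] by (simp only:)
      qed
      moreover have "int M dvd nsq v - nsq (\<chi> i. w $ i + t * u $ i)"
        by (rule nsq_dvd_diff) (simp add: v_def mod_eq_dvd_iff[symmetric])
      ultimately have "int M dvd nsq v - l" by (metis diff_add_cancel add_diff_eq dvd_add)
      then have "v \<in> R" using assms(2) by (simp add: R_def v_def)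
      moreover have "\<sigma> (v, t) = w"
        using w by (simp add: \<sigma>_def v_def vec_eq_iff W_def mod_diff_left_eq)
      ultimately show "w \<in> \<sigma> ` (R \<times> {0..<int M})" using t by (intro image_eqI[of _ _ "(v, t)"]) auto
    qed
    then have "card W \<le> card (R \<times> {0..<int M})"
      using finR by (meson card_image_le card_mono finite_SigmaI finite_imageI finite_atLeastLessThan_int order_trans)
    then show ?thesis by (simp add: card_cartesian_product)
  qed
  ultimately have "totient M * (m * M ^ (CARD('d) - 2)) \<le> card R * M" by simp
  then have "(totient M * M ^ (CARD('d) - 2)) * m \<le> (2 * card R) * m" by (simp add: M(1) mult_ac)
  then show ?thesis using M(2) by simp
qed

section \<open>Totients of factorials and points in thin shells\<close>

text \<open>
  \<open>\<phi>(M) / M\<close> is the product of \<open>1 - 1/p\<close> over the primes up to \<open>q\<close>. All these primes are 2, 3 or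
  congruent to \<open>\<plusminus>1\<close> modulo 6, and the product over all such numbers up to \<open>6 q + 1\<close> is still of order
  at least \<open>q^(-1/3)\<close>. This elementary substitute for Mertens' theorem suffices, since the exponent only has to
  be smaller than \<open>1/2\<close>.
\<close>

lemma totient_two_fact_cubed_ge:
  assumes "q \<ge> 2"
  shows "(real (totient (2 * fact q)) / (2 * fact q)) ^ 3 \<ge> 1 / (108 * real q)"
proof -
  define M :: nat where "M = 2 * fact q"
  have M0: "M > 0" by (simp add: M_def)
  \<comment> \<open>\<open>S\<close> is a superset of the prime factors of \<open>M\<close>; its elements need not be prime.\<close>
  define A1 A2 where "A1 = (\<lambda>k. 6 * k - 1) ` {1..q}" and "A2 = (\<lambda>k. 6 * k + 1) ` {1..q}"
  define S where "S = insert 2 (insert 3 (A1 \<union> A2))"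
  define g where "g = (\<lambda>p::nat. 1 - 1 / real p)"
  have finS: "finite S" by (simp add: S_def A1_def A2_def)
  have S0: "x \<ge> 2" if "x \<in> S" for x using that by (auto simp: S_def A1_def A2_def)
  have g: "0 \<le> g p" "g p \<le> 1" if "p \<in> S" for p using S0[OF that] by (auto simp: g_def)
  have sub: "prime_factors M \<subseteq> S"
  proof
    fix p assume "p \<in> prime_factors M"
    then have p: "prime p" "p dvd 2 * fact q" by (auto simp: M_def in_prime_factors_iff)
    then have "p dvd 2 \<or> p dvd fact q" by (simp add: prime_dvd_mult_iff)
    then have pq: "p \<le> q" using p(1) assms by (auto simp: prime_dvd_fact_iff dest: dvd_imp_le)
    have p2: "p \<ge> 2" using p(1) by (rule prime_ge_2_nat)
    show "p \<in> S"
    proof (cases "p \<ge> 5")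
      case True
      then obtain k where "k \<ge> 1" "k \<le> p" "p = 6 * k - 1 \<or> p = 6 * k + 1" using prime_mod6[OF p(1)] by blast
      then have "k \<in> {1..q}" "p = 6 * k - 1 \<or> p = 6 * k + 1" using pq by auto
      then show ?thesis unfolding S_def A1_def A2_def by blast
    next
      case False
      then have "p = 2 \<or> p = 3 \<or> p = 4" using p2 by linarith
      moreover have "p \<noteq> 4"
      proof
        assume "p = 4"
        then have "2 dvd p" by simp
        then show False using primes_dvd_imp_eq[OF two_is_prime_nat p(1)] \<open>p = 4\<close> by simp
      qed
      ultimately show ?thesis by (auto simp: S_def)
    qed
  qed
  have prodS: "prod g S = 1/3 * (\<Prod>k\<in>{1..q}. (1 - 1 / (6 * real k - 1)) * (1 - 1 / (6 * real k + 1)))"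
  proof -
    have "6 * k - 1 \<noteq> 6 * k' + 1" if "k \<ge> 1" for k k' :: nat using that by presburger
    then have disj: "A1 \<inter> A2 = {}" by (auto simp: A1_def A2_def)
    have n1: "2 \<notin> A1" "3 \<notin> A1" "2 \<notin> A2" "3 \<notin> A2" unfolding A1_def A2_def by auto
    have "prod g S = g 2 * (g 3 * prod g (A1 \<union> A2))"
      using n1 unfolding S_def by (simp add: A1_def A2_def)
    also have "prod g (A1 \<union> A2) = prod g A1 * prod g A2"
      by (rule prod.union_disjoint) (use disj in \<open>auto simp: A1_def A2_def\<close>)
    also have "prod g A1 = (\<Prod>k\<in>{1..q}. g (6 * k - 1))"
      unfolding A1_def by (subst prod.reindex) (auto simp: inj_on_def)
    also have "\<dots> = (\<Prod>k\<in>{1..q}. 1 - 1 / (6 * real k - 1))"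
      by (intro prod.cong refl) (auto simp: g_def of_nat_diff)
    also have "prod g A2 = (\<Prod>k\<in>{1..q}. g (6 * k + 1))"
      unfolding A2_def by (subst prod.reindex) (auto simp: inj_on_def)
    also have "\<dots> = (\<Prod>k\<in>{1..q}. 1 - 1 / (6 * real k + 1))"
      by (intro prod.cong refl) (auto simp: g_def add.commute)
    finally show ?thesis by (simp add: prod.distrib g_def)
  qed
  have "prod g S = prod g (S - prime_factors M) * prod g (prime_factors M)"
    by (rule prod.subset_diff[OF sub finS])
  also have "\<dots> \<le> 1 * prod g (prime_factors M)"
    using sub g by (intro mult_right_mono prod_le_1 prod_nonneg) auto
  also have "\<dots> = real (totient M) / M"
    using M0 by (simp add: totient_formula2 g_def)
  finally have le: "prod g S \<le> real (totient M) / M" .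
  have "1 / (108 * real q) = (1/3)^3 * (1 / (4 * real q))" by (simp add: eval_nat_numeral)
  also have "\<dots> \<le> (1/3)^3 * (\<Prod>k\<in>{1..q}. (1 - 1 / (6 * real k - 1)) * (1 - 1 / (6 * real k + 1))) ^ 3"
    using prod_mod6_cubed_ge[of q] assms by (intro mult_left_mono) auto
  also have "\<dots> = (prod g S) ^ 3" unfolding prodS by (simp only: power_mult_distrib)
  also have "\<dots> \<le> (real (totient M) / M) ^ 3" using le g by (intro power_mono prod_nonneg) auto
  finally show ?thesis by (simp add: M_def)
qed

lemma exists_totient_density_large:
  assumes "C > 0"
  shows "\<exists>q::nat. q \<ge> 2 \<and> C / sqrt (real q) \<le> real (totient (2 * fact q)) / (2 * fact q)"
proof -
  obtain n :: nat where n: "n \<ge> 1" "108 * C ^ 3 / sqrt (real n) \<le> 1"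
    using exists_large_sqrt[of 1 "108 * C ^ 3"] by auto
  define q where "q = Suc n"
  have q: "q \<ge> 2" using n by (simp add: q_def)
  define x where "x = sqrt (real q)"
  have x: "x > 0" "x\<^sup>2 = real q" using q by (auto simp: x_def)
  have "108 * C ^ 3 \<le> sqrt (real n)" using n by (simp add: divide_le_eq)
  also have "\<dots> \<le> x" by (simp add: q_def x_def)
  finally have Cx: "108 * C ^ 3 \<le> x" .
  have "(C / x) ^ 3 = 108 * C ^ 3 / (108 * x ^ 3)" by (simp add: power_divide)
  also have "\<dots> \<le> x / (108 * x ^ 3)" using Cx x by (intro divide_right_mono) auto
  also have "\<dots> = 1 / (108 * real q)" using x by (simp add: power3_eq_cube power2_eq_square flip: x(2))
  also have "\<dots> \<le> (real (totient (2 * fact q)) / (2 * fact q)) ^ 3" by (rule totient_two_fact_cubed_ge[OF q])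
  finally have "(C / x) ^ 3 \<le> (real (totient (2 * fact q)) / (2 * fact q)) ^ 3" .
  moreover have "0 \<le> C / x" "0 \<le> real (totient (2 * fact q)) / (2 * fact q)" using assms x(1) by auto
  ultimately have "C / x \<le> real (totient (2 * fact q)) / (2 * fact q)" by (subst (asm) power_mono_iff) auto
  then show ?thesis using q by (auto simp: x_def)
qed

text \<open>
  Given a solution \<open>r\<close> modulo \<open>M\<close>, all coordinates but one may be chosen freely among the integers of the
  right residue class up to about \<open>N / (2 d)\<close>. The last coordinate then ranges over the right residue
  class in an interval of length of order \<open>\<eta> N\<close> just above the point where the value \<open>l - \<eta> l\<close> is
  reached.
\<close>

lemma card_shell_ge:
  fixes N M l :: nat and \<eta> :: real
  assumes d: "CARD('d::finite) \<ge> 5" and M: "even M" "M \<ge> 2" and \<eta>: "0 < \<eta>" "\<eta> \<le> 1/2"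
    and N: "N\<^sup>2 \<le> l" "4 * CARD('d) * M \<le> N" "8 * M \<le> \<eta> * N"
  defines "S \<equiv> {v::int^'d. l - \<eta> * l < of_int (nsq v) \<and> nsq v \<le> int l \<and> int M dvd nsq v - int l}"
  shows "finite S" "real (totient M) / (real M)\<^sup>2 * \<eta> * real N ^ CARD('d) / (16 * (4 * real CARD('d)) ^ (CARD('d) - 1)) \<le> real (card S)"
proof -
  define D where "D = CARD('d)"
  have D: "D \<ge> 5" using d by (simp add: D_def)
  have M0: "real M > 0" using M by simp
  have Nl: "(real N)\<^sup>2 \<le> real l" using N(1) by (metis of_nat_le_iff of_nat_power)
  have N0: "real N > 0" using N(2) M D by (cases N) (auto simp: D_def)
  have Nsl: "real N \<le> sqrt l" using Nl by (rule real_le_rsqrt)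
  define i1 where "i1 = (SOME i::'d. True)"
  define I where "I = UNIV - {i1}"
  have cardI: "card I = D - 1" by (simp add: I_def D_def)
  have split: "(\<Sum>i\<in>UNIV. f i) = f i1 + (\<Sum>i\<in>I. f i)" for f :: "'d \<Rightarrow> int"
    unfolding I_def by (rule sum.remove) auto
  define rest where "rest = (\<lambda>v::int^'d. \<Sum>i\<in>I. (v $ i)\<^sup>2)"
  have nsq_split: "nsq v = (v $ i1)\<^sup>2 + rest v" for v unfolding nsq_def rest_def by (rule split)
  \<comment> \<open>\<open>base\<close> is the least admissible value of coordinate \<open>i1\<close>, given the sum of squares of the others.\<close>
  define base where "base = (\<lambda>r::int. \<lfloor>sqrt (l - \<eta> * l - of_int r)\<rfloor> + 1)"
  define Y where "Y = N div (2 * D * M)"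
  define Z where "Z = nat \<lfloor>\<eta> * N / (4 * M)\<rfloor>"
  have Yle: "Y * (2 * D * M) \<le> N" by (simp add: Y_def)
  have Yge: "real Y \<ge> N / (4 * D * M)"
  proof -
    have "N < (Y + 1) * (2 * D * M)" unfolding Y_def using D M by (metis Suc_eq_plus1 dividend_less_times_div mult.commute mult_pos_pos mult_Suc add.commute zero_less_numeral less_le_trans pos2)
    then have "real N < (real Y + 1) * (2 * D * M)" by (metis of_nat_1 of_nat_add of_nat_less_iff of_nat_mult)
    moreover have "real (4 * D * M) \<le> real N" using N(2) by (simp only: of_nat_le_iff D_def)
    ultimately show ?thesis using D M0 by (simp add: field_simps)
  qed
  have Z: "real Z \<le> \<eta> * N / (4 * M)" "real Z \<ge> \<eta> * N / (8 * M)"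
  proof -
    have nn: "0 \<le> \<eta> * N / (4 * M)" using \<eta> by simp
    then have Zf: "real Z = of_int \<lfloor>\<eta> * N / (4 * M)\<rfloor>" by (simp add: Z_def)
    show "real Z \<le> \<eta> * N / (4 * M)" unfolding Zf by (rule of_int_floor_le)
    have "1 \<le> \<eta> * N / (8 * M)" using N(3) M0 by (simp add: field_simps)
    moreover have "\<eta> * N / (4 * M) = \<eta> * N / (8 * M) + \<eta> * N / (8 * M)" by simp
    ultimately show "real Z \<ge> \<eta> * N / (8 * M)" unfolding Zf by linarith
  qed
  define R where "R = {v::int^'d. (\<forall>i. v $ i \<in> {0..<int M}) \<and> int M dvd nsq v - int l}"
  define B where "B = (\<lambda>i. if i = i1 then {0..<int Z} else {0..<int Y})"
  define X where "X = {x::int^'d. \<forall>i. x $ i \<in> B i}"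
  define f where "f = (\<lambda>v::int^'d. ((\<chi> i. v $ i mod int M) :: int^'d,
     (\<chi> i. if i = i1 then (v $ i1 - base (rest v)) div int M else v $ i div int M) :: int^'d))"
  show finS: "finite S"
  proof (rule finite_subset)
    show "S \<subseteq> (\<Union>k\<in>{..l}. lattice_sphere k)"
    proof
      fix v assume "v \<in> S"
      then have "nsq v = int (nat (nsq v))" "nat (nsq v) \<le> l" using nsq_nonneg[of v] by (auto simp: S_def)
      then show "v \<in> (\<Union>k\<in>{..l}. lattice_sphere k)"
        by (intro UN_I[of "nat (nsq v)"]) (simp_all only: lattice_sphere_iff atMost_iff)
    qed
  qed (auto intro: finite_lattice_sphere)
  have "R \<times> X \<subseteq> f ` S"
  proof
    fix rx assume "rx \<in> R \<times> X"
    then obtain r x where rx: "rx = (r, x)" "r \<in> R" "x \<in> X" by auto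
    have r: "0 \<le> r $ i" "r $ i < int M" for i using rx(2) by (auto simp: R_def)
    have xB: "x $ i \<in> B i" for i using rx(3) by (simp add: X_def)
    have x1: "0 \<le> x $ i1" "x $ i1 < int Z" using xB[of i1] by (auto simp: B_def)
    have xI: "0 \<le> x $ i" "x $ i < int Y" if "i \<in> I" for i using xB[of i] that by (auto simp: B_def I_def)
    define s where "s = (\<Sum>i\<in>I. (r $ i + int M * x $ i)\<^sup>2)"
    define b where "b = base s"
    define \<delta> where "\<delta> = (r $ i1 - b) mod int M"
    have \<delta>: "0 \<le> \<delta>" "\<delta> < int M" using M by (auto simp: \<delta>_def)
    define v :: "int ^ 'd" where "v = (\<chi> i. if i = i1 then b + \<delta> + int M * x $ i1 else r $ i + int M * x $ i)"
    have v1: "v $ i1 = b + \<delta> + int M * x $ i1" and vI: "\<And>i. i \<in> I \<Longrightarrow> v $ i = r $ i + int M * x $ i"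
      by (auto simp: v_def I_def)
    have rest_v: "rest v = s" unfolding rest_def s_def by (intro sum.cong) (auto simp: vI)
    have s4: "real_of_int s \<le> l / 4"
    proof -
      have "real_of_int ((r $ i + int M * x $ i)\<^sup>2) \<le> (N / (2 * D))\<^sup>2" if "i \<in> I" for i
      proof -
        have "r $ i + int M * x $ i \<le> int M + int M * (int Y - 1)"
          using r[of i] xI[OF that] by (intro add_mono mult_left_mono) auto
        then have "r $ i + int M * x $ i \<le> int (M * Y)" by (simp add: algebra_simps)
        then have "real_of_int (r $ i + int M * x $ i) \<le> real (M * Y)" by linarith
        also have "\<dots> \<le> N / (2 * D)"
        proof -
          have "real (Y * (2 * D * M)) \<le> real N" using Yle by (simp only: of_nat_le_iff)
          then show ?thesis using D by (simp add: field_simps)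
        qed
        finally have "real_of_int (r $ i + int M * x $ i) \<le> N / (2 * D)" .
        moreover have "0 \<le> real_of_int (r $ i + int M * x $ i)" using r[of i] xI[OF that] by simp
        ultimately have "(real_of_int (r $ i + int M * x $ i))\<^sup>2 \<le> (N / (2 * D))\<^sup>2" by (intro power_mono)
        then show ?thesis by simp
      qed
      then have "real_of_int s \<le> (\<Sum>i\<in>I. (N / (2 * D))\<^sup>2)" unfolding s_def of_int_sum by (intro sum_mono)
      also have "\<dots> = real (D - 1) * (N / (2 * D))\<^sup>2" by (simp add: cardI)
      also have "\<dots> \<le> real (D * D) * (N / (2 * D))\<^sup>2"
      proof (intro mult_right_mono)
        have "D - 1 \<le> D * D" using le_square[of D] by linarith
        then show "real (D - 1) \<le> real (D * D)" by (simp only: of_nat_le_iff)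
      qed auto
      also have "\<dots> = (real N)\<^sup>2 / 4" using D by (simp add: field_simps power2_eq_square)
      finally show ?thesis using Nl by linarith
    qed
    have s0: "0 \<le> s" by (simp add: s_def sum_nonneg)
    define A where "A = l - \<eta> * l - real_of_int s"
    have A0: "0 \<le> A" and Al: "A \<le> l"
    proof -
      have "\<eta> * l \<le> 1/2 * l" using \<eta> by (intro mult_right_mono) auto
      then show "0 \<le> A" using s4 unfolding A_def by linarith
      have "0 \<le> \<eta> * l" using \<eta> by simp
      then show "A \<le> l" using s0 unfolding A_def by simp
    qed
    have b: "sqrt A < of_int b" "of_int b - 1 \<le> sqrt A" unfolding b_def base_def A_def by linarith+
    have v_lo: "sqrt A < of_int (v $ i1)"
    proof -
      have "b \<le> v $ i1" unfolding v1 using \<delta> x1 by simp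
      then show ?thesis using b(1) by linarith
    qed
    have v_hi: "of_int (v $ i1) \<le> sqrt A + \<eta> * N / 4"
    proof -
      have "v $ i1 \<le> b + (int M - 1) + int M * (int Z - 1)" unfolding v1 using \<delta> x1 by (intro add_mono mult_left_mono) auto
      then have "v $ i1 \<le> b - 1 + int (M * Z)" by (simp add: algebra_simps)
      then have "real_of_int (v $ i1) \<le> of_int b - 1 + real (M * Z)" by linarith
      moreover have "real (M * Z) \<le> \<eta> * N / 4" using Z(1) M0 by (simp add: field_simps)
      ultimately show ?thesis using b(2) by linarith
    qed
    have lo: "A < (of_int (v $ i1))\<^sup>2"
    proof -
      have "(sqrt A)\<^sup>2 < (of_int (v $ i1))\<^sup>2" using v_lo A0 by (intro power_strict_mono) auto
      then show ?thesis using A0 by simp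
    qed
    have hi: "(of_int (v $ i1))\<^sup>2 \<le> A + \<eta> * l"
    proof -
      have "(of_int (v $ i1))\<^sup>2 \<le> (sqrt A + \<eta> * N / 4)\<^sup>2"
        using v_hi order.trans[OF real_sqrt_ge_zero[OF A0] less_imp_le[OF v_lo]] by (intro power_mono) auto
      also have "\<dots> = A + \<eta> * (N * sqrt A) / 2 + \<eta> * (\<eta> * (real N)\<^sup>2) / 16"
        using A0 by (simp add: power2_sum power2_eq_square field_simps)
      also have "\<dots> \<le> A + \<eta> * l / 2 + \<eta> * l / 16"
      proof (intro add_mono divide_right_mono mult_left_mono order_refl)
        have "N * sqrt A \<le> sqrt l * sqrt l" using Nsl Al A0 by (intro mult_mono) auto
        then show "N * sqrt A \<le> l" by simp
        have "\<eta> * (real N)\<^sup>2 \<le> 1 * (real l)" using \<eta> Nl by (intro mult_mono) auto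
        then show "\<eta> * (real N)\<^sup>2 \<le> l" by simp
      qed (use \<eta> in auto)
      also have "\<dots> \<le> A + \<eta> * l" using \<eta> by (simp add: field_simps)
      finally show ?thesis .
    qed
    have dvdi: "int M dvd v $ i - r $ i" for i
    proof (cases "i = i1")
      case True
      have "int M dvd \<delta> - (r $ i1 - b)" unfolding \<delta>_def by (simp add: mod_eq_dvd_iff[symmetric])
      then have "int M dvd (\<delta> - (r $ i1 - b)) + int M * x $ i1" by simp
      then show ?thesis unfolding True v1 by (simp add: algebra_simps)
    next
      case False
      then show ?thesis by (simp add: v_def)
    qed
    have "int M dvd nsq v - nsq r" by (rule nsq_dvd_diff) (rule dvdi)
    then have "int M dvd nsq v - int l" using rx(2) by (simp add: R_def) (metis diff_add_cancel add_diff_eq dvd_add)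
    moreover have "l - \<eta> * l < of_int (nsq v)" "real_of_int (nsq v) \<le> real l"
      unfolding nsq_split rest_v using lo hi by (auto simp: A_def)
    ultimately have "v \<in> S" by (simp add: S_def)
    moreover have "f v = (r, x)"
    proof -
      have "v $ i mod int M = r $ i" for i
        using dvdi[of i] r[of i] by (metis mod_eq_dvd_iff mod_pos_pos_trivial)
      moreover have "(v $ i1 - base (rest v)) div int M = x $ i1"
        unfolding rest_v b_def[symmetric] v1 using \<delta> M by simp
      moreover have "v $ i div int M = x $ i" if "i \<noteq> i1" for i
        using that r[of i] M by (simp add: v_def)
      ultimately show ?thesis by (auto simp: f_def vec_eq_iff)
    qed
    ultimately show "rx \<in> f ` S" using rx(1) by (metis image_eqI)
  qed
  then have "card (R \<times> X) \<le> card S" using finS by (meson card_image_le card_mono finite_imageI order_trans)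
  then have RX: "real (card R) * real (card X) \<le> real (card S)"
    by (metis card_cartesian_product of_nat_le_iff of_nat_mult)
  have cardX: "real (card X) = Z * real Y ^ (D - 1)"
  proof -
    have "card X = (\<Prod>i\<in>UNIV. card (B i))" unfolding X_def by (rule card_vec_box) (simp add: B_def)
    also have "\<dots> = card (B i1) * (\<Prod>i\<in>I. card (B i))" unfolding I_def by (rule prod.remove) auto
    also have "(\<Prod>i\<in>I. card (B i)) = (\<Prod>i\<in>I. Y)" by (intro prod.cong) (auto simp: B_def I_def)
    finally show ?thesis by (simp add: B_def cardI)
  qed
  have cardR: "real (totient M) * real M ^ (D - 2) / 2 \<le> real (card R)"
  proof -
    have "totient M * M ^ (D - 2) \<le> 2 * card R" unfolding R_def D_def by (rule card_local_solutions[OF M d])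
    then have "real (totient M * M ^ (D - 2)) \<le> real (2 * card R)" by (simp only: of_nat_le_iff)
    then show ?thesis by simp
  qed
  have "real (totient M) / (real M)\<^sup>2 * \<eta> * real N ^ D / (16 * (4 * real D) ^ (D - 1))
    = (real (totient M) * real M ^ (D - 2) / 2) * ((\<eta> * N / (8 * M)) * (N / (4 * D * M)) ^ (D - 1))"
  proof -
    have gen: "t / m\<^sup>2 * \<eta> * (n * n1) / (16 * G) = (t * m2 / 2) * ((\<eta> * n / (8 * m)) * (n1 / (G * (m * m2))))"
      if "m \<noteq> 0" "m2 \<noteq> 0" "G \<noteq> 0" for t m n n1 G m2 :: real
      using that by (simp add: field_simps power2_eq_square)
    have "(N / (4 * D * M)) ^ (D - 1) = real N ^ (D - 1) / ((4 * real D) ^ (D - 1) * real M ^ (D - 1))"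
      by (simp add: power_divide power_mult_distrib)
    moreover have "real N ^ D = real N * real N ^ (D - 1)" "real M ^ (D - 1) = real M * real M ^ (D - 2)"
      using D by (simp_all flip: power_Suc add: Suc_diff_Suc numeral_2_eq_2)
    ultimately show ?thesis
      by (simp only: of_nat_mult of_nat_numeral) (rule gen, use M0 D in auto)
  qed
  also have "\<dots> \<le> real (card R) * (Z * real Y ^ (D - 1))"
    by (intro mult_mono power_mono cardR Z Yge) (use \<eta> in auto)
  also have "\<dots> \<le> real (card S)" using RX by (simp only: cardX)
  finally show "real (totient M) / (real M)\<^sup>2 * \<eta> * real N ^ CARD('d) / (16 * (4 * real CARD('d)) ^ (CARD('d) - 1)) \<le> real (card S)"
    by (simp only: D_def)
qed

section \<open>A lower bound for the size of spheres\<close>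

text \<open>
  Averaging over the squared radii in \<open>(l - \<eta> l, l]\<close> that are congruent to \<open>l\<close> modulo \<open>M = 2 q0!\<close> gives
  spheres of average size at least \<open>c3 (\<phi>(M)/M) N^(d-2)\<close>, by \<open>card_shell_ge\<close>. Each of them differs from
  the sphere at \<open>l\<close> by at most \<open>C2 N^(d-2) / sqrt q0\<close>, by \<open>card_sphere_compare\<close>. For suitable \<open>q0\<close> the
  error is at most half of the average.
\<close>

theorem card_sphere_ge:
  assumes "CARD('d::finite) \<ge> 5"
  shows "\<exists>(c::real) (N0::nat). c > 0 \<and> N0 \<ge> 1 \<and> (\<forall>(N::nat) (l::nat). N \<ge> N0 \<longrightarrow> N\<^sup>2 \<le> l \<longrightarrow> l < (N + 1)\<^sup>2 \<longrightarrow>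
     c * real N ^ (CARD('d) - 2) \<le> real (card (lattice_sphere l :: (int ^ 'd) set)))"
proof -
  define D where "D = CARD('d)"
  define C2 :: real where "C2 = 288 * (10^15 * 5^(D - 5)) + 192"
  define c3 :: real where "c3 = 1 / (128 * (4 * real D) ^ (D - 1))"
  have D: "D \<ge> 5" using assms by (simp add: D_def)
  have c3: "c3 > 0" using D by (simp add: c3_def)
  have C2: "C2 > 0" unfolding C2_def by (intro add_nonneg_pos) auto
  \<comment> \<open>\<open>\<phi>(M)/M\<close> is at least of order \<open>q0^(-1/3)\<close>, so it beats the error \<open>q0^(-1/2)\<close> of
    the comparison.\<close>
  obtain q0 :: nat where q0: "q0 \<ge> 2" "(2 * C2 / c3) / sqrt (real q0) \<le> real (totient (2 * fact q0)) / (2 * fact q0)"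
    using exists_totient_density_large[of "2 * C2 / c3"] c3 C2 by auto
  define M :: nat where "M = 2 * fact q0"
  have M: "even M" "M \<ge> 2" by (auto simp: M_def)
  have M0: "real M > 0" using M by simp
  define \<phi> where "\<phi> = real (totient M) / M"
  have \<phi>: "\<phi> > 0" using M by (simp add: \<phi>_def)
  have E: "C2 / sqrt (real q0) \<le> c3 * \<phi> / 2"
  proof -
    have "(2 * C2 / c3) / sqrt (real q0) \<le> \<phi>" using q0(2) by (simp add: \<phi>_def M_def)
    then have "c3 * ((2 * C2 / c3) / sqrt (real q0)) \<le> c3 * \<phi>" using c3 by (intro mult_left_mono) auto
    moreover have "c3 * ((2 * C2 / c3) / sqrt (real q0)) = 2 * (C2 / sqrt (real q0))" using c3 by simp
    ultimately show ?thesis by linarith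
  qed
  \<comment> \<open>The largest relative window in which \<open>card_sphere_compare\<close> applies.\<close>
  define \<eta> :: real where "\<eta> = 1 / (5 ^ D * real q0 ^ 5)"
  have \<eta>0: "\<eta> > 0" using q0 by (simp add: \<eta>_def)
  have \<eta>1: "\<eta> \<le> 1/2"
  proof -
    have "2 \<le> (5::real) ^ D" using power_increasing[of 1 D "5::real"] D by simp
    moreover have "1 \<le> real q0 ^ 5" using q0 by (intro one_le_power) auto
    ultimately have "2 * 1 \<le> 5 ^ D * real q0 ^ 5" by (intro mult_mono) auto
    then show ?thesis unfolding \<eta>_def by (intro divide_left_mono) auto
  qed
  define N0 where "N0 = max (4 * D * M) (nat \<lceil>8 * M / \<eta>\<rceil>)"
  have "c3 * \<phi> / 2 * real N ^ (D - 2) \<le> real (card (lattice_sphere l :: (int ^ 'd) set))"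
    if N: "N \<ge> N0" and l: "N\<^sup>2 \<le> l" "l < (N + 1)\<^sup>2" for N l :: nat
  proof -
    have N1: "4 * D * M \<le> N" using N by (simp add: N0_def)
    have "8 * M / \<eta> \<le> N" using N unfolding N0_def by linarith
    then have N2: "8 * M \<le> \<eta> * N" using \<eta>0 by (simp add: field_simps)
    have Npos: "N \<ge> 1" using N1 D M by (cases N) auto
    have Nl: "(real N)\<^sup>2 \<le> real l" using l(1) by (metis of_nat_le_iff of_nat_power)
    have lN: "real l \<le> 4 * (real N)\<^sup>2"
    proof -
      have "(N + 1)\<^sup>2 \<le> (2 * N)\<^sup>2" using Npos by (intro power_mono) auto
      then have "l \<le> (2 * N)\<^sup>2" using l(2) by linarith
      then have "real l \<le> real ((2 * N)\<^sup>2)" by (simp only: of_nat_le_iff)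
      then show ?thesis by (simp add: power_mult_distrib)
    qed
    define S where "S = {v::int^'d. l - \<eta> * l < of_int (nsq v) \<and> nsq v \<le> int l \<and> int M dvd nsq v - int l}"
    have shell: "real (totient M) / (real M)\<^sup>2 * \<eta> * real N ^ D / (16 * (4 * real D) ^ (D - 1)) \<le> real (card S)"
      unfolding S_def D_def by (rule card_shell_ge[OF assms M \<eta>0 \<eta>1 l(1)]) (use N1 N2 in \<open>auto simp: D_def\<close>)
    define \<Lambda> where "\<Lambda> = {l'. real l - \<eta> * l < real l' \<and> l' \<le> l \<and> M dvd l - l'}"
    have fin\<Lambda>: "finite \<Lambda>" by (rule finite_subset[of _ "{..l}"]) (auto simp: \<Lambda>_def)
    define r where "r = (\<lambda>l. real (card (lattice_sphere l :: (int ^ 'd) set)))"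
    have "S \<subseteq> (\<Union>k\<in>\<Lambda>. lattice_sphere k)"
    proof
      fix v assume v: "v \<in> S"
      define k where "k = nat (nsq v)"
      have k: "nsq v = int k" using nsq_nonneg[of v] by (simp add: k_def)
      have kl: "k \<le> l" using v k by (simp add: S_def)
      have "int M dvd int l - int k" using v k by (simp add: S_def dvd_diff_commute)
      then have "M dvd l - k" using kl by (metis int_dvd_int_iff of_nat_diff)
      then have "k \<in> \<Lambda>" using v k kl by (simp add: S_def \<Lambda>_def)
      then show "v \<in> (\<Union>k\<in>\<Lambda>. lattice_sphere k)" using k by (auto simp: lattice_sphere_iff)
    qed
    then have "card S \<le> card (\<Union>k\<in>\<Lambda>. lattice_sphere k :: (int ^ 'd) set)"
      using fin\<Lambda> finite_lattice_sphere by (intro card_mono) auto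
    also have "\<dots> \<le> (\<Sum>k\<in>\<Lambda>. card (lattice_sphere k :: (int ^ 'd) set))" by (rule card_UN_le[OF fin\<Lambda>])
    finally have "real (card S) \<le> (\<Sum>k\<in>\<Lambda>. r k)" unfolding r_def by (simp flip: of_nat_sum)
    also have "\<dots> \<le> (\<Sum>k\<in>\<Lambda>. r l + C2 / sqrt q0 * real N ^ (D - 2))"
    proof (rule sum_mono)
      fix k assume k: "k \<in> \<Lambda>"
      then have kl: "k \<le> l" by (simp add: \<Lambda>_def)
      have "\<bar>r l - r k\<bar> \<le> C2 / sqrt q0 * real N ^ (D - 2)"
        unfolding r_def C2_def D_def
      proof (rule card_sphere_compare[OF assms Npos l(2) kl])
        show "1 \<le> q0" using q0 by simp
        show "2 * fact q0 dvd l - k" using k by (simp add: \<Lambda>_def M_def)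
        show "real (l - k) \<le> real l / (5 ^ CARD('d) * real q0 ^ 5)"
          using k kl by (simp add: \<Lambda>_def \<eta>_def D_def of_nat_diff)
      qed
      then show "r k \<le> r l + C2 / sqrt q0 * real N ^ (D - 2)" by linarith
    qed
    also have "\<dots> = card \<Lambda> * (r l + C2 / sqrt q0 * real N ^ (D - 2))" by simp
    also have "\<dots> \<le> (8 * \<eta> * (real N)\<^sup>2 / M) * (r l + C2 / sqrt q0 * real N ^ (D - 2))"
    proof (intro mult_right_mono)
      define K where "K = nat \<lfloor>\<eta> * l / M\<rfloor>"
      have "\<Lambda> \<subseteq> (\<lambda>k. l - k * M) ` {..K}"
      proof
        fix k assume k: "k \<in> \<Lambda>"
        then obtain m where m: "l - k = M * m" by (auto simp: \<Lambda>_def)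
        have "real (l - k) < \<eta> * l" using k by (auto simp: \<Lambda>_def of_nat_diff)
        then have "real M * real m < \<eta> * l" unfolding m by simp
        then have "real m \<le> \<eta> * l / M" using M0 by (simp add: field_simps)
        then have "m \<le> K" unfolding K_def by (simp add: le_nat_floor)
        moreover have "k = l - m * M" using m k by (auto simp: \<Lambda>_def mult.commute)
        ultimately show "k \<in> (\<lambda>k. l - k * M) ` {..K}" by auto
      qed
      then have "card \<Lambda> \<le> card {..K}" by (meson card_image_le card_mono finite_atMost finite_imageI order_trans)
      then have "real (card \<Lambda>) \<le> real K + 1" by simp
      also have "real K \<le> \<eta> * l / M" unfolding K_def using \<eta>0 by (intro of_nat_floor) auto
      also have "1 \<le> \<eta> * l / M"
      proof -
        have "real N * 1 \<le> real N * real N" using Npos by (intro mult_left_mono) auto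
        then have "real N \<le> real l" using Nl by (simp add: power2_eq_square)
        then have "\<eta> * N \<le> \<eta> * l" using \<eta>0 by (intro mult_left_mono) auto
        then show ?thesis using N2 M0 by (simp add: field_simps)
      qed
      also have "\<eta> * l / M + \<eta> * l / M = 2 * \<eta> * l / M" by simp
      also have "\<dots> \<le> 2 * \<eta> * (4 * (real N)\<^sup>2) / M" using lN \<eta>0 by (intro divide_right_mono mult_left_mono) auto
      finally show "real (card \<Lambda>) \<le> 8 * \<eta> * (real N)\<^sup>2 / M" by simp
      show "0 \<le> r l + C2 / sqrt q0 * real N ^ (D - 2)" using C2 by (simp add: r_def)
    qed
    finally have "real (totient M) / (real M)\<^sup>2 * \<eta> * real N ^ D / (16 * (4 * real D) ^ (D - 1))
       \<le> (8 * \<eta> * (real N)\<^sup>2 / M) * (r l + C2 / sqrt q0 * real N ^ (D - 2))"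
      using shell by linarith
    moreover have "real (totient M) / (real M)\<^sup>2 * \<eta> * real N ^ D / (16 * (4 * real D) ^ (D - 1))
      = (8 * \<eta> * (real N)\<^sup>2 / M) * (c3 * \<phi> * real N ^ (D - 2))"
    proof -
      have "D - 2 + 2 = D" using D by simp
      then have "real N ^ D = real N ^ (D - 2) * (real N)\<^sup>2" by (metis power_add)
      then show ?thesis by (simp add: c3_def \<phi>_def power2_eq_square mult_ac)
    qed
    moreover have "8 * \<eta> * (real N)\<^sup>2 / M > 0" using \<eta>0 Npos M0 by simp
    ultimately have "c3 * \<phi> * real N ^ (D - 2) \<le> r l + C2 / sqrt q0 * real N ^ (D - 2)"
      by (metis mult_le_cancel_left_pos)
    also have "C2 / sqrt q0 * real N ^ (D - 2) \<le> c3 * \<phi> / 2 * real N ^ (D - 2)"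
      using E by (intro mult_right_mono) auto
    finally show ?thesis by (simp add: r_def)
  qed
  moreover have "c3 * \<phi> / 2 > 0" using c3 \<phi> by simp
  moreover have "N0 \<ge> 1"
  proof -
    have "0 < D" "0 < M" using D M by simp_all
    then have "0 < 4 * D * M" by simp
    moreover have "4 * D * M \<le> N0" by (simp add: N0_def)
    ultimately show ?thesis by linarith
  qed
  ultimately show ?thesis unfolding D_def by blast
qed

section \<open>Fourier analysis on a discrete torus\<close>

definition dotr :: "int ^ 'd::finite \<Rightarrow> ('d \<Rightarrow> real) \<Rightarrow> real" where
  "dotr v \<xi> = (\<Sum>i\<in>UNIV. of_int (v $ i) * \<xi> i)"

lemma dotr_add: "dotr (v + w) \<xi> = dotr v \<xi> + dotr w \<xi>"
  and dotr_diff: "dotr (v - w) \<xi> = dotr v \<xi> - dotr w \<xi>"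
  by (simp_all add: dotr_def sum.distrib sum_subtractf algebra_simps)

text \<open>
  The characters of integer vectors modulo \<open>P\<close>, indexed by the integer points of a box of side \<open>P\<close>; \<open>fr P\<close>
  rescales an index to a frequency in the unit cube. The same boxes also serve as smoothing kernels.
\<close>

definition freqs :: "nat \<Rightarrow> (int ^ 'd::finite) set" where
  "freqs P = {k. \<forall>i. k $ i \<in> {0..<int P}}"

definition fr :: "nat \<Rightarrow> int ^ 'd::finite \<Rightarrow> 'd \<Rightarrow> real" where
  "fr P k i = of_int (k $ i) / P"

lemma finite_freqs: "finite (freqs P)" unfolding freqs_def by (rule finite_vec_box) auto

lemma sum_ee_freqs:
  fixes x :: "int ^ 'd::finite"
  assumes "P > 0" "\<And>i. \<bar>x $ i\<bar> < int P"
  shows "(\<Sum>k\<in>freqs P. ee (dotr x (fr P k))) = (if x = 0 then of_nat (P ^ CARD('d)) else 0)"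
proof -
  have one: "(\<Sum>n\<in>{0..<int P}. ee (of_int (x $ i) * (of_int n / P))) = (if x $ i = 0 then of_nat P else 0)" for i
  proof -
    have "(\<Sum>n\<in>{0..<int P}. ee (of_int (x $ i) * (of_int n / P))) = (\<Sum>k<P. ee (real k * of_int (x $ i) / P))"
      by (rule sum.reindex_bij_witness[of _ int nat]) (auto simp: mult_ac)
    also have "\<dots> = (if int P dvd x $ i then of_nat P else 0)" by (rule sum_ee_roots[OF assms(1)])
    also have "int P dvd x $ i \<longleftrightarrow> x $ i = 0"
      using assms(2)[of i] dvd_imp_le_int[of "x $ i" "int P"] by auto
    finally show ?thesis .
  qed
  have "(\<Sum>k\<in>freqs P. ee (dotr x (fr P k))) = (\<Sum>k\<in>freqs P. \<Prod>i\<in>UNIV. ee (of_int (x $ i) * (of_int (k $ i) / P)))"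
    by (simp add: dotr_def fr_def ee_sum)
  also have "\<dots> = (\<Prod>i\<in>UNIV. \<Sum>n\<in>{0..<int P}. ee (of_int (x $ i) * (of_int n / P)))"
    unfolding freqs_def by (rule prod_sum_vec[symmetric]) auto
  also have "\<dots> = (\<Prod>i\<in>UNIV. if x $ i = 0 then of_nat P else 0)" by (simp only: one)
  also have "\<dots> = (if x = 0 then of_nat (P ^ CARD('d)) else 0)"
  proof (cases "x = 0")
    case False
    then obtain i where "x $ i \<noteq> 0" by (auto simp: vec_eq_iff)
    then have "(\<Prod>i\<in>UNIV. if x $ i = 0 then of_nat P else (0::complex)) = 0" by (intro prod_zero) auto
    then show ?thesis using False by simp
  qed simp
  finally show ?thesis .
qed

lemma sum_ee_freqs_count:
  fixes g :: "'t \<Rightarrow> int ^ 'd::finite"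
  assumes "P > 0" "finite T" "\<And>t i. t \<in> T \<Longrightarrow> \<bar>g t $ i\<bar> < int P"
  shows "(\<Sum>k\<in>freqs P. \<Sum>t\<in>T. ee (dotr (g t) (fr P k))) = of_nat (P ^ CARD('d)) * of_nat (card {t\<in>T. g t = 0})"
proof -
  have "(\<Sum>k\<in>freqs P. \<Sum>t\<in>T. ee (dotr (g t) (fr P k))) = (\<Sum>t\<in>T. \<Sum>k\<in>freqs P. ee (dotr (g t) (fr P k)))"
    by (rule sum.swap)
  also have "\<dots> = (\<Sum>t\<in>T. if g t = 0 then of_nat (P ^ CARD('d)) else 0)"
    by (intro sum.cong refl sum_ee_freqs assms(1)) (use assms(3) in auto)
  also have "\<dots> = (\<Sum>t\<in>{t\<in>T. g t = 0}. of_nat (P ^ CARD('d)))"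
    by (rule sum.inter_filter[OF assms(2), symmetric])
  finally show ?thesis by (simp add: mult.commute)
qed

definition ft :: "(int ^ 'd::finite) set \<Rightarrow> ('d \<Rightarrow> real) \<Rightarrow> complex" where
  "ft A \<xi> = (\<Sum>x\<in>A. ee (dotr x \<xi>))"

lemma norm_ft_squared: "of_real ((norm (ft A \<xi>))\<^sup>2) = (\<Sum>x\<in>A. \<Sum>y\<in>A. ee (dotr (x - y) \<xi>))"
proof -
  have "of_real ((norm (ft A \<xi>))\<^sup>2) = ft A \<xi> * cnj (ft A \<xi>)" using complex_norm_square[of "ft A \<xi>"] by simp
  also have "\<dots> = (\<Sum>x\<in>A. \<Sum>y\<in>A. ee (dotr (x - y) \<xi>))"
    by (simp add: ft_def sum_product cnj_ee dotr_diff ee_add[symmetric])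
  finally show ?thesis .
qed

text \<open>
  Orthogonality on a torus that is large enough for congruent differences to be equal.
\<close>

lemma sum_ft_squared_times:
  fixes A V :: "(int ^ 'd::finite) set"
  assumes "P > 0" "finite A" "finite V" "\<And>x y v i. x \<in> A \<Longrightarrow> y \<in> A \<Longrightarrow> v \<in> V \<Longrightarrow> \<bar>x $ i - y $ i + v $ i\<bar> < int P"
  shows "(\<Sum>k\<in>freqs P. of_real ((norm (ft A (fr P k)))\<^sup>2) * ft V (fr P k))
     = of_nat (P ^ CARD('d)) * of_nat (card {(x,y,v). x \<in> A \<and> y \<in> A \<and> v \<in> V \<and> x + v = y})"
proof -
  let ?T = "A \<times> A \<times> V"
  let ?g = "\<lambda>(x, y, v). x - y + v :: int ^ 'd"
  have "of_real ((norm (ft A \<xi>))\<^sup>2) * ft V \<xi> = (\<Sum>t\<in>?T. ee (dotr (?g t) \<xi>))" for \<xi>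
  proof -
    have "of_real ((norm (ft A \<xi>))\<^sup>2) * ft V \<xi> = (\<Sum>x\<in>A. \<Sum>y\<in>A. \<Sum>v\<in>V. ee (dotr (x - y + v) \<xi>))"
      unfolding norm_ft_squared sum_distrib_right by (simp add: ft_def sum_distrib_left dotr_add ee_add)
    also have "\<dots> = (\<Sum>t\<in>?T. ee (dotr (?g t) \<xi>))"
      by (simp add: sum.cartesian_product case_prod_unfold)
    finally show ?thesis .
  qed
  then have "(\<Sum>k\<in>freqs P. of_real ((norm (ft A (fr P k)))\<^sup>2) * ft V (fr P k)) = (\<Sum>k\<in>freqs P. \<Sum>t\<in>?T. ee (dotr (?g t) (fr P k)))"
    by simp
  also have "\<dots> = of_nat (P ^ CARD('d)) * of_nat (card {t\<in>?T. ?g t = 0})"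
    by (rule sum_ee_freqs_count) (use assms in auto)
  also have "{t\<in>?T. ?g t = 0} = {(x,y,v). x \<in> A \<and> y \<in> A \<and> v \<in> V \<and> x + v = y}"
  proof -
    have "x - y + v = (x + v) - y" for x y v :: "int ^ 'd" by (simp add: algebra_simps)
    then have "x - y + v = 0 \<longleftrightarrow> x + v = y" for x y v :: "int ^ 'd" by (simp only: right_minus_eq)
    then show ?thesis by auto
  qed
  finally show ?thesis .
qed

lemma sum_ft_squared_times_squared:
  fixes A R :: "(int ^ 'd::finite) set"
  assumes "P > 0" "finite A" "finite R" "\<And>x y v w i. x \<in> A \<Longrightarrow> y \<in> A \<Longrightarrow> v \<in> R \<Longrightarrow> w \<in> R \<Longrightarrow> \<bar>x $ i - y $ i + (v $ i - w $ i)\<bar> < int P"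
  shows "(\<Sum>k\<in>freqs P. (norm (ft A (fr P k)))\<^sup>2 * (norm (ft R (fr P k)))\<^sup>2)
     = real (P ^ CARD('d)) * real (card {(x,y,v,w). x \<in> A \<and> y \<in> A \<and> v \<in> R \<and> w \<in> R \<and> x + v = y + w})"
proof -
  let ?T = "A \<times> A \<times> R \<times> R"
  let ?g = "\<lambda>(x, y, v, w). x - y + (v - w) :: int ^ 'd"
  have e: "complex_of_real ((norm (ft A \<xi>))\<^sup>2) * of_real ((norm (ft R \<xi>))\<^sup>2) = (\<Sum>t\<in>?T. ee (dotr (?g t) \<xi>))" for \<xi>
  proof -
    define r where "r = complex_of_real ((norm (ft R \<xi>))\<^sup>2)"
    have r: "r = (\<Sum>v\<in>R. \<Sum>w\<in>R. ee (dotr (v - w) \<xi>))" unfolding r_def by (rule norm_ft_squared)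
    have "complex_of_real ((norm (ft A \<xi>))\<^sup>2) * r = (\<Sum>x\<in>A. \<Sum>y\<in>A. \<Sum>v\<in>R. \<Sum>w\<in>R. ee (dotr (x - y + (v - w)) \<xi>))"
      unfolding norm_ft_squared sum_distrib_right unfolding r dotr_add ee_add sum_distrib_left ..
    also have "\<dots> = (\<Sum>t\<in>?T. ee (dotr (?g t) \<xi>))"
      by (simp add: sum.cartesian_product case_prod_unfold)
    finally show ?thesis by (simp only: r_def)
  qed
  have "complex_of_real (\<Sum>k\<in>freqs P. (norm (ft A (fr P k)))\<^sup>2 * (norm (ft R (fr P k)))\<^sup>2) = (\<Sum>k\<in>freqs P. \<Sum>t\<in>?T. ee (dotr (?g t) (fr P k)))"
    unfolding e[symmetric] by simp
  also have "\<dots> = of_nat (P ^ CARD('d)) * of_nat (card {t\<in>?T. ?g t = 0})"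
    by (rule sum_ee_freqs_count) (use assms in auto)
  also have "{t\<in>?T. ?g t = 0} = {(x,y,v,w). x \<in> A \<and> y \<in> A \<and> v \<in> R \<and> w \<in> R \<and> x + v = y + w}"
  proof -
    have "x - y + (v - w) = (x + v) - (y + w)" for x y v w :: "int ^ 'd" by (simp add: algebra_simps)
    then have "x - y + (v - w) = 0 \<longleftrightarrow> x + v = y + w" for x y v w :: "int ^ 'd" by (simp only: right_minus_eq)
    then show ?thesis by auto
  qed
  also have "(of_nat :: nat \<Rightarrow> complex) (P ^ CARD('d)) * (of_nat :: nat \<Rightarrow> complex) (card {(x,y,v,w). x \<in> A \<and> y \<in> A \<and> v \<in> R \<and> w \<in> R \<and> x + v = y + w})
     = complex_of_real (real (P ^ CARD('d)) * real (card {(x,y,v,w). x \<in> A \<and> y \<in> A \<and> v \<in> R \<and> w \<in> R \<and> x + v = y + w}))"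
    by (simp only: of_real_mult of_real_of_nat_eq)
  finally show ?thesis by (simp only: of_real_eq_iff)
qed

text \<open>
  Cauchy-Schwarz for the number of representations of a point of \<open>Q\<close> as a sum.
\<close>

lemma card_additive_quadruples_ge:
  fixes A R :: "(int ^ 'd::finite) set"
  assumes "finite A" "finite R" "finite Q" "\<And>x v. x \<in> A \<Longrightarrow> v \<in> R \<Longrightarrow> x + v \<in> Q"
  shows "(real (card A) * real (card R))\<^sup>2 \<le> real (card Q) * real (card {(x,y,v,w). x \<in> A \<and> y \<in> A \<and> v \<in> R \<and> w \<in> R \<and> x + v = y + w})"
proof -
  define f where "f = (\<lambda>z. card {(x,v). x \<in> A \<and> v \<in> R \<and> x + v = z})"
  have fin: "finite {(x,v). x \<in> A \<and> v \<in> R \<and> x + v = z}" for z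
    by (rule finite_subset[of _ "A \<times> R"]) (use assms in auto)
  have 1: "card A * card R = (\<Sum>z\<in>Q. f z)"
  proof -
    have "A \<times> R = (\<Union>z\<in>Q. {(x,v). x \<in> A \<and> v \<in> R \<and> x + v = z})" using assms(4) by auto
    then have "card (A \<times> R) = (\<Sum>z\<in>Q. f z)"
      unfolding f_def by (simp only:) (rule card_UN_disjoint, use assms fin in auto)
    then show ?thesis by (simp add: card_cartesian_product)
  qed
  have 2: "card {(x,y,v,w). x \<in> A \<and> y \<in> A \<and> v \<in> R \<and> w \<in> R \<and> x + v = y + w} = (\<Sum>z\<in>Q. (f z)\<^sup>2)"
  proof -
    let ?X = "{(x,y,v,w). x \<in> A \<and> y \<in> A \<and> v \<in> R \<and> w \<in> R \<and> x + v = y + w}"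
    let ?F = "\<lambda>z. {(x,v). x \<in> A \<and> v \<in> R \<and> x + v = z}"
    have "bij_betw (\<lambda>(x,y,v,w). ((x,v),(y,w))) ?X (\<Union>z\<in>Q. ?F z \<times> ?F z)"
      by (rule bij_betwI[where g = "\<lambda>((x,v),(y,w)). (x,y,v,w)"]) (use assms(4) in auto)
    then have "card ?X = card (\<Union>z\<in>Q. ?F z \<times> ?F z)" by (rule bij_betw_same_card)
    also have "\<dots> = (\<Sum>z\<in>Q. card (?F z \<times> ?F z))"
      by (rule card_UN_disjoint) (use assms fin in auto)
    finally show ?thesis by (simp add: card_cartesian_product f_def power2_eq_square)
  qed
  have "(\<Sum>z\<in>Q. 1 * real (f z))\<^sup>2 \<le> (\<Sum>z\<in>Q. 1\<^sup>2) * (\<Sum>z\<in>Q. (real (f z))\<^sup>2)"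
    by (rule Cauchy_Schwarz_ineq_sum)
  then show ?thesis unfolding 2 using 1 by (simp flip: of_nat_mult)
qed

section \<open>Multipliers of spherical averages\<close>

lemma norm_one_minus_ee_sum_le:
  assumes "finite A"
  shows "norm (1 - ee (\<Sum>i\<in>A. f i)) \<le> (\<Sum>i\<in>A. norm (1 - ee (f i)))"
  using assms
proof (induction A rule: finite_induct)
  case (insert x A)
  have "1 - ee (\<Sum>i\<in>insert x A. f i) = (1 - ee (f x)) + ee (f x) * (1 - ee (\<Sum>i\<in>A. f i))"
    using insert by (simp add: ee_add algebra_simps)
  also have "norm \<dots> \<le> norm (1 - ee (f x)) + norm (ee (f x) * (1 - ee (\<Sum>i\<in>A. f i)))"
    by (rule norm_triangle_ineq)
  also have "\<dots> \<le> norm (1 - ee (f x)) + (\<Sum>i\<in>A. norm (1 - ee (f i)))"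
    using insert.IH by (simp add: norm_mult)
  finally show ?case using insert by simp
qed simp

text \<open>
  The Fourier multiplier of \<open>spherical_avg q l\<close>.
\<close>

definition mult_avg :: "nat \<Rightarrow> nat \<Rightarrow> ('d::finite \<Rightarrow> real) \<Rightarrow> complex" where
  "mult_avg q l \<xi> = esum l (\<lambda>i. real q * \<xi> i) / of_nat (card (lattice_sphere l :: (int ^ 'd) set))"

lemma norm_esum_le:
  fixes \<xi> :: "'d::finite \<Rightarrow> real"
  shows "norm (esum l \<xi>) \<le> real (card (lattice_sphere l :: (int ^ 'd) set))"
  unfolding esum_def by (rule order.trans[OF norm_sum]) simp

lemma norm_mult_avg_le_1:
  fixes \<xi> :: "'d::finite \<Rightarrow> real"
  shows "norm (mult_avg q l \<xi>) \<le> 1"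
  using norm_esum_le[of l "\<lambda>i. real q * \<xi> i"]
  by (cases "card (lattice_sphere l :: (int ^ 'd) set) = 0") (auto simp: mult_avg_def norm_divide divide_le_eq_1)

lemma component_le_sqrt:
  assumes "v \<in> (lattice_sphere l :: (int ^ 'd::finite) set)"
  shows "\<bar>real_of_int (v $ i)\<bar> \<le> sqrt (real l)"
proof -
  have "(v $ i)\<^sup>2 \<le> int l" using component_squared_le_nsq[of v i] assms by (simp add: lattice_sphere_iff)
  then have "real_of_int ((v $ i)\<^sup>2) \<le> real l" by linarith
  then show ?thesis by (intro real_le_rsqrt) simp
qed

text \<open>
  If \<open>q \<xi>\<close> is much closer to the integers than the inverse radius of the sphere, all terms of the
  exponential sum are close to 1.
\<close>

lemma mult_avg_near_1:
  fixes \<xi> :: "'d::finite \<Rightarrow> real"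
  assumes "card (lattice_sphere l :: (int ^ 'd) set) > 0" "\<And>i. nint (real q * \<xi> i) \<le> \<omega>"
  shows "norm (1 - mult_avg q l \<xi>) \<le> 2 * pi * CARD('d) * sqrt l * \<omega>"
proof -
  let ?S = "lattice_sphere l :: (int ^ 'd) set"
  let ?\<theta> = "\<lambda>i. real q * \<xi> i"
  have fin: "finite ?S" by (rule finite_lattice_sphere)
  have pt: "norm (1 - ee (\<Sum>i\<in>UNIV. of_int (v $ i) * ?\<theta> i)) \<le> 2 * pi * CARD('d) * sqrt l * \<omega>" if v: "v \<in> ?S" for v
  proof -
    have "norm (1 - ee (\<Sum>i\<in>UNIV. of_int (v $ i) * ?\<theta> i)) \<le> (\<Sum>i\<in>UNIV. norm (1 - ee (of_int (v $ i) * ?\<theta> i)))"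
      by (rule norm_one_minus_ee_sum_le) simp
    also have "\<dots> \<le> (\<Sum>i\<in>(UNIV::'d set). 2 * pi * (sqrt l * \<omega>))"
    proof (rule sum_mono)
      fix i
      have "norm (1 - ee (of_int (v $ i) * ?\<theta> i)) \<le> 2 * pi * nint (of_int (v $ i) * ?\<theta> i)"
        by (rule norm_one_minus_ee_le_nint)
      also have "\<dots> \<le> 2 * pi * (\<bar>of_int (v $ i)\<bar> * nint (?\<theta> i))"
        by (intro mult_left_mono nint_of_int_mult) auto
      also have "\<dots> \<le> 2 * pi * (sqrt l * \<omega>)"
        using component_le_sqrt[OF v, of i] assms(2)[of i] by (intro mult_left_mono mult_mono) auto
      finally show "norm (1 - ee (of_int (v $ i) * ?\<theta> i)) \<le> 2 * pi * (sqrt l * \<omega>)" .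
    qed
    finally show ?thesis by (simp add: mult_ac)
  qed
  have "1 - mult_avg q l \<xi> = (\<Sum>v\<in>?S. 1 - ee (\<Sum>i\<in>UNIV. of_int (v $ i) * ?\<theta> i)) / of_nat (card ?S)"
    using assms(1) by (simp add: mult_avg_def esum_def sum_subtractf diff_divide_distrib)
  also have "norm \<dots> = norm (\<Sum>v\<in>?S. 1 - ee (\<Sum>i\<in>UNIV. of_int (v $ i) * ?\<theta> i)) / card ?S"
    by (simp add: norm_divide)
  also have "\<dots> \<le> (\<Sum>v\<in>?S. 2 * pi * CARD('d) * sqrt l * \<omega>) / card ?S"
    by (intro divide_right_mono order.trans[OF norm_sum] sum_mono pt) auto
  also have "\<dots> = 2 * pi * CARD('d) * sqrt l * \<omega>" using assms(1) by simp
  finally show ?thesis .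
qed

lemma Re_ge_of_norm_one_minus: "norm (1 - z) \<le> \<epsilon> \<Longrightarrow> Re z \<ge> 1 - \<epsilon>"
  using complex_Re_le_cmod[of "1 - z"] by simp

lemma exists_nat_sqrt: "\<exists>N::nat. N\<^sup>2 \<le> l \<and> l < (N + 1)\<^sup>2"
proof -
  define N where "N = nat \<lfloor>sqrt (real l)\<rfloor>"
  have a: "real N \<le> sqrt (real l)" and b: "sqrt (real l) < real N + 1" unfolding N_def by (auto simp: of_nat_floor)
  have "(real N)\<^sup>2 \<le> (sqrt (real l))\<^sup>2" by (rule power_mono[OF a]) simp
  then have 1: "real (N\<^sup>2) \<le> real l" by simp
  have "(sqrt (real l))\<^sup>2 < (real N + 1)\<^sup>2" by (rule power_strict_mono[OF b]) simp_all
  then have "real l < real ((N + 1)\<^sup>2)" by (simp add: add.commute)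
  with 1 have "real (N\<^sup>2) \<le> real l \<and> real l < real ((N + 1)\<^sup>2)" by blast
  then show ?thesis by (intro exI[of _ N]) (simp only: of_nat_le_iff of_nat_less_iff)
qed

text \<open>
  \<open>esum_decay\<close> normalised by the size of the sphere, which is where the lower bound for spheres is
  needed.
\<close>

lemma sphere_dichotomy:
  assumes d: "CARD('d::finite) \<ge> 5" and \<epsilon>: "\<epsilon> > 0"
  shows "\<exists>(Q::nat) (K::real) (L::nat). Q \<ge> 1 \<and> K > 0 \<and> L \<ge> 1 \<and> (\<forall>l\<ge>L. card (lattice_sphere l :: (int ^ 'd) set) > 0) \<and>
     (\<forall>l\<ge>L. \<forall>(q::nat) (\<xi>::'d \<Rightarrow> real). norm (mult_avg q l \<xi>) > \<epsilon> \<longrightarrow>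
     (\<exists>q'. 1 \<le> q' \<and> q' \<le> Q \<and> (\<forall>i. nint (real q' * (real q * \<xi> i)) \<le> K / sqrt l)))"
proof -
  obtain c :: real and N0 :: nat where c: "c > 0" "N0 \<ge> 1"
    "\<And>N l. N \<ge> N0 \<Longrightarrow> N\<^sup>2 \<le> l \<Longrightarrow> l < (N + 1)\<^sup>2 \<Longrightarrow> c * real N ^ (CARD('d) - 2) \<le> real (card (lattice_sphere l :: (int ^ 'd) set))"
    using card_sphere_ge[OF d] by blast
  have "\<epsilon> * c > 0" using c \<epsilon> by simp
  from esum_decay[OF d this] obtain Q :: nat and K :: real where QK: "Q \<ge> 1" "K > 0"
    "\<And>N l (\<xi>::'d \<Rightarrow> real). N \<ge> Q \<Longrightarrow> N\<^sup>2 \<le> l \<Longrightarrow> l < (N + 1)\<^sup>2 \<Longrightarrow> norm (esum l \<xi>) > \<epsilon> * c * real N ^ (CARD('d) - 2) \<Longrightarrow>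
     (\<exists>q. 1 \<le> q \<and> q \<le> Q \<and> (\<forall>i. nint (real q * \<xi> i) \<le> K / N))" by blast
  define L where "L = (max N0 Q)\<^sup>2"
  have L1: "L \<ge> 1" using c(2) unfolding L_def by (simp add: max_def)
  have pos: "card (lattice_sphere l :: (int ^ 'd) set) > 0 \<and> (\<forall>(q::nat) (\<xi>::'d \<Rightarrow> real). norm (mult_avg q l \<xi>) > \<epsilon> \<longrightarrow>
     (\<exists>q'. 1 \<le> q' \<and> q' \<le> Q \<and> (\<forall>i. nint (real q' * (real q * \<xi> i)) \<le> (2 * K) / sqrt l)))" if l: "l \<ge> L" for l
  proof -
    obtain N where N: "N\<^sup>2 \<le> l" "l < (N + 1)\<^sup>2" using exists_nat_sqrt by blast
    have "(max N0 Q)\<^sup>2 < (N + 1)\<^sup>2" using N(2) l by (simp add: L_def)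
    then have "max N0 Q < N + 1" by (rule power_less_imp_less_base) simp
    then have NN: "N \<ge> N0" "N \<ge> Q" by auto
    have Npos: "real N > 0" using NN(2) QK(1) by simp
    note cN = c(3)[OF NN(1) N]
    have "0 < c * real N ^ (CARD('d) - 2)" using c(1) Npos by simp
    then have p: "real (card (lattice_sphere l :: (int ^ 'd) set)) > 0" using cN by linarith
    have sq: "sqrt l \<le> 2 * N"
    proof -
      have "real l < real ((N + 1)\<^sup>2)" using N(2) by (simp only: of_nat_less_iff)
      also have "\<dots> \<le> real ((2 * N)\<^sup>2)" using Npos by (simp only: of_nat_le_iff) (intro power_mono, auto)
      finally have "real l \<le> (2 * real N)\<^sup>2" by simp
      then show ?thesis by (intro real_le_lsqrt) auto
    qed
    have lpos: "real l > 0" using l L1 by simp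
    have KN: "K / N \<le> 2 * K / sqrt l"
    proof -
      have "K * sqrt l \<le> K * (2 * N)" using sq QK(2) by (intro mult_left_mono) auto
      then show ?thesis using Npos lpos by (simp add: field_simps)
    qed
    have "\<exists>q'. 1 \<le> q' \<and> q' \<le> Q \<and> (\<forall>i. nint (real q' * (real q * \<xi> i)) \<le> (2 * K) / sqrt l)"
      if big: "norm (mult_avg q l \<xi>) > \<epsilon>" for q :: nat and \<xi> :: "'d \<Rightarrow> real"
    proof -
      have "\<epsilon> * real (card (lattice_sphere l :: (int ^ 'd) set)) < norm (esum l (\<lambda>i. real q * \<xi> i))"
        using big p by (simp add: mult_avg_def norm_divide less_divide_eq)
      moreover have "\<epsilon> * (c * real N ^ (CARD('d) - 2)) \<le> \<epsilon> * real (card (lattice_sphere l :: (int ^ 'd) set))"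
        using cN \<epsilon> by (intro mult_left_mono) auto
      ultimately have "norm (esum l (\<lambda>i. real q * \<xi> i)) > \<epsilon> * c * real N ^ (CARD('d) - 2)" by (simp add: mult.assoc)
      from QK(3)[OF NN(2) N this] show ?thesis using KN by (meson order_trans)
    qed
    then show ?thesis using p by simp
  qed
  show ?thesis
  proof (intro exI conjI)
    show "Q \<ge> 1" "2 * K > 0" "L \<ge> 1" using QK L1 by auto
  qed (use pos in blast)+
qed

text \<open>
  Up to the first multiplier that is not small, all are at least \<open>-\<epsilon>\<close>; that one is at least \<open>-1\<close>; and all
  later ones have nonnegative real part.
\<close>

lemma Re_sum_mult_avg_ge:
  fixes m :: "nat \<Rightarrow> complex"
  assumes "\<epsilon> \<ge> 0" "\<epsilon> \<le> 1" "\<And>j. norm (m j) \<le> 1"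
    and dich: "\<And>j j'. j < j' \<Longrightarrow> j' \<le> J \<Longrightarrow> norm (m j) > \<epsilon> \<Longrightarrow> norm (1 - m j') \<le> 1"
  shows "(\<Sum>j=0..J. Re (m j)) \<ge> - 1 - \<epsilon> * (J + 1)"
proof (cases "\<exists>j\<le>J. norm (m j) > \<epsilon>")
  case False
  then have "Re (m j) \<ge> - \<epsilon>" if "j \<le> J" for j using that abs_Re_le_cmod[of "m j"] by force
  then have "(\<Sum>j=0..J. - \<epsilon>) \<le> (\<Sum>j=0..J. Re (m j))" by (intro sum_mono) auto
  then show ?thesis by (simp add: mult.commute add.commute)
next
  case True
  define k where "k = (LEAST j. j \<le> J \<and> norm (m j) > \<epsilon>)"
  have k: "k \<le> J" "norm (m k) > \<epsilon>" using True LeastI_ex[of "\<lambda>j. j \<le> J \<and> norm (m j) > \<epsilon>"] by (auto simp: k_def)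
  have before: "norm (m j) \<le> \<epsilon>" if "j < k" for j
    using not_less_Least[of j "\<lambda>j. j \<le> J \<and> norm (m j) > \<epsilon>"] that k(1) by (auto simp: k_def)
  have "(if j = k then - 1 else - \<epsilon>) \<le> Re (m j)" if "j \<le> J" for j
  proof -
    consider "j < k" | "j = k" | "k < j" by linarith
    then show ?thesis
    proof cases
      case 1 then show ?thesis using before[of j] abs_Re_le_cmod[of "m j"] by auto
    next
      case 2 then show ?thesis using assms(3)[of j] abs_Re_le_cmod[of "m j"] by auto
    next
      case 3
      then have "Re (m j) \<ge> 1 - 1" using dich[OF 3 that k(2)] by (intro Re_ge_of_norm_one_minus)
      then show ?thesis using assms(1) 3 by simp
    qed
  qed
  then have "(\<Sum>j=0..J. if j = k then - 1 else - \<epsilon>) \<le> (\<Sum>j=0..J. Re (m j))" by (intro sum_mono) auto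
  moreover have "(\<Sum>j=0..J. if j = k then - 1 else - \<epsilon>) \<ge> (\<Sum>j=0..J. (if j = k then - 1 else 0) + - \<epsilon>)"
    using assms(1) by (intro sum_mono) auto
  moreover have "(\<Sum>j=0..J. (if j = k then - 1 else 0) + - \<epsilon>) = - 1 - \<epsilon> * (J + 1)"
  proof -
    have "(\<Sum>j=0..J. if j = k then - 1 else 0) = (- 1 :: real)" using k(1) by simp
    then show ?thesis unfolding sum.distrib by (simp add: algebra_simps)
  qed
  ultimately show ?thesis by linarith
qed

section \<open>Supersaturation for dense sets\<close>

lemma card_cube: "card (cube N :: (int ^ 'd::finite) set) = (2 * N + 1) ^ CARD('d)"
proof -
  have "(cube N :: (int ^ 'd) set) = {v. \<forall>i. v $ i \<in> {- int N..int N}}"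
    by (auto simp: cube_def abs_le_iff minus_le_iff)
  then have "card (cube N :: (int ^ 'd) set) = (\<Prod>i\<in>(UNIV :: 'd set). card {- int N..int N})"
    by (simp only:) (rule card_vec_box, simp)
  also have "card {- int N..int N} = 2 * N + 1" by simp
  finally show ?thesis by simp
qed

lemma ft_box: "ft (freqs R) \<xi> = (\<Prod>i\<in>UNIV. \<Sum>n\<in>{0..<int R}. ee (of_int n * \<xi> i))"
proof -
  have "ft (freqs R) \<xi> = (\<Sum>v\<in>freqs R. \<Prod>i\<in>UNIV. ee (of_int (v $ i) * \<xi> i))"
    by (simp add: ft_def dotr_def ee_sum)
  also have "\<dots> = (\<Prod>i\<in>UNIV. \<Sum>n\<in>{0..<int R}. ee (of_int n * \<xi> i))"
    unfolding freqs_def by (rule prod_sum_vec[symmetric]) auto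
  finally show ?thesis .
qed

text \<open>
  The cutoff is sharp, so the decay is only linear in \<open>1 / nint x\<close>. This is enough, as the box transform
  only has to locate its own large values.
\<close>

lemma norm_interval_sum:
  shows "norm (\<Sum>n\<in>{0..<int R}. ee (of_int n * x)) \<le> R"
    and "nint x * norm (\<Sum>n\<in>{0..<int R}. ee (of_int n * x)) \<le> 1"
proof -
  define S where "S = (\<Sum>n\<in>{0..<int R}. ee (of_int n * x))"
  have "norm S \<le> (\<Sum>n\<in>{0..<int R}. 1)" unfolding S_def by (rule order.trans[OF norm_sum]) simp
  then show "norm (\<Sum>n\<in>{0..<int R}. ee (of_int n * x)) \<le> R" by (simp add: S_def)
  have zk: "ee (real n * x) = ee x ^ n" for n
    by (induction n) (auto simp: ee_add distrib_right)
  have "S = (\<Sum>n<R. ee x ^ n)"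
    unfolding S_def zk[symmetric] by (rule sum.reindex_bij_witness[of _ int nat]) auto
  then have "(1 - ee x) * S = 1 - ee x ^ R" by (simp add: one_diff_power_eq)
  then have "norm (1 - ee x) * norm S = norm (1 - ee x ^ R)" by (metis norm_mult)
  also have "\<dots> \<le> 2" by (rule order.trans[OF norm_triangle_ineq4]) (simp add: norm_power)
  finally have "norm (1 - ee x) * norm S \<le> 2" .
  moreover have "2 * nint x * norm S \<le> norm (1 - ee x) * norm S"
    by (intro mult_right_mono norm_one_minus_ee_ge) auto
  ultimately show "nint x * norm (\<Sum>n\<in>{0..<int R}. ee (of_int n * x)) \<le> 1" by (simp add: S_def)
qed

lemma norm_ft_box_le:
  fixes \<xi> :: "'d::finite \<Rightarrow> real"
  shows "norm (ft (freqs R) \<xi>) \<le> real R ^ CARD('d)"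
proof -
  have "norm (ft (freqs R) \<xi>) \<le> (\<Prod>i\<in>(UNIV::'d set). real R)"
    unfolding ft_box prod_norm[symmetric] by (intro prod_mono) (auto simp: norm_interval_sum)
  then show ?thesis by simp
qed

lemma ft_box_large:
  fixes \<xi> :: "'d::finite \<Rightarrow> real"
  assumes "R > 0" "\<eta> > 0" "norm (ft (freqs R) \<xi>) > \<eta> * real R ^ CARD('d)"
  shows "nint (\<xi> i) \<le> 1 / (\<eta> * R)"
proof -
  let ?s = "\<lambda>i. norm (\<Sum>n\<in>{0..<int R}. ee (of_int n * \<xi> i))"
  have "norm (ft (freqs R) \<xi>) = ?s i * (\<Prod>j\<in>UNIV - {i}. ?s j)"
    unfolding ft_box prod_norm[symmetric] by (rule prod.remove) auto
  also have "\<dots> \<le> ?s i * (\<Prod>j\<in>UNIV - {i}. real R)"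
    by (intro mult_left_mono prod_mono) (auto simp: norm_interval_sum)
  also have "\<dots> = ?s i * real R ^ (CARD('d) - 1)" by simp
  finally have "\<eta> * real R ^ CARD('d) < ?s i * real R ^ (CARD('d) - 1)" using assms(3) by linarith
  moreover have "real R ^ CARD('d) = real R * real R ^ (CARD('d) - 1)"
    by (metis mult.commute power_minus_mult zero_less_card_finite)
  ultimately have "\<eta> * R < ?s i" using assms(1) by (simp add: mult.assoc[symmetric])
  then have "nint (\<xi> i) * (\<eta> * R) \<le> nint (\<xi> i) * ?s i" by (intro mult_left_mono) auto
  also have "\<dots> \<le> 1" by (rule norm_interval_sum)
  finally show ?thesis using assms(1,2) by (simp add: field_simps)
qed

lemma ft_dilated_sphere:
  fixes \<xi> :: "'d::finite \<Rightarrow> real"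
  assumes "q > 0"
  shows "ft ((\<lambda>v. int q *s v) ` lattice_sphere l) \<xi> = esum l (\<lambda>i. real q * \<xi> i)"
proof -
  have inj: "inj_on (\<lambda>v::int^'d. int q *s v) (lattice_sphere l)"
    using assms by (auto simp: inj_on_def vec_eq_iff)
  show ?thesis unfolding ft_def esum_def
    by (subst sum.reindex[OF inj]) (simp add: dotr_def mult_ac)
qed

lemma card_sphere_pairs:
  fixes A :: "(int ^ 'd::finite) set"
  assumes "q > 0" "finite A" "card (lattice_sphere l :: (int ^ 'd) set) > 0"
  shows "real (card {(x,y,v). x \<in> A \<and> y \<in> A \<and> v \<in> (\<lambda>v. int q *s v) ` lattice_sphere l \<and> x + v = y})
     = card (lattice_sphere l :: (int ^ 'd) set) * (\<Sum>x\<in>A. spherical_avg q l (indicat_real A) x)"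
proof -
  let ?S = "lattice_sphere l :: (int ^ 'd) set"
  have fin: "finite ?S" by (rule finite_lattice_sphere)
  have inj: "int q *s v = int q *s w \<longleftrightarrow> v = w" for v w :: "int ^ 'd"
    using assms(1) by (auto simp: vec_eq_iff)
  let ?g = "\<lambda>(x, v). (x, x + int q *s v, int q *s v)"
  let ?T = "SIGMA x:A. {v\<in>?S. x + int q *s v \<in> A}"
  have inj_g: "inj_on ?g ?T"
    by (rule inj_onI) (auto simp only: inj prod.inject split: prod.splits)
  have img: "{(x,y,v). x \<in> A \<and> y \<in> A \<and> v \<in> (\<lambda>v. int q *s v) ` ?S \<and> x + v = y} = ?g ` ?T"
  proof (intro equalityI subsetI)
    fix t assume "t \<in> {(x,y,v). x \<in> A \<and> y \<in> A \<and> v \<in> (\<lambda>v. int q *s v) ` ?S \<and> x + v = y}"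
    then obtain x v where t: "t = (x, x + int q *s v, int q *s v)" "x \<in> A" "v \<in> ?S" "x + int q *s v \<in> A" by blast
    then have "(x, v) \<in> ?T" by blast
    then show "t \<in> ?g ` ?T" using t(1) by (intro image_eqI[of _ _ "(x, v)"]) simp_all
  next
    fix t assume "t \<in> ?g ` ?T"
    then obtain x v where "t = (x, x + int q *s v, int q *s v)" "x \<in> A" "v \<in> ?S" "x + int q *s v \<in> A" by auto
    then show "t \<in> {(x,y,v). x \<in> A \<and> y \<in> A \<and> v \<in> (\<lambda>v. int q *s v) ` ?S \<and> x + v = y}" by blast
  qed
  have "card {(x,y,v). x \<in> A \<and> y \<in> A \<and> v \<in> (\<lambda>v. int q *s v) ` ?S \<and> x + v = y} = card ?T"
    unfolding img by (rule card_image[OF inj_g])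
  also have "\<dots> = (\<Sum>x\<in>A. card {v\<in>?S. x + int q *s v \<in> A})"
    using fin assms(2) by (intro card_SigmaI) auto
  finally have "real (card {(x,y,v). x \<in> A \<and> y \<in> A \<and> v \<in> (\<lambda>v. int q *s v) ` ?S \<and> x + v = y})
     = (\<Sum>x\<in>A. real (card {v\<in>?S. x + int q *s v \<in> A}))" by simp
  also have "\<dots> = (\<Sum>x\<in>A. card ?S * spherical_avg q l (indicat_real A) x)"
  proof (intro sum.cong refl)
    fix x
    have "(\<Sum>v\<in>?S. indicat_real A (x + int q *s v)) = real (card {v\<in>?S. x + int q *s v \<in> A})"
    proof -
      have "(\<Sum>v\<in>?S. indicat_real A (x + int q *s v)) = (\<Sum>v\<in>?S. if x + int q *s v \<in> A then 1 else 0)"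
        by (intro sum.cong refl) (simp add: indicator_def)
      also have "\<dots> = (\<Sum>v\<in>{v\<in>?S. x + int q *s v \<in> A}. 1)" by (rule sum.inter_filter[OF fin, symmetric])
      finally show ?thesis by simp
    qed
    then show "real (card {v\<in>?S. x + int q *s v \<in> A}) = card ?S * spherical_avg q l (indicat_real A) x"
      using assms(3) by (simp add: spherical_avg_def)
  qed
  finally show ?thesis by (simp add: sum_distrib_left)
qed

lemma sum_norm_ft_squared:
  fixes A :: "(int ^ 'd::finite) set"
  assumes "P > 0" "finite A" "\<And>x y i. x \<in> A \<Longrightarrow> y \<in> A \<Longrightarrow> \<bar>x $ i - y $ i\<bar> < int P"
  shows "(\<Sum>k\<in>freqs P. (norm (ft A (fr P k)))\<^sup>2) = real (P ^ CARD('d)) * card A"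
proof -
  have "complex_of_real (\<Sum>k\<in>freqs P. (norm (ft A (fr P k)))\<^sup>2) = (\<Sum>k\<in>freqs P. of_real ((norm (ft A (fr P k)))\<^sup>2) * ft {0} (fr P k))"
    by (simp add: ft_def dotr_def)
  also have "\<dots> = of_nat (P ^ CARD('d)) * of_nat (card {(x,y,v). x \<in> A \<and> y \<in> A \<and> v \<in> {0} \<and> x + v = y})"
    by (rule sum_ft_squared_times) (use assms in auto)
  also have "{(x,y,v). x \<in> A \<and> y \<in> A \<and> v \<in> {0} \<and> x + v = y} = (\<lambda>x. (x, x, 0)) ` A" by auto
  also have "card \<dots> = card A" by (rule card_image) (auto simp: inj_on_def)
  also have "(of_nat :: nat \<Rightarrow> complex) (P ^ CARD('d)) * of_nat (card A) = complex_of_real (real (P ^ CARD('d)) * card A)"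
    by (simp only: of_real_mult of_real_of_nat_eq)
  finally show ?thesis by (simp only: of_real_eq_iff)
qed

text \<open>
  A pointwise lower bound for the sum of multipliers, in terms of the box transform, becomes a lower bound
  for the number of pairs by Parseval. The box term contributes the number of coincidences
  \<open>x + v = y + w\<close> with \<open>v\<close>, \<open>w\<close> in the box, which Cauchy-Schwarz bounds from below because all these
  sums lie in the slightly larger cube \<open>cube (N + R)\<close>.
\<close>

lemma spectral_pair_bound:
  fixes A :: "(int ^ 'd::finite) set" and q l :: "nat \<Rightarrow> nat"
  assumes A: "A \<subseteq> cube N" and R: "R > 0"
    and q: "\<And>j. j \<le> J \<Longrightarrow> q j > 0" and l: "\<And>j. j \<le> J \<Longrightarrow> card (lattice_sphere (l j) :: (int ^ 'd) set) > 0"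
    and a: "a \<ge> 0"
    and pt: "\<And>\<xi> :: 'd \<Rightarrow> real. a * (norm (ft (freqs R) \<xi>) / real R ^ CARD('d))\<^sup>2 \<le> (\<Sum>j=0..J. Re (mult_avg (q j) (l j) \<xi>)) + b"
  shows "a * (real (card A))\<^sup>2 / card (cube (N + R) :: (int ^ 'd) set)
      \<le> (\<Sum>x\<in>A. \<Sum>j=0..J. spherical_avg (q j) (l j) (indicat_real A) x) + b * card A"
proof -
  define D where "D = CARD('d)"
  have finA: "finite A" using A finite_cube finite_subset by blast
  have Ai: "\<bar>x $ i\<bar> \<le> int N" if "x \<in> A" for x i using A that by (auto simp: cube_def)
  define V where "V = (\<lambda>j. (\<lambda>v. int (q j) *s v) ` (lattice_sphere (l j) :: (int ^ 'd) set))"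
  have finV: "finite (V j)" for j unfolding V_def by (intro finite_imageI finite_lattice_sphere)
  define Y where "Y = (\<Sum>j=0..J. q j * l j)"
  \<comment> \<open>The torus is so large that no difference in question wraps around.\<close>
  define P where "P = 1 + 2 * N + 2 * R + Y"
  have P0: "P > 0" by (simp add: P_def)
  have Vi: "\<bar>v $ i\<bar> \<le> int Y" if v: "v \<in> V j" "j \<le> J" for v i j
  proof -
    obtain w where w: "w \<in> lattice_sphere (l j)" "v = int (q j) *s w" using v by (auto simp: V_def)
    have "\<bar>w $ i\<bar> \<le> (w $ i)\<^sup>2" using self_le_power[of "\<bar>w $ i\<bar>" 2] by (cases "w $ i = 0") auto
    also have "\<dots> \<le> int (l j)" using component_squared_le_nsq[of w i] w(1) by (simp add: lattice_sphere_iff)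
    finally have "int (q j) * \<bar>w $ i\<bar> \<le> int (q j) * int (l j)" by (intro mult_left_mono) auto
    then have "\<bar>v $ i\<bar> \<le> int (q j * l j)" by (simp add: w(2) abs_mult)
    also have "q j * l j \<le> Y" unfolding Y_def using v(2) by (intro member_le_sum) auto
    finally show ?thesis by simp
  qed
  have diff: "\<bar>x $ i - y $ i\<bar> \<le> 2 * int N" if "x \<in> A" "y \<in> A" for x y i using Ai[OF that(1), of i] Ai[OF that(2), of i] by linarith
  define H where "H = (\<lambda>k. (norm (ft A (fr P k)))\<^sup>2)"
  define PD where "PD = real (P ^ D)"
  have PD0: "PD > 0" using P0 by (simp add: PD_def)
  have 1: "(\<Sum>k\<in>freqs P. H k) = PD * card A"
    unfolding H_def PD_def D_def
  proof (rule sum_norm_ft_squared[OF P0 finA])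
    show "\<bar>x $ i - y $ i\<bar> < int P" if "x \<in> A" "y \<in> A" for x y i
      using diff[OF that, of i] by (simp add: P_def)
  qed
  have 2: "(\<Sum>k\<in>freqs P. H k * Re (mult_avg (q j) (l j) (fr P k))) = PD * (\<Sum>x\<in>A. spherical_avg (q j) (l j) (indicat_real A) x)"
    if j: "j \<le> J" for j
  proof -
    let ?n = "real (card (lattice_sphere (l j) :: (int ^ 'd) set))"
    have n0: "?n > 0" using l[OF j] by simp
    have m: "mult_avg (q j) (l j) \<xi> = ft (V j) \<xi> / of_real ?n" for \<xi>
      unfolding mult_avg_def V_def ft_dilated_sphere[OF q[OF j]] by simp
    have "(\<Sum>k\<in>freqs P. H k * Re (mult_avg (q j) (l j) (fr P k))) = Re (\<Sum>k\<in>freqs P. of_real (H k) * ft (V j) (fr P k)) / ?n"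
      unfolding m by (simp add: sum_divide_distrib)
    also have "(\<Sum>k\<in>freqs P. of_real (H k) * ft (V j) (fr P k)) = of_nat (P ^ D) * of_nat (card {(x,y,v). x \<in> A \<and> y \<in> A \<and> v \<in> V j \<and> x + v = y})"
      unfolding H_def D_def
    proof (rule sum_ft_squared_times[OF P0 finA finV])
      show "\<bar>x $ i - y $ i + v $ i\<bar> < int P" if "x \<in> A" "y \<in> A" "v \<in> V j" for x y v i
        using diff[OF that(1,2), of i] Vi[OF that(3) j, of i] by (simp add: P_def)
    qed
    also have "Re \<dots> = PD * real (card {(x,y,v). x \<in> A \<and> y \<in> A \<and> v \<in> V j \<and> x + v = y})"
      unfolding PD_def by simp
    also have "real (card {(x,y,v). x \<in> A \<and> y \<in> A \<and> v \<in> V j \<and> x + v = y}) = ?n * (\<Sum>x\<in>A. spherical_avg (q j) (l j) (indicat_real A) x)"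
      unfolding V_def by (rule card_sphere_pairs[OF q[OF j] finA l[OF j]])
    finally show ?thesis using n0 by simp
  qed
  have 3: "PD * ((real (card A))\<^sup>2 / card (cube (N + R) :: (int ^ 'd) set)) \<le> (\<Sum>k\<in>freqs P. H k * (norm (ft (freqs R) (fr P k)) / real R ^ D)\<^sup>2)"
  proof -
    let ?Q = "cube (N + R) :: (int ^ 'd) set"
    let ?X = "{(x,y,v,w). x \<in> A \<and> y \<in> A \<and> v \<in> freqs R \<and> w \<in> freqs R \<and> x + v = y + w}"
    have cR: "card (freqs R :: (int ^ 'd) set) = R ^ D" unfolding freqs_def D_def by (subst card_vec_box) auto
    have Q0: "card ?Q > 0" by (simp add: card_cube)
    have "(real (card A) * real (R ^ D))\<^sup>2 \<le> real (card ?Q) * real (card ?X)"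
      unfolding cR[symmetric]
    proof (rule card_additive_quadruples_ge[OF finA finite_freqs finite_cube])
      show "x + v \<in> ?Q" if "x \<in> A" "v \<in> freqs R" for x v
        unfolding cube_def
      proof (intro CollectI allI)
        fix i
        have "v $ i \<in> {0..<int R}" using that(2) by (simp add: freqs_def)
        then show "\<bar>(x + v) $ i\<bar> \<le> int (N + R)" using Ai[OF that(1), of i] by auto
      qed
    qed
    then have "(real (card A))\<^sup>2 / card ?Q \<le> real (card ?X) / (real R ^ D)\<^sup>2"
      using Q0 R by (simp add: field_simps power_mult_distrib)
    then have "PD * ((real (card A))\<^sup>2 / card ?Q) \<le> PD * (real (card ?X) / (real R ^ D)\<^sup>2)"
      using PD0 by (intro mult_left_mono) auto
    also have "PD * real (card ?X) = (\<Sum>k\<in>freqs P. H k * (norm (ft (freqs R) (fr P k)))\<^sup>2)"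
      unfolding H_def PD_def D_def
    proof (rule sum_ft_squared_times_squared[OF P0 finA finite_freqs, symmetric])
      show "\<bar>x $ i - y $ i + (v $ i - w $ i)\<bar> < int P" if "x \<in> A" "y \<in> A" "v \<in> freqs R" "w \<in> freqs R" for x y v w i
      proof -
        have "v $ i \<in> {0..<int R}" "w $ i \<in> {0..<int R}" using that by (auto simp: freqs_def)
        then have "\<bar>v $ i - w $ i\<bar> \<le> int R" by auto
        then show ?thesis using diff[OF that(1,2), of i] by (simp add: P_def)
      qed
    qed
    then have "PD * (real (card ?X) / (real R ^ D)\<^sup>2) = (\<Sum>k\<in>freqs P. H k * (norm (ft (freqs R) (fr P k)))\<^sup>2) / (real R ^ D)\<^sup>2"
      by simp
    finally show ?thesis by (simp add: sum_divide_distrib power_divide)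
  qed
  have "PD * (a * (real (card A))\<^sup>2 / card (cube (N + R) :: (int ^ 'd) set)) = a * (PD * ((real (card A))\<^sup>2 / card (cube (N + R) :: (int ^ 'd) set)))" by simp
  also have "\<dots> \<le> a * (\<Sum>k\<in>freqs P. H k * (norm (ft (freqs R) (fr P k)) / real R ^ D)\<^sup>2)"
    by (intro mult_left_mono 3 a)
  also have "\<dots> = (\<Sum>k\<in>freqs P. H k * (a * (norm (ft (freqs R) (fr P k)) / real R ^ D)\<^sup>2))"
    by (simp add: sum_distrib_left mult_ac)
  also have "\<dots> \<le> (\<Sum>k\<in>freqs P. H k * ((\<Sum>j=0..J. Re (mult_avg (q j) (l j) (fr P k))) + b))"
    unfolding D_def by (intro sum_mono mult_left_mono pt) (simp add: H_def)
  also have "\<dots> = (\<Sum>j=0..J. \<Sum>k\<in>freqs P. H k * Re (mult_avg (q j) (l j) (fr P k))) + b * (\<Sum>k\<in>freqs P. H k)"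
  proof -
    have "(\<Sum>k\<in>freqs P. H k * ((\<Sum>j=0..J. Re (mult_avg (q j) (l j) (fr P k))) + b))
      = (\<Sum>k\<in>freqs P. \<Sum>j=0..J. H k * Re (mult_avg (q j) (l j) (fr P k))) + (\<Sum>k\<in>freqs P. b * H k)"
      by (simp add: distrib_left sum.distrib sum_distrib_left mult.commute)
    also have "(\<Sum>k\<in>freqs P. \<Sum>j=0..J. H k * Re (mult_avg (q j) (l j) (fr P k))) = (\<Sum>j=0..J. \<Sum>k\<in>freqs P. H k * Re (mult_avg (q j) (l j) (fr P k)))"
      by (rule sum.swap)
    finally show ?thesis by (simp add: sum_distrib_left)
  qed
  also have "(\<Sum>j=0..J. \<Sum>k\<in>freqs P. H k * Re (mult_avg (q j) (l j) (fr P k))) = (\<Sum>j=0..J. PD * (\<Sum>x\<in>A. spherical_avg (q j) (l j) (indicat_real A) x))"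
    by (intro sum.cong refl 2) auto
  also have "\<dots> = PD * (\<Sum>j=0..J. \<Sum>x\<in>A. spherical_avg (q j) (l j) (indicat_real A) x)" by (simp add: sum_distrib_left)
  also have "(\<Sum>j=0..J. \<Sum>x\<in>A. spherical_avg (q j) (l j) (indicat_real A) x) = (\<Sum>x\<in>A. \<Sum>j=0..J. spherical_avg (q j) (l j) (indicat_real A) x)"
    by (rule sum.swap)
  finally have "PD * (a * (real (card A))\<^sup>2 / card (cube (N + R) :: (int ^ 'd) set)) \<le>
     PD * ((\<Sum>x\<in>A. \<Sum>j=0..J. spherical_avg (q j) (l j) (indicat_real A) x) + b * card A)"
    by (simp add: 1 algebra_simps)
  then show ?thesis using PD0 by (rule mult_left_le_imp_le)
qed

text \<open>
  The pointwise bound required by \<open>spectral_pair_bound\<close> distinguishes two kinds of frequencies. Where the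
  transform of the box is not small, the frequency is within \<open>\<omega> / sqrt l\<close> of an integer point and all
  \<open>J + 1\<close> multipliers are at least \<open>1 - \<epsilon>\<close>. Elsewhere the sum of the multipliers is at least
  \<open>- 1 - \<epsilon> (J + 1)\<close> by \<open>Re_sum_mult_avg_ge\<close>. A density of \<open>\<beta>\<close> in the cube \<open>cube (N + R)\<close> then yields a gain of
  at least \<open>3/4 \<beta> (J + 1) \<ge> 6\<close> against a loss of 1.
\<close>

theorem supersaturation:
  fixes \<alpha> :: real
  assumes d: "CARD('d::finite) \<ge> 5" and \<alpha>: "0 < \<alpha>" "\<alpha> \<le> 1"
  shows "\<exists>(r::nat) (s::nat) (J::nat) (L::nat) (c2::real). 2 \<le> r \<and> r < s \<and> 1 \<le> L \<and> 0 < c2 \<and>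
    (\<forall>(N::nat) (l::nat) (A::(int^'d) set). L \<le> l \<longrightarrow> l \<le> c2 * (real N)\<^sup>2 \<longrightarrow> A \<subseteq> cube N \<longrightarrow>
      \<alpha> * card (cube N :: (int ^ 'd) set) \<le> card A \<longrightarrow>
      real (card A) \<le> (\<Sum>x\<in>A. \<Sum>j=0..J. spherical_avg (r ^ j) (s ^ (2 * (J - j)) * l) (indicat_real A) x))"
proof -
  define D where "D = CARD('d)"
  have D0: "real D > 0" using d by (simp add: D_def)
  define \<beta> where "\<beta> = \<alpha> / 2 ^ D"
  have \<beta>: "0 < \<beta>" "\<beta> \<le> 1"
  proof -
    have "(1::real) \<le> 2 ^ D" by (rule one_le_power) simp
    with \<alpha>(2) have "\<alpha> \<le> 2 ^ D" by (rule order.trans)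
    then show "\<beta> \<le> 1" by (simp add: \<beta>_def divide_le_eq)
  qed (simp add: \<beta>_def \<alpha>)
  define \<epsilon> where "\<epsilon> = \<beta> / 16"
  have \<epsilon>: "0 < \<epsilon>" "\<epsilon> \<le> 1/16" using \<beta> by (auto simp: \<epsilon>_def)
  define J where "J = nat \<lceil>8 / \<beta>\<rceil>"
  define J1 where "J1 = real J + 1"
  have J1: "J1 * \<beta> \<ge> 8" "J1 > 0"
  proof -
    have "8 / \<beta> \<le> J1" unfolding J1_def J_def by linarith
    then show "J1 * \<beta> \<ge> 8" using \<beta> by (simp add: field_simps)
  qed (simp add: J1_def)
  obtain Q :: nat and K :: real and L :: nat where QKL: "Q \<ge> 1" "K > 0" "L \<ge> 1"
    "\<And>l. l \<ge> L \<Longrightarrow> card (lattice_sphere l :: (int ^ 'd) set) > 0"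
    "\<And>l q (\<xi>::'d \<Rightarrow> real). l \<ge> L \<Longrightarrow> norm (mult_avg q l \<xi>) > \<epsilon> \<Longrightarrow>
     (\<exists>q'. 1 \<le> q' \<and> q' \<le> Q \<and> (\<forall>i. nint (real q' * (real q * \<xi> i)) \<le> K / sqrt l))"
    using sphere_dichotomy[OF d \<epsilon>(1)] by blast
  \<comment> \<open>Every denominator \<open>q' \<le> Q\<close> divides \<open>r\<close>, so multiplication by \<open>r\<close> removes it.\<close>
  define r :: nat where "r = 2 * fact Q"
  have r2: "r \<ge> 2" by (simp add: r_def)
  \<comment> \<open>Passing from \<open>j\<close> to \<open>j + 1\<close> multiplies the distance of the frequency from the integers by at most \<open>r\<close>
    but divides the radius of the sphere by \<open>s\<close>; a factor \<open>r / s\<close> is thus gained, and \<open>s\<close> is chosen to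
    let it absorb the constant \<open>2 \<pi> d K\<close>.\<close>
  define s :: nat where "s = r + 1 + nat \<lceil>2 * pi * D * K * r\<rceil>"
  have rs: "r < s" by (simp add: s_def)
  have sK: "2 * pi * D * K * r \<le> s" unfolding s_def by linarith
  have s0: "real s > 0" using rs by simp
  \<comment> \<open>Within \<open>\<omega> / sqrt l\<close> of an integer point, a sphere vector dilated by \<open>r^j\<close> has length at most
    \<open>s^J sqrt l\<close> and turns the phase by at most \<open>\<epsilon>\<close>.\<close>
  define \<omega> where "\<omega> = \<epsilon> / (2 * pi * D * s ^ J)"
  have \<omega>0: "\<omega> > 0" using \<epsilon> D0 s0 by (simp add: \<omega>_def)
  define \<theta> where "\<theta> = sqrt \<epsilon> * \<omega>"
  have \<theta>0: "\<theta> > 0" using \<epsilon> \<omega>0 by (simp add: \<theta>_def)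
  have \<theta>1: "\<theta> \<le> 1"
  proof -
    have "1 * 1 * 1 * 1 \<le> 2 * pi * D * s ^ J"
      using pi_gt3 D0 rs by (intro mult_mono one_le_power) (auto simp: D_def)
    then have "\<omega> \<le> \<epsilon> / 1" unfolding \<omega>_def using \<epsilon> by (intro divide_left_mono) auto
    then have "\<omega> \<le> 1" using \<epsilon> by simp
    moreover have "sqrt \<epsilon> \<le> 1" using \<epsilon> by simp
    ultimately show ?thesis unfolding \<theta>_def using \<epsilon> \<omega>0 by (intro mult_le_one) auto
  qed
  define c2 where "c2 = (\<theta> / 2)\<^sup>2"
  have c2: "c2 > 0" using \<theta>0 by (simp add: c2_def)
  have "real (card A) \<le> (\<Sum>x\<in>A. \<Sum>j=0..J. spherical_avg (r ^ j) (s ^ (2 * (J - j)) * l) (indicat_real A) x)"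
    if l: "L \<le> l" "l \<le> c2 * (real N)\<^sup>2" and A: "A \<subseteq> cube N" "\<alpha> * card (cube N :: (int ^ 'd) set) \<le> card A"
    for N l :: nat and A :: "(int ^ 'd) set"
  proof -
    have l1: "real l \<ge> 1" using l(1) QKL(3) by linarith
    define lm where "lm = (\<lambda>j. s ^ (2 * (J - j)) * l)"
    have lmL: "lm j \<ge> L" for j
    proof -
      have "1 * l \<le> s ^ (2 * (J - j)) * l" using rs by (intro mult_right_mono one_le_power) auto
      then show ?thesis using l(1) unfolding lm_def by linarith
    qed
    have sqlm: "sqrt (lm j) = s ^ (J - j) * sqrt l" for j
    proof -
      have "real (lm j) = (real s ^ (J - j))\<^sup>2 * real l" unfolding lm_def by (simp add: power_even_eq)
      then show ?thesis by (simp add: real_sqrt_mult)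
    qed
    define m where "m = (\<lambda>(\<xi>::'d \<Rightarrow> real) j. mult_avg (r ^ j) (lm j) \<xi>)"
    \<comment> \<open>The box is a large multiple of the radius \<open>sqrt l\<close>, yet by the choice of \<open>c2\<close> no larger than the cube.\<close>
    define R where "R = nat \<lceil>sqrt l / \<theta>\<rceil>"
    have x1: "1 \<le> sqrt l / \<theta>"
    proof -
      have "1 \<le> sqrt l" using l1 by simp
      then have "\<theta> \<le> sqrt l" using \<theta>1 by linarith
      then show ?thesis using \<theta>0 by (simp add: le_divide_eq)
    qed
    have R: "sqrt l / \<theta> \<le> R" "real R \<le> 2 * (sqrt l / \<theta>)" "R > 0" using x1 unfolding R_def by linarith+
    have RN: "R \<le> N"
    proof -
      have "sqrt l \<le> sqrt (c2 * (real N)\<^sup>2)" using l(2) by (intro real_sqrt_le_mono)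
      also have "\<dots> = (\<theta> / 2) * N" using \<theta>0 by (simp add: c2_def real_sqrt_mult)
      finally have "sqrt l / \<theta> \<le> N / 2" using \<theta>0 by (simp add: field_simps)
      then have "real R \<le> real N" using R(2) by linarith
      then show ?thesis by simp
    qed
    have low: "(\<Sum>j=0..J. Re (m \<xi> j)) \<ge> - 1 - \<epsilon> * J1" for \<xi>
    proof -
      have J1': "J1 = real (J + 1)" by (simp add: J1_def)
      show ?thesis unfolding J1'
    proof (rule Re_sum_mult_avg_ge)
      fix j j' assume jj: "j < j'" "j' \<le> J" "norm (m \<xi> j) > \<epsilon>"
      then obtain q' where q': "1 \<le> q'" "q' \<le> Q" "\<And>i. nint (real q' * (real (r ^ j) * \<xi> i)) \<le> K / sqrt (lm j)"
        using QKL(5)[OF lmL[of j], of "r ^ j" \<xi>] unfolding m_def by blast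
      define e where "e = j' - j"
      have e: "e \<ge> 1" "j' = j + e" "J - j = (J - j') + e" using jj by (auto simp: e_def)
      have "q' dvd r" unfolding r_def using q' by (intro dvd_mult dvd_fact) auto
      also have "r dvd r ^ e" using e(1) by (intro dvd_power) auto
      finally obtain t where t: "r ^ e = q' * t" by (elim dvdE)
      have nn: "nint (real (r ^ j') * \<xi> i) \<le> real r ^ e * (K / (s ^ (J - j) * sqrt l))" for i
      proof -
        have "real (r ^ j') * \<xi> i = of_int (int t) * (real q' * (real (r ^ j) * \<xi> i))"
        proof -
          have "r ^ j' = t * q' * r ^ j" by (simp add: e(2) power_add t mult_ac)
          then have "real (r ^ j') = real t * real q' * real (r ^ j)" by (simp only: of_nat_mult)
          then show ?thesis by simp
        qed
        then have "nint (real (r ^ j') * \<xi> i) \<le> \<bar>of_int (int t)\<bar> * nint (real q' * (real (r ^ j) * \<xi> i))"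
          by (simp only: nint_of_int_mult)
        also have "\<dots> \<le> real t * (K / sqrt (lm j))"
        proof -
          have "\<bar>real_of_int (int t)\<bar> = real t" by simp
          then show ?thesis using q'(3)[of i] by (simp only: mult_left_mono of_nat_0_le_iff)
        qed
        also have "\<dots> \<le> real r ^ e * (K / sqrt (lm j))"
        proof (intro mult_right_mono)
          have "1 * t \<le> r ^ e" unfolding t using q'(1) by (intro mult_right_mono) auto
          then have "real t \<le> real (r ^ e)" by (simp only: of_nat_le_iff mult_1)
          then show "real t \<le> real r ^ e" by simp
        qed (use QKL(2) in auto)
        finally show ?thesis by (simp only: sqlm)
      qed
      have "norm (1 - m \<xi> j') \<le> 2 * pi * CARD('d) * sqrt (lm j') * (real r ^ e * (K / (s ^ (J - j) * sqrt l)))"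
        unfolding m_def by (rule mult_avg_near_1[OF QKL(4)[OF lmL] nn])
      also have "\<dots> = 2 * pi * D * K * (real r ^ e / real s ^ e)"
        using s0 l1 unfolding sqlm e(3) power_add by (simp add: D_def field_simps)
      also have "\<dots> \<le> 2 * pi * D * K * (r / s)"
      proof (intro mult_left_mono)
        have "(real r / s) ^ e \<le> (real r / s) ^ 1" using rs e(1) by (intro power_decreasing) auto
        then show "real r ^ e / real s ^ e \<le> r / s" by (simp add: power_divide)
      qed (use QKL(2) in auto)
      also have "\<dots> \<le> 1" using sK s0 by (simp add: field_simps)
      finally show "norm (1 - m \<xi> j') \<le> 1" .
    qed (use \<epsilon> norm_mult_avg_le_1 in \<open>auto simp: m_def\<close>)
    qed
    have near: "(\<Sum>j=0..J. Re (m \<xi> j)) \<ge> J1 * (1 - \<epsilon>)" if nr: "\<And>i. nint (\<xi> i) \<le> \<omega> / sqrt l" for \<xi>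
    proof -
      have "Re (m \<xi> j) \<ge> 1 - \<epsilon>" if j: "j \<le> J" for j
      proof (rule Re_ge_of_norm_one_minus)
        have nn: "nint (real (r ^ j) * \<xi> i) \<le> real r ^ j * (\<omega> / sqrt l)" for i
        proof -
          have "nint (real (r ^ j) * \<xi> i) \<le> real (r ^ j) * nint (\<xi> i)" using nint_of_int_mult[of "int (r ^ j)" "\<xi> i"] by simp
          also have "\<dots> \<le> real (r ^ j) * (\<omega> / sqrt l)" using nr[of i] by (intro mult_left_mono) auto
          finally show ?thesis by simp
        qed
        have "norm (1 - m \<xi> j) \<le> 2 * pi * CARD('d) * sqrt (lm j) * (real r ^ j * (\<omega> / sqrt l))"
          unfolding m_def by (rule mult_avg_near_1[OF QKL(4)[OF lmL] nn])
        also have "\<dots> = 2 * pi * D * \<omega> * (s ^ (J - j) * real r ^ j)"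
          using l1 unfolding sqlm by (simp add: D_def field_simps)
        also have "\<dots> \<le> 2 * pi * D * \<omega> * (s ^ (J - j) * real s ^ j)"
          using rs \<omega>0 by (intro mult_left_mono power_mono) auto
        also have "s ^ (J - j) * real s ^ j = real s ^ J" using j by (simp flip: power_add)
        also have "2 * pi * D * \<omega> * real s ^ J = \<epsilon>" using D0 s0 by (simp add: \<omega>_def)
        finally show "norm (1 - m \<xi> j) \<le> \<epsilon>" .
      qed
      then have "(\<Sum>j=0..J. 1 - \<epsilon>) \<le> (\<Sum>j=0..J. Re (m \<xi> j))" by (intro sum_mono) auto
      then show ?thesis by (simp add: J1_def add.commute)
    qed
    have pt: "J1 * (1 - \<epsilon>) * (norm (ft (freqs R) \<xi>) / real R ^ CARD('d))\<^sup>2 \<le> (\<Sum>j=0..J. Re (mult_avg (r ^ j) (lm j) \<xi>)) + (1 + 2 * \<epsilon> * J1)" for \<xi> :: "'d \<Rightarrow> real"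
    proof -
      define F where "F = norm (ft (freqs R) \<xi>) / real R ^ CARD('d)"
      have F: "0 \<le> F" "F \<le> 1" using norm_ft_box_le[of R \<xi>] R(3) by (auto simp: F_def divide_le_eq)
      show ?thesis
      proof (cases "F > sqrt \<epsilon>")
        case True
        then have "norm (ft (freqs R) \<xi>) > sqrt \<epsilon> * real R ^ CARD('d)" using R(3) by (simp add: F_def less_divide_eq)
        moreover have "sqrt \<epsilon> > 0" using \<epsilon> by simp
        ultimately have n: "nint (\<xi> i) \<le> 1 / (sqrt \<epsilon> * R)" for i using ft_box_large[OF R(3)] by blast
        have "1 / (sqrt \<epsilon> * R) \<le> \<omega> / sqrt l"
          using R(1,3) \<theta>0 \<epsilon> l1 unfolding \<theta>_def by (simp add: field_simps)
        then have "(\<Sum>j=0..J. Re (m \<xi> j)) \<ge> J1 * (1 - \<epsilon>)" using n by (intro near) (meson order_trans)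
        moreover have "J1 * (1 - \<epsilon>) * F\<^sup>2 \<le> J1 * (1 - \<epsilon>) * 1"
          using F J1 \<epsilon> by (intro mult_left_mono) (auto simp: power_le_one)
        moreover have "0 \<le> \<epsilon> * J1" using \<epsilon> J1 by simp
        ultimately show ?thesis by (simp add: F_def m_def)
      next
        case False
        then have "F\<^sup>2 \<le> (sqrt \<epsilon>)\<^sup>2" using F by (intro power_mono) auto
        then have "F\<^sup>2 \<le> \<epsilon>" using \<epsilon> by simp
        then have "J1 * (1 - \<epsilon>) * F\<^sup>2 \<le> J1 * 1 * \<epsilon>" using J1 \<epsilon> by (intro mult_mono) auto
        then show ?thesis using low[of \<xi>] by (simp add: F_def m_def mult_ac)
      qed
    qed
    have main: "J1 * (1 - \<epsilon>) * (real (card A))\<^sup>2 / card (cube (N + R) :: (int ^ 'd) set)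
      \<le> (\<Sum>x\<in>A. \<Sum>j=0..J. spherical_avg (r ^ j) (lm j) (indicat_real A) x) + (1 + 2 * \<epsilon> * J1) * card A"
      by (rule spectral_pair_bound[OF A(1) R(3) _ QKL(4)[OF lmL] _ pt]) (use r2 J1 \<epsilon> in auto)
    have cub: "\<beta> * card (cube (N + R) :: (int ^ 'd) set) \<le> card A"
    proof -
      have "2 * (N + R) + 1 \<le> 2 * (2 * N + 1)" using RN by simp
      then have "(2 * (N + R) + 1) ^ D \<le> (2 * (2 * N + 1)) ^ D" by (rule power_mono) simp
      then have "card (cube (N + R) :: (int ^ 'd) set) \<le> 2 ^ D * card (cube N :: (int ^ 'd) set)"
        unfolding card_cube D_def by (simp only: power_mult_distrib)
      then have "real (card (cube (N + R) :: (int ^ 'd) set)) \<le> real (2 ^ D * card (cube N :: (int ^ 'd) set))" by (simp only: of_nat_le_iff)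
      then have "\<beta> * card (cube (N + R) :: (int ^ 'd) set) \<le> \<beta> * real (2 ^ D * card (cube N :: (int ^ 'd) set))" using \<beta> by (intro mult_left_mono) auto
      also have "\<dots> = \<alpha> * card (cube N :: (int ^ 'd) set)" by (simp add: \<beta>_def)
      finally show ?thesis using A(2) by linarith
    qed
    have Q0: "real (card (cube (N + R) :: (int ^ 'd) set)) > 0" by (simp add: card_cube)
    have "J1 * (1 - \<epsilon>) * (\<beta> * card A) \<le> J1 * (1 - \<epsilon>) * ((real (card A))\<^sup>2 / card (cube (N + R) :: (int ^ 'd) set))"
    proof (intro mult_left_mono)
      have "\<beta> * card (cube (N + R) :: (int ^ 'd) set) * card A \<le> card A * real (card A)"
        using cub by (intro mult_right_mono) auto
      then show "\<beta> * card A \<le> (real (card A))\<^sup>2 / card (cube (N + R) :: (int ^ 'd) set)"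
        using Q0 by (simp add: field_simps power2_eq_square)
    qed (use J1 \<epsilon> in auto)
    then have "(J1 * (1 - \<epsilon>) * \<beta> - (1 + 2 * \<epsilon> * J1)) * card A
      \<le> (\<Sum>x\<in>A. \<Sum>j=0..J. spherical_avg (r ^ j) (lm j) (indicat_real A) x)"
      using main by (simp add: algebra_simps)
    moreover have "1 \<le> J1 * (1 - \<epsilon>) * \<beta> - (1 + 2 * \<epsilon> * J1)"
    proof -
      have "J1 * (1 - \<epsilon>) * \<beta> - (1 + 2 * \<epsilon> * J1) = (J1 * \<beta>) * (1 - \<epsilon> - 1/8) - 1"
        by (simp add: \<epsilon>_def algebra_simps)
      moreover have "(J1 * \<beta>) * (1 - \<epsilon> - 1/8) \<ge> 8 * (3/4)" using J1 \<epsilon> by (intro mult_mono) auto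
      ultimately show ?thesis by linarith
    qed
    then have "1 * real (card A) \<le> (J1 * (1 - \<epsilon>) * \<beta> - (1 + 2 * \<epsilon> * J1)) * card A" by (intro mult_right_mono) auto
    ultimately show ?thesis by (simp add: lm_def)
  qed
  then show ?thesis using r2 rs QKL(3) c2 by blast
qed

section \<open>Containers in weighted graphs\<close>

text \<open>
  A weighted form of the Kleitman-Winston algorithm. As long as some point \<open>v\<close> of the available set \<open>A\<close> has
  weight at least 1 into \<open>A\<close>, the algorithm asks whether \<open>v\<close> belongs to \<open>B\<close>. If not, \<open>v\<close> is dropped. If
  so, \<open>v\<close> joins the fingerprint, every \<open>x\<close> receives the weight \<open>T v x\<close>, and the points that have
  received \<open>h\<close> or more in total are dropped. The function \<open>g\<close> records what was received before. The answers can be read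
  off from \<open>F\<close> alone, so the final set is a function \<open>C\<close> of \<open>F\<close>. The potential \<open>\<Sum> 2 h - g x\<close> decreases
  by at least 1 with each point of the fingerprint, and this bounds \<open>F\<close>. A point that is dropped after
  receiving \<open>h\<close> still has \<open>2 h - g x \<ge> h\<close>, enough to pay for the last weight \<open>T v x \<le> h\<close>.

  Every point of \<open>B\<close> ends in \<open>F\<close>, in \<open>C F\<close>, or among those that receive weight at least \<open>h\<close> in total;
  the last kind is rare when \<open>B\<close> spans little weight.
\<close>

lemma container:
  fixes T :: "'a \<Rightarrow> 'a \<Rightarrow> real" and h :: real
  assumes "finite A" and T: "\<And>x y. 0 \<le> T x y" "\<And>x y. T x y \<le> h"
    and "\<And>x. x \<in> A \<Longrightarrow> g x < h"
  shows "\<exists>C. \<forall>B. \<exists>F \<subseteq> B \<inter> A. real (card F) \<le> (\<Sum>x\<in>A. 2 * h - g x) \<and> C F \<subseteq> A - F \<and>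
      (\<forall>v\<in>C F. (\<Sum>x\<in>C F. T v x) < 1) \<and>
      (\<forall>b\<in>B \<inter> A. b \<in> F \<or> b \<in> C F \<or> h \<le> g b + (\<Sum>v\<in>F. T v b))"
  using assms(1,4)
proof (induction A arbitrary: g rule: finite_psubset_induct)
  case (psubset A)
  note finA = psubset.hyps
  have h0: "0 \<le> h" using T(1)[of undefined undefined] T(2)[of undefined undefined] by linarith
  have pos: "0 \<le> 2 * h - g x" if "x \<in> A" for x using psubset.prems[OF that] h0 by linarith
  show ?case
  proof (cases "\<forall>v\<in>A. (\<Sum>x\<in>A. T v x) < 1")
    case True
    have "0 \<le> (\<Sum>x\<in>A. 2 * h - g x)" using pos by (intro sum_nonneg) auto
    then show ?thesis using True by (intro exI[of _ "\<lambda>_. A"] allI exI[of _ "{}"]) auto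
  next
    case False
    then obtain v where v: "v \<in> A" "1 \<le> (\<Sum>x\<in>A. T v x)" by force
    \<comment> \<open>\<open>C0\<close> continues after the answer \<open>v \<notin> B\<close>, and \<open>C1\<close> after the answer \<open>v \<in> B\<close>.\<close>
    define A1 where "A1 = {x \<in> A - {v}. g x + T v x < h}"
    define g1 where "g1 = (\<lambda>x. g x + T v x)"
    have sub0: "A - {v} \<subset> A" and sub1: "A1 \<subset> A" using v(1) by (auto simp: A1_def)
    obtain C0 where C0: "\<And>B. \<exists>F \<subseteq> B \<inter> (A - {v}). real (card F) \<le> (\<Sum>x\<in>A - {v}. 2 * h - g x) \<and> C0 F \<subseteq> A - {v} - F \<and>
      (\<forall>w\<in>C0 F. (\<Sum>x\<in>C0 F. T w x) < 1) \<and>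
      (\<forall>b\<in>B \<inter> (A - {v}). b \<in> F \<or> b \<in> C0 F \<or> h \<le> g b + (\<Sum>w\<in>F. T w b))"
      using psubset.IH[OF sub0, of g] psubset.prems by blast
    obtain C1 where C1: "\<And>B. \<exists>F \<subseteq> B \<inter> A1. real (card F) \<le> (\<Sum>x\<in>A1. 2 * h - g1 x) \<and> C1 F \<subseteq> A1 - F \<and>
      (\<forall>w\<in>C1 F. (\<Sum>x\<in>C1 F. T w x) < 1) \<and>
      (\<forall>b\<in>B \<inter> A1. b \<in> F \<or> b \<in> C1 F \<or> h \<le> g1 b + (\<Sum>w\<in>F. T w b))"
      using psubset.IH[OF sub1, of g1] by (auto simp: A1_def g1_def)
    \<comment> \<open>The answer is recovered from the fingerprint.\<close>
    define C where "C = (\<lambda>F. if v \<in> F then C1 (F - {v}) else C0 F)"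
    have drop: "1 + (\<Sum>x\<in>A1. 2 * h - g1 x) \<le> (\<Sum>x\<in>A. 2 * h - g x)"
    proof -
      have "(\<Sum>x\<in>A. T v x) + (\<Sum>x\<in>A. if x \<in> A1 then 2 * h - g1 x else 0) \<le> (\<Sum>x\<in>A. 2 * h - g x)"
        unfolding sum.distrib[symmetric]
      proof (rule sum_mono)
        fix x assume x: "x \<in> A"
        show "T v x + (if x \<in> A1 then 2 * h - g1 x else 0) \<le> 2 * h - g x"
          using psubset.prems[OF x] T(2)[of v x] by (auto simp: g1_def)
      qed
      moreover have "(\<Sum>x\<in>A. if x \<in> A1 then 2 * h - g1 x else 0) = (\<Sum>x\<in>A1. 2 * h - g1 x)"
        using finA sub1 by (simp add: sum.If_cases Int_absorb1 psubset_imp_subset)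
      ultimately show ?thesis using v(2) by linarith
    qed
    have "\<exists>F \<subseteq> B \<inter> A. real (card F) \<le> (\<Sum>x\<in>A. 2 * h - g x) \<and> C F \<subseteq> A - F \<and>
      (\<forall>v\<in>C F. (\<Sum>x\<in>C F. T v x) < 1) \<and>
      (\<forall>b\<in>B \<inter> A. b \<in> F \<or> b \<in> C F \<or> h \<le> g b + (\<Sum>v\<in>F. T v b))" for B
    proof (cases "v \<in> B")
      case False
      obtain F where F: "F \<subseteq> B \<inter> (A - {v})" "real (card F) \<le> (\<Sum>x\<in>A - {v}. 2 * h - g x)" "C0 F \<subseteq> A - {v} - F"
        "\<forall>w\<in>C0 F. (\<Sum>x\<in>C0 F. T w x) < 1" "\<forall>b\<in>B \<inter> (A - {v}). b \<in> F \<or> b \<in> C0 F \<or> h \<le> g b + (\<Sum>w\<in>F. T w b)"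
        using C0[of B] by blast
      have CF: "C F = C0 F" using F(1) by (auto simp: C_def)
      have "(\<Sum>x\<in>A - {v}. 2 * h - g x) \<le> (\<Sum>x\<in>A. 2 * h - g x)"
        using finA pos by (intro sum_mono2) auto
      then have "real (card F) \<le> (\<Sum>x\<in>A. 2 * h - g x)" using F(2) by linarith
      moreover have "\<forall>b\<in>B \<inter> A. b \<in> F \<or> b \<in> C0 F \<or> h \<le> g b + (\<Sum>v\<in>F. T v b)" using F(5) False by blast
      ultimately show ?thesis using F(1,3,4) unfolding CF by (intro exI[of _ F]) (auto simp: CF)
    next
      case True
      obtain F1 where F1: "F1 \<subseteq> B \<inter> A1" "real (card F1) \<le> (\<Sum>x\<in>A1. 2 * h - g1 x)" "C1 F1 \<subseteq> A1 - F1"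
        "\<forall>w\<in>C1 F1. (\<Sum>x\<in>C1 F1. T w x) < 1" "\<forall>b\<in>B \<inter> A1. b \<in> F1 \<or> b \<in> C1 F1 \<or> h \<le> g1 b + (\<Sum>w\<in>F1. T w b)"
        using C1[of B] by blast
      have vF1: "v \<notin> F1" using F1(1) by (auto simp: A1_def)
      have finF1: "finite F1" using F1(1) finA sub1 by (meson finite_subset le_infE psubset_imp_subset)
      define F where "F = insert v F1"
      have CF: "C F = C1 F1" using vF1 by (simp add: C_def F_def)
      have 1: "F \<subseteq> B \<inter> A" using F1(1) True v(1) by (auto simp: F_def A1_def)
      have 2: "real (card F) \<le> (\<Sum>x\<in>A. 2 * h - g x)" using F1(2) drop vF1 finF1 by (simp add: F_def)
      have 3: "C F \<subseteq> A - F" unfolding CF using F1(3) by (auto simp: F_def A1_def)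
      have sumF: "(\<Sum>w\<in>F. T w b) = T v b + (\<Sum>w\<in>F1. T w b)" for b using vF1 finF1 by (simp add: F_def)
      have 4: "b \<in> F \<or> b \<in> C F \<or> h \<le> g b + (\<Sum>v\<in>F. T v b)" if b: "b \<in> B \<inter> A" for b
      proof (cases "b \<in> A1")
        case True
        have eq: "g1 b + (\<Sum>w\<in>F1. T w b) = g b + (\<Sum>w\<in>F. T w b)" by (simp add: sumF g1_def)
        have "b \<in> F1 \<or> b \<in> C1 F1 \<or> h \<le> g b + (\<Sum>w\<in>F. T w b)" using F1(5) b True unfolding eq[symmetric] by blast
        then show ?thesis using CF by (auto simp: F_def)
      next
        case False
        show ?thesis
        proof (cases "b = v")
          case False
          then have "h \<le> g b + T v b" using \<open>b \<notin> A1\<close> b by (auto simp: A1_def)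
          moreover have "0 \<le> (\<Sum>w\<in>F1. T w b)" by (intro sum_nonneg T)
          ultimately show ?thesis unfolding sumF by linarith
        qed (simp add: F_def)
      qed
      show ?thesis using 1 2 3 4 F1(4) unfolding CF by (intro exI[of _ F]) (auto simp: CF)
    qed
    then show ?thesis by blast
  qed
qed

section \<open>Binomial random subsets\<close>

lemma prob_le_expectation:
  fixes f :: "'a \<Rightarrow> real"
  assumes "finite (set_pmf M)" "\<And>x. x \<in> set_pmf M \<Longrightarrow> 0 \<le> f x" "\<And>x. x \<in> set_pmf M \<Longrightarrow> x \<in> E \<Longrightarrow> 1 \<le> f x"
  shows "measure_pmf.prob M E \<le> measure_pmf.expectation M f"
proof -
  have "measure_pmf.prob M E = measure_pmf.expectation M (indicat_real E)" by simp
  also have "\<dots> \<le> measure_pmf.expectation M f"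
  proof (rule integral_mono_AE)
    show "AE x in measure_pmf M. indicat_real E x \<le> f x"
      unfolding AE_measure_pmf_iff using assms by (auto simp: indicator_def)
  qed (use assms(1) in \<open>auto intro: integrable_measure_pmf_finite\<close>)
  finally show ?thesis .
qed

lemma set_pmf_binomial_subset: "finite Q \<Longrightarrow> set_pmf (binomial_subset Q p) \<subseteq> Pow Q"
  by (auto simp: binomial_subset_def)

lemma finite_set_pmf_binomial_subset: "finite Q \<Longrightarrow> finite (set_pmf (binomial_subset Q p))"
  using set_pmf_binomial_subset finite_subset by blast

lemma expectation_binomial_subset:
  fixes f :: "'a \<Rightarrow> bool \<Rightarrow> real"
  assumes "finite Q" "0 \<le> p" "p \<le> 1" "\<And>x b. 0 \<le> f x b"
  shows "measure_pmf.expectation (binomial_subset Q p) (\<lambda>\<Omega>. \<Prod>x\<in>Q. f x (x \<in> \<Omega>)) = (\<Prod>x\<in>Q. p * f x True + (1 - p) * f x False)"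
proof -
  have "measure_pmf.expectation (binomial_subset Q p) (\<lambda>\<Omega>. \<Prod>x\<in>Q. f x (x \<in> \<Omega>))
    = measure_pmf.expectation (Pi_pmf Q False (\<lambda>_. bernoulli_pmf p)) (\<lambda>\<omega>. \<Prod>x\<in>Q. f x (\<omega> x))"
    unfolding binomial_subset_def by (simp cong: prod.cong)
  also have "\<dots> = (\<Prod>x\<in>Q. measure_pmf.expectation (bernoulli_pmf p) (f x))"
    by (rule expectation_prod_Pi_pmf) (use assms in \<open>auto intro: integrable_measure_pmf_finite\<close>)
  also have "\<dots> = (\<Prod>x\<in>Q. p * f x True + (1 - p) * f x False)"
    using assms by (intro prod.cong refl) (simp add: mult.commute)
  finally show ?thesis .
qed

lemma sum_Pow_power_card:
  assumes "finite Q"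
  shows "(\<Sum>F\<in>Pow Q. (x::real) ^ card F) = (1 + x) ^ card Q"
  using assms
proof (induction Q rule: finite_induct)
  case (insert a Q)
  have "(\<Sum>F\<in>Pow (insert a Q). x ^ card F) = (\<Sum>F\<in>Pow Q. x ^ card F) + (\<Sum>F\<in>insert a ` Pow Q. x ^ card F)"
    unfolding Pow_insert using insert by (intro sum.union_disjoint) auto
  also have "(\<Sum>F\<in>insert a ` Pow Q. x ^ card F) = (\<Sum>F\<in>Pow Q. x ^ card (insert a F))"
    using insert by (subst sum.reindex) (auto simp: inj_on_def insert_eq_iff)
  also have "\<dots> = (\<Sum>F\<in>Pow Q. x * x ^ card F)"
  proof (intro sum.cong refl)
    fix F assume "F \<in> Pow Q"
    then have "finite F" "a \<notin> F" using insert by (auto intro: finite_subset)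
    then show "x ^ card (insert a F) = x * x ^ card F" by simp
  qed
  finally show ?case using insert by (simp add: sum_distrib_left[symmetric] algebra_simps)
qed simp

text \<open>
  The exponential moment of the number of points in \<open>C\<close> on the event \<open>F \<subseteq> \<Omega>\<close>, which factorises over the points because
  \<open>F\<close> and \<open>C\<close> are disjoint.
\<close>

lemma prob_fingerprint_le:
  assumes Q: "finite Q" and p: "0 \<le> p" "p \<le> 1" and C: "C \<subseteq> Q - F" "F \<subseteq> Q"
  shows "measure_pmf.prob (binomial_subset Q p) {\<Omega>. F \<subseteq> \<Omega> \<and> m \<le> real (card (\<Omega> \<inter> C))} \<le> p ^ card F * exp (2 * p * card C - m)"
proof -
  define f where "f = (\<lambda>x b. if x \<in> F then of_bool b else if x \<in> C then (if b then exp 1 else 1) else (1::real))"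
  define g where "g = (\<lambda>\<Omega>. exp (- m) * (\<Prod>x\<in>Q. f x (x \<in> \<Omega>)))"
  have "C \<subseteq> Q" using C by auto
  then have finC: "finite C" "finite F" using C(2) Q finite_subset by auto
  have g1: "1 \<le> g \<Omega>" if "F \<subseteq> \<Omega>" "m \<le> real (card (\<Omega> \<inter> C))" for \<Omega>
  proof -
    have "(\<Prod>x\<in>Q. f x (x \<in> \<Omega>)) = (\<Prod>x\<in>\<Omega> \<inter> C. exp 1)"
      by (rule prod.mono_neutral_cong_right) (use Q C that in \<open>auto simp: f_def\<close>)
    also have "\<dots> = exp (real (card (\<Omega> \<inter> C)))" by (simp add: exp_of_nat_mult[symmetric])
    finally have e: "(\<Prod>x\<in>Q. f x (x \<in> \<Omega>)) = exp (real (card (\<Omega> \<inter> C)))" .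
    have "g \<Omega> = exp (- m + card (\<Omega> \<inter> C))" unfolding g_def e exp_add[symmetric] ..
    then show ?thesis using that by simp
  qed
  have "measure_pmf.prob (binomial_subset Q p) {\<Omega>. F \<subseteq> \<Omega> \<and> m \<le> real (card (\<Omega> \<inter> C))} \<le> measure_pmf.expectation (binomial_subset Q p) g"
    by (rule prob_le_expectation[OF finite_set_pmf_binomial_subset[OF Q]])
      (use g1 in \<open>auto simp: g_def f_def intro!: mult_nonneg_nonneg prod_nonneg\<close>)
  also have "\<dots> = exp (- m) * (\<Prod>x\<in>Q. p * f x True + (1 - p) * f x False)"
    unfolding g_def by (subst expectation_binomial_subset[OF Q p, symmetric]) (auto simp: f_def)
  also have "(\<Prod>x\<in>Q. p * f x True + (1 - p) * f x False) = (\<Prod>x\<in>F \<union> C. p * f x True + (1 - p) * f x False)"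
    by (rule prod.mono_neutral_right) (use Q C in \<open>auto simp: f_def\<close>)
  also have "\<dots> = (\<Prod>x\<in>F. p * f x True + (1 - p) * f x False) * (\<Prod>x\<in>C. p * f x True + (1 - p) * f x False)"
    by (rule prod.union_disjoint) (use finC C in auto)
  also have "(\<Prod>x\<in>F. p * f x True + (1 - p) * f x False) = (\<Prod>x\<in>F. p)" by (intro prod.cong refl) (simp add: f_def)
  also have "(\<Prod>x\<in>C. p * f x True + (1 - p) * f x False) = (\<Prod>x\<in>C. p * exp 1 + (1 - p))"
    using C by (intro prod.cong refl) (auto simp: f_def)
  finally have a: "measure_pmf.prob (binomial_subset Q p) {\<Omega>. F \<subseteq> \<Omega> \<and> m \<le> real (card (\<Omega> \<inter> C))}
    \<le> exp (- m) * (p ^ card F * (p * exp 1 + (1 - p)) ^ card C)" by simp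
  have b: "(p * exp 1 + (1 - p)) ^ card C \<le> exp (2 * p * card C)"
  proof -
    have "p * exp 1 \<le> p * 3" using exp_le p by (intro mult_left_mono) auto
    then have "p * exp 1 + (1 - p) \<le> 1 + 2 * p" by simp
    also have "\<dots> \<le> exp (2 * p)" by (rule exp_ge_add_one_self)
    finally have "(p * exp 1 + (1 - p)) ^ card C \<le> exp (2 * p) ^ card C" using p by (intro power_mono) auto
    then show ?thesis by (simp add: exp_of_nat_mult[symmetric] mult.commute)
  qed
  have "exp (- m) * (p ^ card F * (p * exp 1 + (1 - p)) ^ card C) \<le> exp (- m) * (p ^ card F * exp (2 * p * card C))"
    using b p by (intro mult_left_mono) auto
  also have "\<dots> = p ^ card F * exp (2 * p * card C - m)" by (simp add: exp_diff exp_minus field_simps)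
  finally show ?thesis using a by linarith
qed

text \<open>
  The union bound over all fingerprints is \<open>\<Sum> p^(card F)\<close>. Inserting \<open>\<tau>^(card F)\<close> at the cost of a factor
  \<open>\<tau>^(-t)\<close> makes this sum at most \<open>(1 + \<tau> p)^n\<close>, so that no binomial coefficients have to be
  estimated.
\<close>

lemma prob_fingerprints_le:
  assumes Q: "finite Q" and p: "0 \<le> p" "p \<le> 1" and \<tau>: "0 < \<tau>" "\<tau> \<le> 1"
    and C: "\<And>F. F \<subseteq> Q \<Longrightarrow> F \<in> \<F> \<Longrightarrow> C F \<subseteq> Q - F \<and> real (card (C F)) \<le> a"
    and t: "\<And>F. F \<in> \<F> \<Longrightarrow> real (card F) \<le> t"
  shows "measure_pmf.prob (binomial_subset Q p) {\<Omega>. \<exists>F\<in>\<F>. F \<subseteq> \<Omega> \<and> m \<le> real (card (\<Omega> \<inter> C F))}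
    \<le> exp (2 * p * a - m + t * ln (1 / \<tau>) + p * \<tau> * card Q)"
proof -
  let ?M = "binomial_subset Q p"
  have "measure_pmf.prob ?M {\<Omega>. \<exists>F\<in>\<F>. F \<subseteq> \<Omega> \<and> m \<le> real (card (\<Omega> \<inter> C F))}
     \<le> measure_pmf.prob ?M (\<Union>F\<in>Pow Q \<inter> \<F>. {\<Omega>. F \<subseteq> \<Omega> \<and> m \<le> real (card (\<Omega> \<inter> C F))})"
    unfolding measure_measure_pmf_finite[OF finite_set_pmf_binomial_subset]
    by (rule measure_pmf.finite_measure_mono_AE) (use set_pmf_binomial_subset[OF Q, of p] in \<open>auto simp: AE_measure_pmf_iff\<close>)
  also have "\<dots> \<le> (\<Sum>F\<in>Pow Q \<inter> \<F>. measure_pmf.prob ?M {\<Omega>. F \<subseteq> \<Omega> \<and> m \<le> real (card (\<Omega> \<inter> C F))})"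
    by (rule measure_pmf.finite_measure_subadditive_finite) (use Q in auto)
  also have "\<dots> \<le> (\<Sum>F\<in>Pow Q \<inter> \<F>. (\<tau> * p) ^ card F * exp (t * ln (1 / \<tau>) + (2 * p * a - m)))"
  proof (rule sum_mono)
    fix F assume F: "F \<in> Pow Q \<inter> \<F>"
    have "measure_pmf.prob ?M {\<Omega>. F \<subseteq> \<Omega> \<and> m \<le> real (card (\<Omega> \<inter> C F))} \<le> p ^ card F * exp (2 * p * card (C F) - m)"
      by (rule prob_fingerprint_le[OF Q p]) (use F C in auto)
    also have "\<dots> \<le> p ^ card F * exp (2 * p * a - m)"
      using F C[of F] p by (intro mult_left_mono) (auto intro!: mult_left_mono)
    also have "\<dots> = \<tau> ^ card F * p ^ card F * (exp (card F * ln (1 / \<tau>)) * exp (2 * p * a - m))"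
    proof -
      have "exp (card F * ln (1 / \<tau>)) = (1 / \<tau>) ^ card F" using \<tau> by (simp add: exp_of_nat_mult)
      then have "\<tau> ^ card F * exp (card F * ln (1 / \<tau>)) = 1" using \<tau> by (simp add: power_one_over)
      then show ?thesis by (simp add: mult_ac)
    qed
    also have "\<dots> \<le> \<tau> ^ card F * p ^ card F * (exp (t * ln (1 / \<tau>)) * exp (2 * p * a - m))"
    proof -
      have "0 \<le> ln (1 / \<tau>)" using \<tau> by (intro ln_ge_zero) simp
      then have "card F * ln (1 / \<tau>) \<le> t * ln (1 / \<tau>)" using t[of F] F by (intro mult_right_mono) auto
      then show ?thesis using \<tau> p by (intro mult_left_mono mult_right_mono) auto
    qed
    finally show "measure_pmf.prob ?M {\<Omega>. F \<subseteq> \<Omega> \<and> m \<le> real (card (\<Omega> \<inter> C F))} \<le> (\<tau> * p) ^ card F * exp (t * ln (1 / \<tau>) + (2 * p * a - m))"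
      by (simp only: power_mult_distrib exp_add)
  qed
  also have "\<dots> \<le> (\<Sum>F\<in>Pow Q. (\<tau> * p) ^ card F * exp (t * ln (1 / \<tau>) + (2 * p * a - m)))"
    using Q \<tau> p by (intro sum_mono2) auto
  also have "\<dots> = (1 + \<tau> * p) ^ card Q * exp (t * ln (1 / \<tau>) + (2 * p * a - m))"
    by (simp only: sum_distrib_right[symmetric] sum_Pow_power_card[OF Q])
  also have "\<dots> \<le> exp (\<tau> * p) ^ card Q * exp (t * ln (1 / \<tau>) + (2 * p * a - m))"
    using \<tau> p by (intro mult_right_mono power_mono) auto
  also have "\<dots> = exp (2 * p * a - m + t * ln (1 / \<tau>) + p * \<tau> * card Q)"
    unfolding exp_of_nat_mult[symmetric] exp_add[symmetric] by (rule arg_cong[of _ _ exp]) (simp add: algebra_simps)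
  finally show ?thesis .
qed

lemma prob_small_binomial_subset:
  assumes Q: "finite Q" and p: "0 \<le> p" "p \<le> 1"
  shows "measure_pmf.prob (binomial_subset Q p) {\<Omega>. real (card \<Omega>) < p * card Q / 2} \<le> exp (- p * card Q / 10)"
proof -
  define f where "f = (\<lambda>x::'a. \<lambda>b. if b then exp (- 1) else (1::real))"
  define g where "g = (\<lambda>\<Omega>. exp (p * card Q / 2) * (\<Prod>x\<in>Q. f x (x \<in> \<Omega>)))"
  have g: "g \<Omega> = exp (p * card Q / 2 - card \<Omega>)" if "\<Omega> \<in> Pow Q" for \<Omega>
  proof -
    have "(\<Prod>x\<in>Q. f x (x \<in> \<Omega>)) = (\<Prod>x\<in>\<Omega>. exp (- 1))"
      by (rule prod.mono_neutral_cong_right) (use Q that in \<open>auto simp: f_def\<close>)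
    also have "\<dots> = exp (- real (card \<Omega>))" by (simp add: exp_of_nat_mult[symmetric])
    finally have e: "(\<Prod>x\<in>Q. f x (x \<in> \<Omega>)) = exp (- real (card \<Omega>))" .
    show ?thesis unfolding g_def e exp_add[symmetric] by simp
  qed
  have "measure_pmf.prob (binomial_subset Q p) {\<Omega>. real (card \<Omega>) < p * card Q / 2} \<le> measure_pmf.expectation (binomial_subset Q p) g"
  proof (rule prob_le_expectation[OF finite_set_pmf_binomial_subset[OF Q]])
    fix \<Omega> assume "\<Omega> \<in> set_pmf (binomial_subset Q p)"
    then have e: "g \<Omega> = exp (p * card Q / 2 - card \<Omega>)" using set_pmf_binomial_subset[OF Q] by (intro g) auto
    show "0 \<le> g \<Omega>" unfolding e by simp
    show "1 \<le> g \<Omega>" if "\<Omega> \<in> {\<Omega>. real (card \<Omega>) < p * card Q / 2}" unfolding e using that by simp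
  qed
  also have "\<dots> = exp (p * card Q / 2) * (\<Prod>x\<in>Q. p * f x True + (1 - p) * f x False)"
    unfolding g_def by (subst expectation_binomial_subset[OF Q p, symmetric]) (auto simp: f_def)
  also have "\<dots> = exp (p * card Q / 2) * (1 - p * (1 - exp (- 1))) ^ card Q" by (simp add: f_def algebra_simps)
  also have "\<dots> \<le> exp (p * card Q / 2) * exp (- (3/5) * p) ^ card Q"
  proof (intro mult_left_mono power_mono)
    have "1 + 1 + 1\<^sup>2 / 2 \<le> exp (1::real)" by (rule exp_lower_Taylor_quadratic) simp
    then have "exp (- 1::real) \<le> 2/5" by (simp add: exp_minus field_simps)
    then have "p * (3/5) \<le> p * (1 - exp (- 1))" using p by (intro mult_left_mono) auto
    then have "1 - p * (1 - exp (- 1)) \<le> 1 + - (3/5) * p" by simp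
    also have "\<dots> \<le> exp (- (3/5) * p)" by (rule exp_ge_add_one_self)
    finally show "1 - p * (1 - exp (- 1)) \<le> exp (- (3/5) * p)" .
    have "p * (1 - exp (- 1)) \<le> 1 * 1" using p by (intro mult_mono) auto
    then show "0 \<le> 1 - p * (1 - exp (- 1))" by simp
  qed simp
  also have "\<dots> = exp (- p * card Q / 10)"
    unfolding exp_of_nat_mult[symmetric] exp_add[symmetric] by (rule arg_cong[of _ _ exp]) (simp add: algebra_simps)
  finally show ?thesis .
qed

lemma prob_empty_binomial_subset:
  assumes Q: "finite Q" and p: "0 \<le> p" "p \<le> 1"
  shows "measure_pmf.prob (binomial_subset Q p) {{}} \<ge> (1 - p) ^ card Q"
proof -
  define f where "f = (\<lambda>x::'a. \<lambda>b. of_bool (\<not> b) :: real)"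
  have "(1 - p) ^ card Q = measure_pmf.expectation (binomial_subset Q p) (\<lambda>\<Omega>. \<Prod>x\<in>Q. f x (x \<in> \<Omega>))"
    by (subst expectation_binomial_subset[OF Q p]) (auto simp: f_def)
  also have "\<dots> \<le> measure_pmf.expectation (binomial_subset Q p) (indicat_real {{}})"
  proof (rule integral_mono_AE)
    show "AE \<Omega> in measure_pmf (binomial_subset Q p). (\<Prod>x\<in>Q. f x (x \<in> \<Omega>)) \<le> indicat_real {{}} \<Omega>"
      unfolding AE_measure_pmf_iff
    proof
      fix \<Omega> assume "\<Omega> \<in> set_pmf (binomial_subset Q p)"
      then have "\<Omega> \<subseteq> Q" using set_pmf_binomial_subset[OF Q] by auto
      show "(\<Prod>x\<in>Q. f x (x \<in> \<Omega>)) \<le> indicat_real {{}} \<Omega>"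
      proof (cases "\<Omega> = {}")
        case False
        then obtain x where "x \<in> \<Omega>" by blast
        then have "(\<Prod>x\<in>Q. f x (x \<in> \<Omega>)) = 0" using \<open>\<Omega> \<subseteq> Q\<close> Q by (intro prod_zero) (auto simp: f_def)
        then show ?thesis by simp
      qed (simp add: f_def)
    qed
  qed (use finite_set_pmf_binomial_subset[OF Q] in \<open>auto intro: integrable_measure_pmf_finite\<close>)
  finally show ?thesis by simp
qed

section \<open>Dense subsets of a random set span many edges\<close>

text \<open>
  The constant \<open>\<tau>\<close> bounds the single weights by \<open>\<tau> p\<close>. It is chosen such that the fingerprints, of
  size at most \<open>2 \<tau> p n\<close>, contribute at most \<open>\<delta> p n / 16\<close> to the exponent. Of the at least \<open>\<delta> p n / 2\<close>
  points of \<open>B\<close>, at most \<open>\<delta> p n / 8\<close> are in the fingerprint and fewer than \<open>\<delta> p n / 8\<close> receive weight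
  \<open>\<tau> p\<close> from it. So at least \<open>\<delta> p n / 4\<close> lie in the container, where only \<open>\<delta> p n / 32\<close> are expected.
\<close>

lemma prob_dense_few_edges_le:
  fixes T :: "'a \<Rightarrow> 'a \<Rightarrow> real" and Q :: "'a set" and \<delta> p :: real
  assumes Q: "finite Q" "Q \<noteq> {}" and p: "0 < p" "p \<le> 1" and \<delta>: "0 < \<delta>" "\<delta> < 1"
  defines "\<tau> \<equiv> (\<delta> / 80)\<^sup>2"
  assumes T: "\<And>x y. 0 \<le> T x y" "\<And>x y. T x y \<le> \<tau> * p"
    and super: "\<And>A. A \<subseteq> Q \<Longrightarrow> \<delta> / 32 * card Q \<le> card A \<Longrightarrow> real (card A) \<le> (\<Sum>x\<in>A. \<Sum>y\<in>A. T x y)"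
  shows "measure_pmf.prob (binomial_subset Q p) {\<Omega>. \<Omega> \<subseteq> Q \<and> p * card Q / 2 \<le> card \<Omega> \<and>
     (\<exists>B\<subseteq>\<Omega>. \<delta> * card \<Omega> \<le> card B \<and> (\<Sum>x\<in>B. \<Sum>y\<in>B. T x y) < \<tau> * \<delta> / 8 * p\<^sup>2 * card Q)} \<le> exp (- (\<delta> / 8) * (p * card Q))"
proof -
  define n where "n = real (card Q)"
  have n0: "n > 0" using Q by (simp add: n_def card_gt_0_iff)
  have \<tau>: "0 < \<tau>" "\<tau> \<le> \<delta> / 6400"
  proof -
    have "\<delta> * \<delta> \<le> \<delta> * 1" using \<delta> by (intro mult_left_mono) auto
    then show "\<tau> \<le> \<delta> / 6400" by (simp add: \<tau>_def power2_eq_square)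
  qed (use \<delta> in \<open>simp add: \<tau>_def\<close>)
  define h where "h = \<tau> * p"
  have h0: "h > 0" using \<tau> p by (simp add: h_def)
  have "\<exists>C. \<forall>B. \<exists>F \<subseteq> B \<inter> Q. real (card F) \<le> (\<Sum>x\<in>Q. 2 * h - 0) \<and> C F \<subseteq> Q - F \<and>
      (\<forall>v\<in>C F. (\<Sum>x\<in>C F. T v x) < 1) \<and>
      (\<forall>b\<in>B \<inter> Q. b \<in> F \<or> b \<in> C F \<or> h \<le> 0 + (\<Sum>v\<in>F. T v b))"
    by (rule container[of Q T h "\<lambda>_. 0"]) (use Q T h0 in \<open>simp_all add: h_def\<close>)
  then obtain C where
    C: "\<forall>B. \<exists>F \<subseteq> B \<inter> Q. real (card F) \<le> (\<Sum>x\<in>Q. 2 * h - 0) \<and> C F \<subseteq> Q - F \<and>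
      (\<forall>v\<in>C F. (\<Sum>x\<in>C F. T v x) < 1) \<and>
      (\<forall>b\<in>B \<inter> Q. b \<in> F \<or> b \<in> C F \<or> h \<le> 0 + (\<Sum>v\<in>F. T v b))"
    by (elim exE)
  define \<F> where "\<F> = {F. real (card F) \<le> 2 * h * n \<and> C F \<subseteq> Q - F \<and> (\<forall>v\<in>C F. (\<Sum>x\<in>C F. T v x) < 1)}"
  have small: "real (card (C F)) \<le> \<delta> / 32 * n" if F: "F \<in> \<F>" for F
  proof (rule ccontr)
    assume big: "\<not> real (card (C F)) \<le> \<delta> / 32 * n"
    have sub: "C F \<subseteq> Q" using F by (auto simp: \<F>_def)
    have fin: "finite (C F)" using sub Q(1) finite_subset by blast
    have "0 \<le> \<delta> / 32 * n" using \<delta> n0 by simp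
    then have ne: "C F \<noteq> {}" using big by auto
    have "real (card (C F)) \<le> (\<Sum>x\<in>C F. \<Sum>y\<in>C F. T x y)" using super[OF sub] big by (simp add: n_def)
    also have "\<dots> < (\<Sum>x\<in>C F. 1)" by (rule sum_strict_mono) (use F fin ne in \<open>auto simp: \<F>_def\<close>)
    finally show False by simp
  qed
  have fp: "\<exists>F\<in>\<F>. F \<subseteq> \<Omega> \<and> \<delta> / 4 * p * n \<le> real (card (\<Omega> \<inter> C F))"
    if \<Omega>: "\<Omega> \<subseteq> Q" "p * card Q / 2 \<le> card \<Omega>" and B: "B \<subseteq> \<Omega>" "\<delta> * card \<Omega> \<le> card B"
      "(\<Sum>x\<in>B. \<Sum>y\<in>B. T x y) < \<tau> * \<delta> / 8 * p\<^sup>2 * card Q" for \<Omega> B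
  proof -
    have fin\<Omega>: "finite \<Omega>" using \<Omega>(1) Q(1) finite_subset by blast
    have finB: "finite B" using B(1) fin\<Omega> finite_subset by blast
    have BQ: "B \<inter> Q = B" using B(1) \<Omega>(1) by blast
    obtain F where F: "F \<subseteq> B" "real (card F) \<le> 2 * h * n" "C F \<subseteq> Q - F" "\<forall>v\<in>C F. (\<Sum>x\<in>C F. T v x) < 1"
      "\<forall>b\<in>B. b \<in> F \<or> b \<in> C F \<or> h \<le> (\<Sum>v\<in>F. T v b)"
    proof -
      obtain F where F: "F \<subseteq> B" "real (card F) \<le> (\<Sum>x\<in>Q. 2 * h - 0)" "C F \<subseteq> Q - F" "\<forall>v\<in>C F. (\<Sum>x\<in>C F. T v x) < 1"
        "\<forall>b\<in>B. b \<in> F \<or> b \<in> C F \<or> h \<le> 0 + (\<Sum>v\<in>F. T v b)"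
        using C[rule_format, of B] unfolding BQ by blast
      show thesis
      proof (rule that[OF F(1) _ F(3,4)])
        show "real (card F) \<le> 2 * h * n" using F(2) by (simp add: n_def mult.commute)
        show "\<forall>b\<in>B. b \<in> F \<or> b \<in> C F \<or> h \<le> (\<Sum>v\<in>F. T v b)" using F(5) by simp
      qed
    qed
    have finF: "finite F" using F(1) finB finite_subset by blast
    \<comment> \<open>The points of \<open>B\<close> that receive weight \<open>h\<close> from the fingerprint; each uses up an amount \<open>h\<close> of the
      weight spanned by \<open>B\<close>.\<close>
    define D where "D = {b\<in>B. h \<le> (\<Sum>v\<in>F. T v b)}"
    have finD: "finite D" using finB by (simp add: D_def)
    have "real (card D) * h = (\<Sum>b\<in>D. h)" by simp
    also have "\<dots> \<le> (\<Sum>b\<in>D. \<Sum>v\<in>F. T v b)" by (intro sum_mono) (auto simp: D_def)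
    also have "\<dots> \<le> (\<Sum>b\<in>D. \<Sum>v\<in>B. T v b)" by (intro sum_mono sum_mono2 finB F(1)) (use T in auto)
    also have "\<dots> \<le> (\<Sum>b\<in>B. \<Sum>v\<in>B. T v b)" by (intro sum_mono2 finB) (use T in \<open>auto simp: D_def intro: sum_nonneg\<close>)
    also have "\<dots> = (\<Sum>v\<in>B. \<Sum>b\<in>B. T v b)" by (rule sum.swap)
    also have "\<dots> < \<tau> * \<delta> / 8 * p\<^sup>2 * n" using B(3) by (simp add: n_def)
    also have "\<dots> = \<delta> / 8 * (p * n) * h" by (simp add: h_def power2_eq_square)
    finally have D: "real (card D) < \<delta> / 8 * (p * n)" using h0 by simp
    have "B \<subseteq> F \<union> (\<Omega> \<inter> C F) \<union> D" using F(5) B(1) by (auto simp: D_def)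
    then have "card B \<le> card (F \<union> (\<Omega> \<inter> C F) \<union> D)" using finF fin\<Omega> finD by (intro card_mono) auto
    also have "\<dots> \<le> card F + card (\<Omega> \<inter> C F) + card D" by (meson add_le_mono1 card_Un_le order_trans)
    finally have "real (card B) \<le> real (card F) + real (card (\<Omega> \<inter> C F)) + real (card D)" by linarith
    moreover have "\<delta> / 2 * (p * n) \<le> real (card B)"
    proof -
      have "\<delta> * (p * n / 2) \<le> \<delta> * card \<Omega>" using \<Omega>(2) \<delta> by (intro mult_left_mono) (auto simp: n_def)
      then show ?thesis using B(2) by simp
    qed
    moreover have "real (card F) \<le> \<delta> / 8 * (p * n)"
    proof -
      have "2 * h * n = 2 * \<tau> * (p * n)" by (simp add: h_def)
      also have "\<dots> \<le> \<delta> / 8 * (p * n)" using \<tau> p n0 \<delta> by (intro mult_right_mono) auto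
      finally show ?thesis using F(2) by linarith
    qed
    ultimately have "\<delta> / 4 * p * n \<le> real (card (\<Omega> \<inter> C F))" using D by (simp add: field_simps)
    moreover have "F \<in> \<F>" using F by (simp add: \<F>_def)
    ultimately show ?thesis using F(1) B(1) by blast
  qed
  have "measure_pmf.prob (binomial_subset Q p) {\<Omega>. \<Omega> \<subseteq> Q \<and> p * card Q / 2 \<le> card \<Omega> \<and>
     (\<exists>B\<subseteq>\<Omega>. \<delta> * card \<Omega> \<le> card B \<and> (\<Sum>x\<in>B. \<Sum>y\<in>B. T x y) < \<tau> * \<delta> / 8 * p\<^sup>2 * card Q)}
    \<le> measure_pmf.prob (binomial_subset Q p) {\<Omega>. \<exists>F\<in>\<F>. F \<subseteq> \<Omega> \<and> \<delta> / 4 * p * n \<le> real (card (\<Omega> \<inter> C F))}"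
  proof (rule measure_pmf.finite_measure_mono)
    show "{\<Omega>. \<Omega> \<subseteq> Q \<and> p * card Q / 2 \<le> card \<Omega> \<and>
     (\<exists>B\<subseteq>\<Omega>. \<delta> * card \<Omega> \<le> card B \<and> (\<Sum>x\<in>B. \<Sum>y\<in>B. T x y) < \<tau> * \<delta> / 8 * p\<^sup>2 * card Q)}
      \<subseteq> {\<Omega>. \<exists>F\<in>\<F>. F \<subseteq> \<Omega> \<and> \<delta> / 4 * p * n \<le> real (card (\<Omega> \<inter> C F))}"
    proof
      fix \<Omega> assume "\<Omega> \<in> {\<Omega>. \<Omega> \<subseteq> Q \<and> p * card Q / 2 \<le> card \<Omega> \<and>
     (\<exists>B\<subseteq>\<Omega>. \<delta> * card \<Omega> \<le> card B \<and> (\<Sum>x\<in>B. \<Sum>y\<in>B. T x y) < \<tau> * \<delta> / 8 * p\<^sup>2 * card Q)}"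
      then obtain B where "\<Omega> \<subseteq> Q" "p * card Q / 2 \<le> card \<Omega>" "B \<subseteq> \<Omega>" "\<delta> * card \<Omega> \<le> card B"
        "(\<Sum>x\<in>B. \<Sum>y\<in>B. T x y) < \<tau> * \<delta> / 8 * p\<^sup>2 * card Q" by blast
      then show "\<Omega> \<in> {\<Omega>. \<exists>F\<in>\<F>. F \<subseteq> \<Omega> \<and> \<delta> / 4 * p * n \<le> real (card (\<Omega> \<inter> C F))}"
        using fp[of \<Omega> B] by simp
    qed
  qed simp
  also have "\<dots> \<le> exp (2 * p * (\<delta> / 32 * n) - \<delta> / 4 * p * n + 2 * h * n * ln (1 / \<tau>) + p * \<tau> * card Q)"
  proof (rule prob_fingerprints_le[OF Q(1) less_imp_le[OF p(1)] p(2) \<tau>(1)])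
    show "\<tau> \<le> 1" using \<tau> \<delta> by linarith
    show "C F \<subseteq> Q - F \<and> real (card (C F)) \<le> \<delta> / 32 * n" if "F \<in> \<F>" for F
      using small[OF that] that by (auto simp: \<F>_def)
    show "real (card F) \<le> 2 * h * n" if "F \<in> \<F>" for F using that by (simp add: \<F>_def)
  qed
  also have "\<dots> \<le> exp (- (\<delta> / 8) * (p * card Q))"
  proof -
    \<comment> \<open>\<open>ln (1 / \<tau>) = 2 ln (80 / \<delta>) \<le> 160 / \<delta>\<close>: the square in the definition of \<open>\<tau>\<close> leaves a factor \<open>\<delta>\<close>
      over.\<close>
    have "\<tau> * ln (1 / \<tau>) \<le> \<delta> / 40"
    proof -
      have "1 / \<tau> = (80 / \<delta>)\<^sup>2" using \<delta> by (simp add: \<tau>_def power_divide)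
      then have "ln (1 / \<tau>) = 2 * ln (80 / \<delta>)" using \<delta> by (simp add: ln_realpow)
      also have "\<dots> \<le> 2 * (80 / \<delta>)" using ln_bound[of "80 / \<delta>"] \<delta> by simp
      finally have "\<tau> * ln (1 / \<tau>) \<le> \<tau> * (2 * (80 / \<delta>))" using \<tau> by (intro mult_left_mono) auto
      also have "\<dots> = \<delta> / 40" using \<delta> by (simp add: \<tau>_def power2_eq_square)
      finally show ?thesis .
    qed
    then have "2 * (\<tau> * ln (1 / \<tau>)) + \<tau> \<le> \<delta> / 16" using \<tau>(2) \<delta> by linarith
    then have "(2 * (\<tau> * ln (1 / \<tau>)) + \<tau>) * (p * n) \<le> \<delta> / 16 * (p * n)" using p n0 by (intro mult_right_mono) auto
    then show ?thesis by (simp add: h_def n_def algebra_simps)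
  qed
  finally show ?thesis .
qed

lemma card_sphere_ge_powr:
  assumes d: "CARD('d::finite) \<ge> 5"
  shows "\<exists>(c::real) (L::nat). c > 0 \<and> L \<ge> 1 \<and> (\<forall>l\<ge>L. c * real l powr ((real CARD('d) - 2) / 2) \<le> real (card (lattice_sphere l :: (int ^ 'd) set)))"
proof -
  define D where "D = CARD('d)"
  obtain c :: real and N0 :: nat where c: "c > 0" "N0 \<ge> 1"
    "\<And>N l. N \<ge> N0 \<Longrightarrow> N\<^sup>2 \<le> l \<Longrightarrow> l < (N + 1)\<^sup>2 \<Longrightarrow> c * real N ^ (D - 2) \<le> real (card (lattice_sphere l :: (int ^ 'd) set))"
    using card_sphere_ge[OF d] unfolding D_def by blast
  have "c / 2 ^ (D - 2) * real l powr ((real D - 2) / 2) \<le> real (card (lattice_sphere l :: (int ^ 'd) set))" if l: "l \<ge> N0\<^sup>2" for l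
  proof -
    obtain N where N: "N\<^sup>2 \<le> l" "l < (N + 1)\<^sup>2" using exists_nat_sqrt by blast
    have "N0\<^sup>2 < (N + 1)\<^sup>2" using N(2) l by simp
    then have "N0 < N + 1" by (rule power_less_imp_less_base) simp
    then have NN: "N \<ge> N0" "N \<ge> 1" using c(2) by auto
    have l0: "real l > 0"
    proof -
      have "0 < N\<^sup>2" using NN(2) by simp
      then have "0 < l" using N(1) by linarith
      then show ?thesis by simp
    qed
    have "real l < real ((N + 1)\<^sup>2)" using N(2) by (simp only: of_nat_less_iff)
    also have "\<dots> \<le> real ((2 * N)\<^sup>2)" using NN(2) by (simp only: of_nat_le_iff) (intro power_mono, auto)
    finally have "sqrt l \<le> 2 * N" by (intro real_le_lsqrt) auto
    then have "(sqrt l / 2) ^ (D - 2) \<le> real N ^ (D - 2)" by (intro power_mono) auto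
    then have "c * (sqrt l / 2) ^ (D - 2) \<le> c * real N ^ (D - 2)" using c(1) by (intro mult_left_mono) auto
    also have "\<dots> \<le> real (card (lattice_sphere l :: (int ^ 'd) set))" by (rule c(3)[OF NN(1) N])
    also have "c * (sqrt l / 2) ^ (D - 2) = c / 2 ^ (D - 2) * real l powr ((real D - 2) / 2)"
    proof -
      have "sqrt l ^ (D - 2) = sqrt l powr real (D - 2)" using l0 by (simp add: powr_realpow)
      also have "\<dots> = real l powr ((real D - 2) / 2)"
        using l0 d by (simp add: powr_half_sqrt[symmetric] powr_powr D_def of_nat_diff)
      finally show ?thesis by (simp add: power_divide)
    qed
    finally show ?thesis .
  qed
  moreover have "N0\<^sup>2 \<ge> 1" using c(2) by simp
  moreover have "c / 2 ^ (D - 2) > 0" using c(1) by simp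
  ultimately show ?thesis unfolding D_def by blast
qed

text \<open>
  The weighted graph whose edges join points at the distances that occur in the spherical averages.
\<close>

definition edge_weight :: "nat \<Rightarrow> nat \<Rightarrow> nat \<Rightarrow> nat \<Rightarrow> int ^ 'd::finite \<Rightarrow> int ^ 'd \<Rightarrow> real" where
  "edge_weight r s J l x y = (\<Sum>j=0..J. real (card {v \<in> lattice_sphere (s ^ (2 * (J - j)) * l). x + int (r ^ j) *s v = y})
     / real (card (lattice_sphere (s ^ (2 * (J - j)) * l) :: (int ^ 'd) set)))"

lemma sum_edge_weight:
  fixes B :: "(int ^ 'd::finite) set"
  assumes "finite B"
  shows "(\<Sum>y\<in>B. edge_weight r s J l x y) = (\<Sum>j=0..J. spherical_avg (r ^ j) (s ^ (2 * (J - j)) * l) (indicat_real B) x)"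
proof -
  have cnt: "(\<Sum>y\<in>B. real (card {v \<in> lattice_sphere m. x + int q *s v = y})) = (\<Sum>v\<in>lattice_sphere m. indicat_real B (x + int q *s v))" for q m
  proof -
    have fin: "finite (lattice_sphere m :: (int ^ 'd) set)" by (rule finite_lattice_sphere)
    have "(\<Sum>y\<in>B. real (card {v \<in> lattice_sphere m. x + int q *s v = y})) = (\<Sum>y\<in>B. \<Sum>v\<in>lattice_sphere m. if x + int q *s v = y then 1 else 0)"
      by (intro sum.cong refl) (simp add: sum.inter_filter[OF fin, symmetric])
    also have "\<dots> = (\<Sum>v\<in>lattice_sphere m. \<Sum>y\<in>B. if x + int q *s v = y then 1 else 0)" by (rule sum.swap)
    also have "\<dots> = (\<Sum>v\<in>lattice_sphere m. indicat_real B (x + int q *s v))"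
      using assms by (intro sum.cong refl) (simp add: indicator_def)
    finally show ?thesis .
  qed
  show ?thesis
    unfolding edge_weight_def spherical_avg_def
    by (subst sum.swap) (intro sum.cong refl, simp only: sum_divide_distrib[symmetric] cnt)
qed

lemma edge_weight_nonneg: "0 \<le> edge_weight r s J l x y"
  unfolding edge_weight_def by (intro sum_nonneg divide_nonneg_nonneg) auto

text \<open>
  For fixed \<open>x\<close>, \<open>y\<close> and \<open>j\<close> there is at most one \<open>v\<close> with \<open>x + r^j v = y\<close>.
\<close>

lemma edge_weight_le:
  fixes x y :: "int ^ 'd::finite"
  assumes "r > 0" "w > 0" "\<And>j. j \<le> J \<Longrightarrow> w \<le> real (card (lattice_sphere (s ^ (2 * (J - j)) * l) :: (int ^ 'd) set))"
  shows "edge_weight r s J l x y \<le> (J + 1) / w"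
proof -
  have "edge_weight r s J l x y \<le> (\<Sum>j=0..J. 1 / w)"
    unfolding edge_weight_def
  proof (rule sum_mono)
    fix j assume j: "j \<in> {0..J}"
    let ?S = "lattice_sphere (s ^ (2 * (J - j)) * l) :: (int ^ 'd) set"
    have "card {v \<in> ?S. x + int (r ^ j) *s v = y} \<le> 1"
    proof -
      have "v = v'" if "x + int (r ^ j) *s v = y" "x + int (r ^ j) *s v' = y" for v v'
      proof -
        have "int (r ^ j) *s v = int (r ^ j) *s v'" using that by (metis add_left_cancel)
        then show ?thesis using assms(1) by (simp add: vec_eq_iff)
      qed
      then show ?thesis by (intro card_le_Suc0_iff_eq[THEN iffD2, folded One_nat_def]) (auto intro: finite_subset[OF _ finite_lattice_sphere])
    qed
    then have "real (card {v \<in> ?S. x + int (r ^ j) *s v = y}) / real (card ?S) \<le> 1 / real (card ?S)"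
      by (intro divide_right_mono) auto
    also have "\<dots> \<le> 1 / w" using assms(2) assms(3)[of j] j by (intro divide_left_mono mult_pos_pos) auto
    finally show "real (card {v \<in> ?S. x + int (r ^ j) *s v = y}) / real (card ?S) \<le> 1 / w" .
  qed
  then show ?thesis by (simp add: add.commute)
qed

lemma infsum_pairs:
  fixes B :: "(int ^ 'd::finite) set"
  assumes "finite B"
  shows "(\<Sum>\<^sub>\<infinity>x\<in>UNIV. indicat_real B x * (\<Sum>j=0..J. spherical_avg (r ^ j) (s ^ (2 * (J - j)) * l) (indicat_real B) x))
     = (\<Sum>x\<in>B. \<Sum>y\<in>B. edge_weight r s J l x y)"
proof -
  have "(\<Sum>\<^sub>\<infinity>x\<in>UNIV. indicat_real B x * (\<Sum>j=0..J. spherical_avg (r ^ j) (s ^ (2 * (J - j)) * l) (indicat_real B) x))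
    = (\<Sum>\<^sub>\<infinity>x\<in>B. \<Sum>y\<in>B. edge_weight r s J l x y)"
    unfolding sum_edge_weight[OF assms] by (rule infsum_cong_neutral) auto
  then show ?thesis using assms by (simp add: infsum_finite)
qed

section \<open>Failure probability\<close>

lemma one_le_powr_neg:
  fixes p a :: real
  assumes "0 < p" "p \<le> 1" "0 \<le> a"
  shows "1 \<le> p powr (- a)"
proof -
  have "p powr a \<le> 1" using assms by (intro powr_le1) auto
  moreover have "0 < p powr a" using assms by simp
  ultimately show ?thesis by (simp add: powr_minus field_simps)
qed

lemma not_dense_subsets_richD:
  fixes \<Omega> :: "(int ^ 'd::finite) set"
  assumes "finite \<Omega>" "\<not> dense_subsets_rich r s J c0 c1 c2 \<delta> N p \<Omega>"
  shows "\<exists>l. c1 * p powr (- 2 / (real CARD('d) - 2)) \<le> real l \<and> real l \<le> c2 * (real N)\<^sup>2 \<and>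
    (\<exists>B\<subseteq>\<Omega>. \<delta> * card \<Omega> \<le> card B \<and> (\<Sum>x\<in>B. \<Sum>y\<in>B. edge_weight r s J l x y) < c0 * p\<^sup>2 * card (cube N :: (int ^ 'd) set))"
proof -
  obtain B l where B: "B \<subseteq> \<Omega>" "\<delta> * card \<Omega> \<le> card B" and l: "c1 * p powr (- 2 / (real CARD('d) - 2)) \<le> real l" "real l \<le> c2 * (real N)\<^sup>2"
    and less: "(\<Sum>\<^sub>\<infinity>x\<in>UNIV. indicat_real B x *
             (\<Sum>j=0..J. spherical_avg (r ^ j) (s ^ (2 * (J - j)) * l) (indicat_real B) x))
           / real (card (cube N :: (int ^ 'd) set)) < c0 * p\<^sup>2"
    using assms(2) unfolding dense_subsets_rich_def not_all not_imp not_le by (elim exE conjE) (rule that)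
  have "finite B" using B(1) assms(1) finite_subset by blast
  moreover have "0 < real (card (cube N :: (int ^ 'd) set))" by (simp add: card_cube)
  ultimately have "(\<Sum>x\<in>B. \<Sum>y\<in>B. edge_weight r s J l x y) < c0 * p\<^sup>2 * card (cube N :: (int ^ 'd) set)"
    using less by (simp add: infsum_pairs divide_less_eq)
  then show ?thesis using B l by blast
qed

text \<open>
  The constant \<open>c1\<close> is chosen such that spheres with \<open>l \<ge> c1 p^(-2/(d-2))\<close> have at least
  \<open>(J + 1) / (\<tau> p)\<close> points. Then no edge weight exceeds \<open>\<tau> p\<close>, and \<open>prob_dense_few_edges_le\<close> applies to
  each of the at most \<open>c2 N\<^sup>2 + 1\<close> radii.
\<close>

lemma prob_not_rich_le:
  fixes \<delta> :: real
  assumes d: "CARD('d::finite) \<ge> 5" and \<delta>: "0 < \<delta>" "\<delta> < 1"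
  shows "\<exists>(r::nat) (s::nat) (J::nat) (c0::real) (c1::real) (c2::real).
    2 \<le> r \<and> r < s \<and> 0 < c0 \<and> 0 < c1 \<and> 0 < c2 \<and>
    (\<forall>(N::nat) (p::real). 0 < p \<longrightarrow> p \<le> 1 \<longrightarrow>
      measure_pmf.prob (binomial_subset (cube N :: (int ^ 'd) set) p) {\<Omega>. \<not> dense_subsets_rich r s J c0 c1 c2 \<delta> N p \<Omega>}
      \<le> exp (- p * card (cube N :: (int ^ 'd) set) / 10)
        + (c2 * (real N)\<^sup>2 + 1) * exp (- (\<delta> / 8) * (p * card (cube N :: (int ^ 'd) set))))"
proof -
  define D where "D = real CARD('d)"
  have D: "D \<ge> 5" using d by (simp add: D_def)
  obtain r s J L :: nat and c2 :: real where sup: "2 \<le> r" "r < s" "1 \<le> L" "0 < c2"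
    "\<And>N l (A::(int^'d) set). L \<le> l \<Longrightarrow> l \<le> c2 * (real N)\<^sup>2 \<Longrightarrow> A \<subseteq> cube N \<Longrightarrow>
      \<delta> / 32 * card (cube N :: (int ^ 'd) set) \<le> card A \<Longrightarrow>
      real (card A) \<le> (\<Sum>x\<in>A. \<Sum>j=0..J. spherical_avg (r ^ j) (s ^ (2 * (J - j)) * l) (indicat_real A) x)"
  proof -
    have "0 < \<delta> / 32" "\<delta> / 32 \<le> 1" using \<delta> by auto
    from supersaturation[OF d this] show thesis using that by blast
  qed
  obtain c :: real and L' :: nat where c: "c > 0" "L' \<ge> 1"
    "\<And>l. l \<ge> L' \<Longrightarrow> c * real l powr ((D - 2) / 2) \<le> real (card (lattice_sphere l :: (int ^ 'd) set))"
    using card_sphere_ge_powr[OF d] unfolding D_def by blast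
  define \<tau> where "\<tau> = (\<delta> / 80)\<^sup>2"
  have \<tau>: "\<tau> > 0" using \<delta> by (simp add: \<tau>_def)
  define c0 where "c0 = \<tau> * \<delta> / 8"
  define c1 where "c1 = max (max 1 (real L)) (max (real L') ((real J + 1) / (c * \<tau>)))"
  have c1: "1 \<le> c1" "L \<le> c1" "L' \<le> c1" "(real J + 1) / (c * \<tau>) \<le> c1"
    by (simp_all add: c1_def)
  have "measure_pmf.prob (binomial_subset (cube N :: (int ^ 'd) set) p) {\<Omega>. \<not> dense_subsets_rich r s J c0 c1 c2 \<delta> N p \<Omega>}
      \<le> exp (- p * card (cube N :: (int ^ 'd) set) / 10)
        + (c2 * (real N)\<^sup>2 + 1) * exp (- (\<delta> / 8) * (p * card (cube N :: (int ^ 'd) set)))"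
    if p: "0 < p" "p \<le> 1" for N :: nat and p :: real
  proof -
    let ?Q = "cube N :: (int ^ 'd) set"
    let ?M = "binomial_subset ?Q p"
    let ?E = "exp (- (\<delta> / 8) * (p * card ?Q))"
    have finQ: "finite ?Q" by (rule finite_cube)
    have Qne: "?Q \<noteq> {}"
    proof
      assume "?Q = {}"
      then have "card ?Q = 0" by (simp only: card.empty)
      then show False by (simp add: card_cube)
    qed
    define Ls where "Ls = {l::nat. c1 * p powr (- 2 / (D - 2)) \<le> real l \<and> real l \<le> c2 * (real N)\<^sup>2}"
    have Ls_sub: "Ls \<subseteq> {..nat \<lfloor>c2 * (real N)\<^sup>2\<rfloor>}" by (auto simp: Ls_def le_nat_floor)
    then have finLs: "finite Ls" by (rule finite_subset) simp
    have cardLs: "real (card Ls) \<le> c2 * (real N)\<^sup>2 + 1"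
    proof -
      have "card Ls \<le> card {..nat \<lfloor>c2 * (real N)\<^sup>2\<rfloor>}" using Ls_sub by (intro card_mono) auto
      then have "real (card Ls) \<le> real (nat \<lfloor>c2 * (real N)\<^sup>2\<rfloor>) + 1" by simp
      also have "real (nat \<lfloor>c2 * (real N)\<^sup>2\<rfloor>) \<le> c2 * (real N)\<^sup>2" using sup(4) by (intro of_nat_floor) auto
      finally show ?thesis by simp
    qed
    define Bad where "Bad = (\<lambda>l. {\<Omega>. \<Omega> \<subseteq> ?Q \<and> p * card ?Q / 2 \<le> card \<Omega> \<and>
     (\<exists>B\<subseteq>\<Omega>. \<delta> * card \<Omega> \<le> card B \<and> (\<Sum>x\<in>B. \<Sum>y\<in>B. edge_weight r s J l x y) < \<tau> * \<delta> / 8 * p\<^sup>2 * card ?Q)})"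
    have bad: "measure_pmf.prob ?M (Bad l) \<le> ?E" if l: "l \<in> Ls" for l
    proof -
      have pw: "1 \<le> p powr (- 2 / (D - 2))" using one_le_powr_neg[OF p, of "2 / (D - 2)"] D by simp
      have "c1 * 1 \<le> c1 * p powr (- 2 / (D - 2))" using pw c1(1) by (intro mult_left_mono) auto
      then have lc1: "c1 \<le> real l" using l by (simp add: Ls_def)
      have lL: "L \<le> l" "L' \<le> l" using lc1 c1 by linarith+
      have l2: "real l \<le> c2 * (real N)\<^sup>2" using l by (simp add: Ls_def)
      define w where "w = (real J + 1) / (\<tau> * p)"
      have w0: "w > 0" using \<tau> p by (simp add: w_def add_nonneg_pos)
      have wl: "w \<le> real (card (lattice_sphere (s ^ (2 * (J - j)) * l) :: (int ^ 'd) set))" for j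
      proof -
        define l' where "l' = s ^ (2 * (J - j)) * l"
        have "1 * l \<le> l'" unfolding l'_def using sup(1,2) by (intro mult_right_mono one_le_power) auto
        then have l': "l \<le> l'" "L' \<le> l'" using lL by linarith+
        have "c1 / p \<le> c1 powr ((D - 2) / 2) * (1 / p)"
        proof -
          have "c1 powr 1 \<le> c1 powr ((D - 2) / 2)" using c1(1) D by (intro powr_mono) auto
          then have "c1 \<le> c1 powr ((D - 2) / 2)" using c1(1) by simp
          then show ?thesis using p by (simp add: divide_right_mono)
        qed
        also have "\<dots> = (c1 * p powr (- 2 / (D - 2))) powr ((D - 2) / 2)"
        proof -
          have "- 2 / (D - 2) * ((D - 2) / 2) = - 1" using D by (simp add: field_simps)
          then have "(p powr (- 2 / (D - 2))) powr ((D - 2) / 2) = p powr (- 1)" by (simp only: powr_powr)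
          also have "\<dots> = 1 / p" using p by (simp add: powr_minus divide_inverse)
          finally show ?thesis using c1(1) p by (simp add: powr_mult)
        qed
        also have "\<dots> \<le> real l powr ((D - 2) / 2)"
          using l c1(1) D by (intro powr_mono2) (auto simp: Ls_def)
        also have "\<dots> \<le> real l' powr ((D - 2) / 2)" using l'(1) D by (intro powr_mono2) auto
        finally have "c * (c1 / p) \<le> c * real l' powr ((D - 2) / 2)" using c(1) by (intro mult_left_mono) auto
        also have "\<dots> \<le> real (card (lattice_sphere l' :: (int ^ 'd) set))" by (rule c(3)[OF l'(2)])
        finally have "c * (c1 / p) \<le> real (card (lattice_sphere l' :: (int ^ 'd) set))" .
        moreover have "w \<le> c * (c1 / p)"
        proof -
          have "c * ((real J + 1) / (c * \<tau>)) \<le> c * c1" using c1(4) c(1) by (intro mult_left_mono) auto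
          moreover have "c * ((real J + 1) / (c * \<tau>)) = (real J + 1) / \<tau>" using c(1) by simp
          ultimately have "(real J + 1) / \<tau> / p \<le> c * c1 / p" using p by (intro divide_right_mono) auto
          then show ?thesis by (simp add: w_def)
        qed
        ultimately show ?thesis by (simp add: l'_def)
      qed
      have T: "edge_weight r s J l x y \<le> (\<delta> / 80)\<^sup>2 * p" for x y :: "int ^ 'd"
      proof -
        have "edge_weight r s J l x y \<le> (real J + 1) / w"
          using edge_weight_le[of r w J s l x y] sup(1) w0 wl by (simp add: add.commute)
        also have "\<dots> = \<tau> * p" using \<tau> p by (simp add: w_def add_nonneg_pos field_simps)
        finally show ?thesis by (simp add: \<tau>_def)
      qed
      have S: "real (card A) \<le> (\<Sum>x\<in>A. \<Sum>y\<in>A. edge_weight r s J l x y)"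
        if A: "A \<subseteq> ?Q" "\<delta> / 32 * card ?Q \<le> card A" for A
      proof -
        have "finite A" using A(1) finQ finite_subset by blast
        then show ?thesis using sup(5)[OF lL(1) l2 A] by (simp add: sum_edge_weight)
      qed
      show ?thesis unfolding Bad_def \<tau>_def
        by (rule prob_dense_few_edges_le[OF finQ Qne p \<delta> edge_weight_nonneg T S])
    qed
    have "measure_pmf.prob ?M {\<Omega>. \<not> dense_subsets_rich r s J c0 c1 c2 \<delta> N p \<Omega>}
      = measure_pmf.prob ?M ({\<Omega>. \<not> dense_subsets_rich r s J c0 c1 c2 \<delta> N p \<Omega>} \<inter> set_pmf ?M)"
      by (simp add: measure_Int_set_pmf)
    also have "\<dots> \<le> measure_pmf.prob ?M ({\<Omega>. real (card \<Omega>) < p * card ?Q / 2} \<union> (\<Union>l\<in>Ls. Bad l))"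
    proof (rule measure_pmf.finite_measure_mono)
      show "{\<Omega>. \<not> dense_subsets_rich r s J c0 c1 c2 \<delta> N p \<Omega>} \<inter> set_pmf ?M
        \<subseteq> {\<Omega>. real (card \<Omega>) < p * card ?Q / 2} \<union> (\<Union>l\<in>Ls. Bad l)"
      proof
        fix \<Omega> assume \<Omega>: "\<Omega> \<in> {\<Omega>. \<not> dense_subsets_rich r s J c0 c1 c2 \<delta> N p \<Omega>} \<inter> set_pmf ?M"
        then have sub: "\<Omega> \<subseteq> ?Q" using set_pmf_binomial_subset[OF finQ, of p] by blast
        then have fin: "finite \<Omega>" using finQ finite_subset by blast
        have "\<not> dense_subsets_rich r s J c0 c1 c2 \<delta> N p \<Omega>" using \<Omega> by simp
        from not_dense_subsets_richD[OF fin this] obtain l where l: "l \<in> Ls"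
          "\<exists>B\<subseteq>\<Omega>. \<delta> * card \<Omega> \<le> card B \<and> (\<Sum>x\<in>B. \<Sum>y\<in>B. edge_weight r s J l x y) < c0 * p\<^sup>2 * card ?Q"
          unfolding Ls_def D_def by blast
        show "\<Omega> \<in> {\<Omega>. real (card \<Omega>) < p * card ?Q / 2} \<union> (\<Union>l\<in>Ls. Bad l)"
        proof (cases "real (card \<Omega>) < p * card ?Q / 2")
          case False
          then have "\<Omega> \<in> Bad l" unfolding Bad_def using sub l(2) by (simp add: c0_def)
          then show ?thesis using l(1) by blast
        qed simp
      qed
    qed simp
    also have "\<dots> \<le> measure_pmf.prob ?M {\<Omega>. real (card \<Omega>) < p * card ?Q / 2} + measure_pmf.prob ?M (\<Union>l\<in>Ls. Bad l)"
      by (rule measure_Un_le) auto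
    also have "measure_pmf.prob ?M {\<Omega>. real (card \<Omega>) < p * card ?Q / 2} \<le> exp (- p * card ?Q / 10)"
      by (rule prob_small_binomial_subset[OF finQ]) (use p in auto)
    also have "measure_pmf.prob ?M (\<Union>l\<in>Ls. Bad l) \<le> (\<Sum>l\<in>Ls. measure_pmf.prob ?M (Bad l))"
      by (rule measure_pmf.finite_measure_subadditive_finite[OF finLs]) auto
    also have "\<dots> \<le> (\<Sum>l\<in>Ls. ?E)" by (intro sum_mono bad)
    also have "\<dots> \<le> (c2 * (real N)\<^sup>2 + 1) * ?E" using cardLs by (simp add: mult_right_mono)
    finally show ?thesis by simp
  qed
  then show ?thesis using sup c1 \<tau> \<delta>
    by (intro exI[of _ r] exI[of _ s] exI[of _ J] exI[of _ c0] exI[of _ c1] exI[of _ c2]) (auto simp: c0_def)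
qed

lemma not_dense_subsets_rich_empty:
  assumes "0 < c0" "0 < p" "c1 * p powr (- 2 / (real CARD('d) - 2)) \<le> real l" "real l \<le> c2 * (real N)\<^sup>2"
  shows "\<not> dense_subsets_rich r s J c0 c1 c2 \<delta> N p ({} :: (int ^ 'd::finite) set)"
proof
  assume "dense_subsets_rich r s J c0 c1 c2 \<delta> N p ({} :: (int ^ 'd) set)"
  then have "c0 * p\<^sup>2 \<le> 0" using assms(3,4) unfolding dense_subsets_rich_def by (auto dest!: spec[of _ "{}"])
  moreover have "0 < c0 * p\<^sup>2" using assms(1,2) by simp
  ultimately show False by simp
qed

lemma exp_minus_two_le:
  fixes p :: real
  assumes "0 \<le> p" "p \<le> 1/2"
  shows "exp (- 2 * p) \<le> 1 - p"
proof -
  have "p * p \<le> p * (1/2)" using assms by (intro mult_left_mono) auto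
  then have "- 2 * p \<le> - p - 2 * p\<^sup>2" by (simp add: power2_eq_square)
  also have "\<dots> \<le> ln (1 - p)" by (rule ln_one_minus_pos_lower_bound[OF assms])
  finally have "exp (- 2 * p) \<le> exp (ln (1 - p))" by simp
  then show ?thesis using assms by simp
qed

theorem theorem1:
  fixes \<delta> :: real
  assumes "CARD('d::finite) \<ge> 5" and "0 < \<delta>" and "\<delta> < 1"
  shows "\<exists>(r::nat) (s::nat) (J::nat) (c0::real) (c1::real) (c2::real).
    2 \<le> r \<and> r < s \<and> 0 < c0 \<and> 0 < c1 \<and> 0 < c2 \<and>
    (\<forall>\<gamma>::real. 0 < \<gamma> \<and> \<gamma> < real CARD('d) - 2 \<longrightarrow>
      (\<exists>c::real. 0 < c \<and>
        (\<forall>\<^sub>F N::nat in sequentially.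
          let p = real N powr (- \<gamma>) in
          measure_pmf.prob (binomial_subset (cube N :: (int ^ 'd) set) p)
              {\<Omega>. dense_subsets_rich r s J c0 c1 c2 \<delta> N p \<Omega>}
            \<ge> 1 - exp (- c * real N powr (real CARD('d) - \<gamma>)))) \<and>
      (\<exists>C::real. 0 < C \<and>
        (\<forall>\<^sub>F N::nat in sequentially.
          let p = real N powr (- \<gamma>);
              \<rho> = measure_pmf.prob (binomial_subset (cube N :: (int ^ 'd) set) p)
                    {\<Omega>. \<not> dense_subsets_rich r s J c0 c1 c2 \<delta> N p \<Omega>}
          in 0 < \<rho> \<and>
             inverse C * real N powr (real CARD('d) - \<gamma>) \<le> \<bar>ln \<rho>\<bar> \<and>
             \<bar>ln \<rho>\<bar> \<le> C * real N powr (real CARD('d) - \<gamma>))))"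
proof -
  define D where "D = real CARD('d)"
  have D: "D \<ge> 5" using assms(1) by (simp add: D_def)
  obtain r s J :: nat and c0 c1 c2 :: real where rs: "2 \<le> r" "r < s" "0 < c0" "0 < c1" "0 < c2"
    and rich: "\<And>(N::nat) (p::real). 0 < p \<Longrightarrow> p \<le> 1 \<Longrightarrow>
      measure_pmf.prob (binomial_subset (cube N :: (int ^ 'd) set) p) {\<Omega>. \<not> dense_subsets_rich r s J c0 c1 c2 \<delta> N p \<Omega>}
      \<le> exp (- p * card (cube N :: (int ^ 'd) set) / 10)
        + (c2 * (real N)\<^sup>2 + 1) * exp (- (\<delta> / 8) * (p * card (cube N :: (int ^ 'd) set)))"
    using prob_not_rich_le[OF assms] by blast
  have main: "\<exists>C>0. \<forall>\<^sub>F N::nat in sequentially.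
       (let p = real N powr (- \<gamma>); \<rho> = measure_pmf.prob (binomial_subset (cube N :: (int ^ 'd) set) p)
                    {\<Omega>. \<not> dense_subsets_rich r s J c0 c1 c2 \<delta> N p \<Omega>}; X = real N powr (D - \<gamma>)
        in \<rho> \<le> exp (- (\<delta> / 20) * X) \<and> 0 < \<rho> \<and> inverse C * X \<le> \<bar>ln \<rho>\<bar> \<and> \<bar>ln \<rho>\<bar> \<le> C * X)"
    if \<gamma>: "0 < \<gamma>" "\<gamma> < D - 2" for \<gamma>
  proof -
    define e where "e = D - \<gamma>"
    have e: "e > 2" using \<gamma> by (simp add: e_def)
    define e' where "e' = \<gamma> * (2 / (D - 2))"
    have e': "e' > 0" "e' < 2" using \<gamma> D by (auto simp: e'_def field_simps)
    define C where "C = max (20 / \<delta>) (2 * 3 ^ CARD('d))"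
    have C: "20 / \<delta> \<le> C" "2 * 3 ^ CARD('d) \<le> C" "C > 0" using assms(2) by (auto simp: C_def less_max_iff_disj)
    have \<delta>0: "\<delta> > 0" by (rule assms(2))
    \<comment> \<open>The number of radii is polynomial in \<open>N\<close> and is absorbed by halving the exponent.\<close>
    have ev1: "\<forall>\<^sub>F N::nat in sequentially. (c2 * (real N)\<^sup>2 + 2) * exp (- (\<delta> / 10) * real N powr e) \<le> exp (- (\<delta> / 20) * real N powr e)"
      using e rs(5) \<delta>0 by real_asymp
    \<comment> \<open>The range of radii contains an integer for large \<open>N\<close>, since \<open>\<gamma> < d - 2\<close> means \<open>e' < 2\<close>. Without this the
      failure event could be empty and its probability 0.\<close>
    have ev2: "\<forall>\<^sub>F N::nat in sequentially. c1 * real N powr e' + 1 \<le> c2 * (real N)\<^sup>2"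
      using e' rs(4,5) by real_asymp
    have ev3: "\<forall>\<^sub>F N::nat in sequentially. real N powr (- \<gamma>) \<le> 1 / 2"
      using \<gamma>(1) by real_asymp
    have "\<forall>\<^sub>F N::nat in sequentially.
       (let p = real N powr (- \<gamma>); \<rho> = measure_pmf.prob (binomial_subset (cube N :: (int ^ 'd) set) p)
                    {\<Omega>. \<not> dense_subsets_rich r s J c0 c1 c2 \<delta> N p \<Omega>}; X = real N powr (D - \<gamma>)
        in \<rho> \<le> exp (- (\<delta> / 20) * X) \<and> 0 < \<rho> \<and> inverse C * X \<le> \<bar>ln \<rho>\<bar> \<and> \<bar>ln \<rho>\<bar> \<le> C * X)"
      using ev1 ev2 ev3 eventually_ge_at_top[of 1]
    proof eventually_elim
      case (elim N)
      define p where "p = real N powr (- \<gamma>)"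
      define X where "X = real N powr e"
      define n where "n = real (card (cube N :: (int ^ 'd) set))"
      define \<rho> where "\<rho> = measure_pmf.prob (binomial_subset (cube N :: (int ^ 'd) set) p)
                    {\<Omega>. \<not> dense_subsets_rich r s J c0 c1 c2 \<delta> N p \<Omega>}"
      have N0: "real N > 0" using elim(4) by simp
      have p: "0 < p" "p \<le> 1/2" "p \<le> 1" using elim(3) N0 by (auto simp: p_def)
      have X0: "X > 0" using N0 by (simp add: X_def)
      have pN: "p * real N ^ CARD('d) = X"
      proof -
        have "real N ^ CARD('d) = real N powr D" using N0 by (simp add: D_def powr_realpow)
        then show ?thesis unfolding p_def X_def e_def by (simp add: powr_add[symmetric])
      qed
      have n: "real N ^ CARD('d) \<le> n" "n \<le> 3 ^ CARD('d) * real N ^ CARD('d)"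
      proof -
        have n: "n = (2 * real N + 1) ^ CARD('d)" by (simp add: n_def card_cube add.commute)
        show "real N ^ CARD('d) \<le> n" unfolding n by (intro power_mono) auto
        have "(2 * real N + 1) ^ CARD('d) \<le> (3 * real N) ^ CARD('d)" using elim(4) by (intro power_mono) auto
        then show "n \<le> 3 ^ CARD('d) * real N ^ CARD('d)" unfolding n by (simp only: power_mult_distrib)
      qed
      have pn1: "X \<le> p * n" unfolding pN[symmetric] using n p by (intro mult_left_mono) auto
      have pn2: "p * n \<le> 3 ^ CARD('d) * X"
      proof -
        have "p * n \<le> p * (3 ^ CARD('d) * real N ^ CARD('d))" using n p by (intro mult_left_mono) auto
        then show ?thesis unfolding pN[symmetric] by (simp only: mult_ac)
      qed
      have \<rho>1: "\<rho> \<le> exp (- (\<delta> / 20) * X)"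
      proof -
        have "\<rho> \<le> exp (- p * n / 10) + (c2 * (real N)\<^sup>2 + 1) * exp (- (\<delta> / 8) * (p * n))"
          unfolding \<rho>_def n_def by (rule rich) (use p in auto)
        also have "\<dots> \<le> exp (- (\<delta> / 10) * X) + (c2 * (real N)\<^sup>2 + 1) * exp (- (\<delta> / 10) * X)"
        proof (intro add_mono mult_left_mono)
          have "\<delta> * X \<le> 1 * (p * n)" using pn1 X0 assms(2,3) by (intro mult_mono) auto
          then show "exp (- p * n / 10) \<le> exp (- (\<delta> / 10) * X)" by simp
          have "\<delta> / 10 * X \<le> \<delta> / 8 * (p * n)" using pn1 X0 assms(2) by (intro mult_mono) auto
          then show "exp (- (\<delta> / 8) * (p * n)) \<le> exp (- (\<delta> / 10) * X)" by simp
        qed (use rs in auto)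
        also have "\<dots> = (c2 * (real N)\<^sup>2 + 2) * exp (- (\<delta> / 10) * X)" by (simp add: algebra_simps)
        also have "\<dots> \<le> exp (- (\<delta> / 20) * X)" using elim(1) by (simp only: X_def)
        finally show ?thesis .
      qed
      have \<rho>2: "exp (- 2 * (p * n)) \<le> \<rho>"
      proof -
        define l where "l = nat \<lceil>c1 * real N powr e'\<rceil>"
        have l: "c1 * real N powr e' \<le> real l" "real l \<le> c1 * real N powr e' + 1"
          using rs(4) unfolding l_def by (auto simp: of_nat_ceiling)
        have pe: "p powr (- 2 / (real CARD('d) - 2)) = real N powr e'"
          unfolding p_def e'_def D_def by (simp add: powr_powr)
        have "\<not> dense_subsets_rich r s J c0 c1 c2 \<delta> N p ({} :: (int ^ 'd) set)"
          by (rule not_dense_subsets_rich_empty[OF rs(3) p(1), where l = l]) (use l elim(2) pe in auto)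
        then have "measure_pmf.prob (binomial_subset (cube N :: (int ^ 'd) set) p) {{}} \<le> \<rho>"
          unfolding \<rho>_def by (intro measure_pmf.finite_measure_mono) auto
        moreover have "(1 - p) ^ card (cube N :: (int ^ 'd) set) \<le> measure_pmf.prob (binomial_subset (cube N :: (int ^ 'd) set) p) {{}}"
          by (rule prob_empty_binomial_subset[OF finite_cube]) (use p in auto)
        moreover have "exp (- 2 * p) ^ card (cube N :: (int ^ 'd) set) \<le> (1 - p) ^ card (cube N :: (int ^ 'd) set)"
          using exp_minus_two_le[of p] p by (intro power_mono) auto
        moreover have "exp (- 2 * p) ^ card (cube N :: (int ^ 'd) set) = exp (- 2 * (p * n))"
          unfolding exp_of_nat_mult[symmetric] n_def by (rule arg_cong[of _ _ exp]) (simp add: mult_ac)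
        ultimately show ?thesis by linarith
      qed
      have \<rho>0: "0 < \<rho>" using \<rho>2 exp_gt_zero[of "- 2 * (p * n)"] by linarith
      have "ln \<rho> \<le> ln (exp (- (\<delta> / 20) * X))" by (rule ln_mono[OF \<rho>1 \<rho>0])
      then have up: "ln \<rho> \<le> - (\<delta> / 20) * X" by (simp only: ln_exp)
      have "ln (exp (- 2 * (p * n))) \<le> ln \<rho>" by (rule ln_mono[OF \<rho>2]) simp
      then have lo: "- 2 * (p * n) \<le> ln \<rho>" by (simp only: ln_exp)
      have "0 \<le> \<delta> / 20 * X" using assms(2) X0 by simp
      then have abs: "\<bar>ln \<rho>\<bar> = - ln \<rho>" using up by simp
      have "inverse C * X \<le> \<delta> / 20 * X"
      proof (intro mult_right_mono)
        have "1 / C \<le> 1 / (20 / \<delta>)" using C assms(2) by (intro divide_left_mono) auto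
        then show "inverse C \<le> \<delta> / 20" by (simp add: inverse_eq_divide)
      qed (use X0 in auto)
      then have 1: "inverse C * X \<le> \<bar>ln \<rho>\<bar>" unfolding abs using up by linarith
      have "2 * 3 ^ CARD('d) * X \<le> C * X" using C X0 by (intro mult_right_mono) auto
      then have 2: "\<bar>ln \<rho>\<bar> \<le> C * X" unfolding abs using lo pn2 by linarith
      show ?case unfolding Let_def using \<rho>1 \<rho>0 1 2 by (simp only: \<rho>_def p_def X_def e_def simp_thms)
    qed
    then show ?thesis using C(3) by blast
  qed
  have compl: "measure_pmf.prob M {\<Omega>. dense_subsets_rich r s J c0 c1 c2 \<delta> N p \<Omega>}
      = 1 - measure_pmf.prob M {\<Omega>. \<not> dense_subsets_rich r s J c0 c1 c2 \<delta> N p \<Omega>}"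
    for M :: "(int ^ 'd) set pmf" and N p
  proof -
    have "{\<Omega>. dense_subsets_rich r s J c0 c1 c2 \<delta> N p \<Omega>}
      = space (measure_pmf M) - {\<Omega>. \<not> dense_subsets_rich r s J c0 c1 c2 \<delta> N p \<Omega>}" by auto
    then show ?thesis by (simp only:) (rule measure_pmf.prob_compl, simp)
  qed
  show ?thesis
  proof (rule exI[of _ r], rule exI[of _ s], rule exI[of _ J], rule exI[of _ c0], rule exI[of _ c1], rule exI[of _ c2], intro conjI allI impI rs)
    fix \<gamma> :: real assume "0 < \<gamma> \<and> \<gamma> < real CARD('d) - 2"
    then have "0 < \<gamma>" "\<gamma> < D - 2" by (auto simp: D_def)
    from main[OF this] obtain C where C: "C > 0" and ev: "\<forall>\<^sub>F N::nat in sequentially.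
       (let p = real N powr (- \<gamma>); \<rho> = measure_pmf.prob (binomial_subset (cube N :: (int ^ 'd) set) p)
                    {\<Omega>. \<not> dense_subsets_rich r s J c0 c1 c2 \<delta> N p \<Omega>}; X = real N powr (D - \<gamma>)
        in \<rho> \<le> exp (- (\<delta> / 20) * X) \<and> 0 < \<rho> \<and> inverse C * X \<le> \<bar>ln \<rho>\<bar> \<and> \<bar>ln \<rho>\<bar> \<le> C * X)" by blast
    have "0 < \<delta> / 20" using assms(2) by simp
    moreover have "\<forall>\<^sub>F N::nat in sequentially.
          let p = real N powr (- \<gamma>) in
          measure_pmf.prob (binomial_subset (cube N :: (int ^ 'd) set) p)
              {\<Omega>. dense_subsets_rich r s J c0 c1 c2 \<delta> N p \<Omega>}
            \<ge> 1 - exp (- (\<delta> / 20) * real N powr (real CARD('d) - \<gamma>))"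
      using ev by eventually_elim (simp add: Let_def compl D_def)
    ultimately show "\<exists>c::real. 0 < c \<and>
        (\<forall>\<^sub>F N::nat in sequentially.
          let p = real N powr (- \<gamma>) in
          measure_pmf.prob (binomial_subset (cube N :: (int ^ 'd) set) p)
              {\<Omega>. dense_subsets_rich r s J c0 c1 c2 \<delta> N p \<Omega>}
            \<ge> 1 - exp (- c * real N powr (real CARD('d) - \<gamma>)))"
      by (intro exI[of _ "\<delta> / 20"] conjI)
    have "\<forall>\<^sub>F N::nat in sequentially.
          let p = real N powr (- \<gamma>);
              \<rho> = measure_pmf.prob (binomial_subset (cube N :: (int ^ 'd) set) p)
                    {\<Omega>. \<not> dense_subsets_rich r s J c0 c1 c2 \<delta> N p \<Omega>}
          in 0 < \<rho> \<and>
             inverse C * real N powr (real CARD('d) - \<gamma>) \<le> \<bar>ln \<rho>\<bar> \<and>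
             \<bar>ln \<rho>\<bar> \<le> C * real N powr (real CARD('d) - \<gamma>)"
      using ev by eventually_elim (simp only: Let_def D_def)
    with C show "\<exists>C::real. 0 < C \<and>
        (\<forall>\<^sub>F N::nat in sequentially.
          let p = real N powr (- \<gamma>);
              \<rho> = measure_pmf.prob (binomial_subset (cube N :: (int ^ 'd) set) p)
                    {\<Omega>. \<not> dense_subsets_rich r s J c0 c1 c2 \<delta> N p \<Omega>}
          in 0 < \<rho> \<and>
             inverse C * real N powr (real CARD('d) - \<gamma>) \<le> \<bar>ln \<rho>\<bar> \<and>
             \<bar>ln \<rho>\<bar> \<le> C * real N powr (real CARD('d) - \<gamma>))"
      by (intro exI[of _ C] conjI)
  qed
qed

end
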